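(* Let $(M^7,\varphi)$ be a $7$-manifold with a $G_2$-structure $\varphi$, let $g=g_\varphi$ be the associated Riemannian metric and $\nabla$ the Levi-Civita connection of $g$. Let $Cr_\varphi\in\Omega^2(M^7,TM^7)$ and $\chi_\varphi\in\Omega^3(M^7,TM^7)$ be the associated $2$-fold and $3$-fold cross products and let $[\cdot,\cdot]^{FN}$ be the Frölicher–Nijenhuis bracket. Then for every $p\in M^7$ the following are equivalent: (1) The $G_2$-structure is torsion-free at $p$, i.e. $(\nabla\varphi)_p=0$. (2) $[Cr_\varphi,\chi_\varphi]^{FN}_p=0\in\Lambda^5T_p^*M^7\otimes T_pM^7$. (3) $[\chi_\varphi,\chi_\varphi]^{FN}_p=0\in\Lambda^6T_p^*M^7\otimes T_pM^7$.
   Context: All objects are smooth. $\Omega^k(M,TM)$ denotes the $TM$-valued $k$-forms. $G_2$-structure: on an oriented $7$-manifold $M$, a $3$-form $\varphi\in\Omega^3(M)$ such that at each $p\in M$ there is a positively oriented basis $(e_i)_{i=1}^7$ of $T_pM$ with dual basis $(e^i)$ (a $G_2$-frame) with $\varphi_p=e^{123}+e^{145}+e^{167}+e^{246}-e^{257}-e^{347}-e^{356}$, where $e^{i_1\cdots i_k}=e^{i_1}\wedge\cdots\wedge e^{i_k}$. There is a unique Riemannian metric $g_\varphi$ for which every $G_2$-frame is orthonormal; $\ast$ is its Hodge star, so $\ast\varphi=e^{4567}+e^{2367}+e^{2345}+e^{1357}-e^{1346}-e^{1256}-e^{1247}$ in a $G_2$-frame. Cross products: for a Riemannian metric $g$ and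 a $(k+1)$-form $\Psi$, $\delta_g(\Psi):=\sum_i(\imath_{e_i}\Psi)\otimes(e^i)^\#$ (any local frame $(e_i)$ with dual frame $(e^i)$). $Cr_\varphi:=\delta_{g_\varphi}(\varphi)$ and $\chi_\varphi:=-\delta_{g_\varphi}(\ast\varphi)$, i.e. $g_\varphi(Cr_\varphi(x,y),z)=\varphi(x,y,z)$ and $g_\varphi(\chi_\varphi(x,y,z),w)=\ast\varphi(x,y,z,w)$. Frölicher–Nijenhuis bracket: the $\mathbb{R}$-bilinear bracket $[\cdot,\cdot]^{FN}:\Omega^k(M,TM)\times\Omega^l(M,TM)\to\Omega^{k+l}(M,TM)$ given for $\alpha\in\Omega^k(M)$, $\beta\in\Omega^l(M)$ and vector fields $X_1,X_2$ by $[\alpha\otimes X_1,\beta\otimes X_2]^{FN}=\alpha\wedge\beta\otimes[X_1,X_2]+\alpha\wedge\mathcal{L}_{X_1}\beta\otimes X_2-\mathcal{L}_{X_2}\alpha\wedge\beta\otimes X_1+(-1)^k\big(d\alpha\wedge(\imath_{X_1}\beta)\otimes X_2+(\imath_{X_2}\alpha)\wedge d\beta\otimes X_1\big)$, where $\mathcal{L}$ is the Lie derivative and $\imath$ is contraction. The subscript $p$ denotes the value at $p$. *)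

theory Defs
  imports "HOL-Analysis.Analysis"
begin

section \<open>Smooth maps\<close>

primrec Ck_on :: "nat \<Rightarrow> ('a::real_normed_vector \<Rightarrow> 'b::real_normed_vector) \<Rightarrow> 'a set \<Rightarrow> bool" where
  "Ck_on 0 f S \<longleftrightarrow> continuous_on S f"
| "Ck_on (Suc k) f S \<longleftrightarrow>
     (\<forall>x\<in>S. f differentiable (at x)) \<and>
     (\<forall>v. Ck_on k (\<lambda>x. frechet_derivative f (at x) v) S)"

text \<open>Only used for open \<open>S\<close>.\<close>
definition smooth_on :: "('a::real_normed_vector \<Rightarrow> 'b::real_normed_vector) \<Rightarrow> 'a set \<Rightarrow> bool" where
  "smooth_on f S \<longleftrightarrow> (\<forall>k. Ck_on k f S)"

abbreviation deriv_at :: "('a::real_normed_vector \<Rightarrow> 'b::real_normed_vector) \<Rightarrow> 'a \<Rightarrow> 'a \<Rightarrow> 'b" where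
  "deriv_at f x \<equiv> frechet_derivative f (at x)"


section \<open>Oriented smooth manifolds\<close>

text \<open>A chart is a domain together with a coordinate map (irrelevant outside the domain).\<close>
type_synonym ('a, 'n) chart = "'a set \<times> ('a \<Rightarrow> real^'n)"

definition chart_image :: "('a, 'n) chart \<Rightarrow> (real^'n) set" where
  "chart_image c = snd c ` fst c"

definition chart_on :: "'a topology \<Rightarrow> ('a, 'n::finite) chart \<Rightarrow> bool" where
  "chart_on X c \<longleftrightarrow>
     openin X (fst c) \<and> open (chart_image c) \<and>
     homeomorphic_map (subtopology X (fst c)) (top_of_set (chart_image c)) (snd c)"

definition overlap :: "('a, 'n) chart \<Rightarrow> ('a, 'n) chart \<Rightarrow> (real^'n) set" where
  "overlap c d = snd c ` (fst c \<inter> fst d)"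

definition transition :: "('a, 'n) chart \<Rightarrow> ('a, 'n) chart \<Rightarrow> real^'n \<Rightarrow> real^'n" where
  "transition c d = snd d \<circ> inv_into (fst c) (snd c)"

text \<open>
  The smooth structure and the orientation are both given by an atlas whose transition maps are
  smooth with positive Jacobian determinant. The atlas need not be maximal.
\<close>
definition oriented_manifold :: "'a topology \<Rightarrow> ('a, 'n::finite) chart set \<Rightarrow> bool" where
  "oriented_manifold X A \<longleftrightarrow>
     Hausdorff_space X \<and> second_countable X \<and>
     (\<forall>c\<in>A. chart_on X c) \<and> \<Union> (fst ` A) = topspace X \<and>
     (\<forall>c\<in>A. \<forall>d\<in>A. smooth_on (transition c d) (overlap c d) \<and>
        (\<forall>x\<in>overlap c d. 0 < det (matrix (deriv_at (transition c d) x))))"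


section \<open>Alternating forms on coordinate space\<close>

text \<open>
  A \<open>k\<close>-linear map takes its arguments as a sequence and depends on the first \<open>k\<close> entries only.
  With values in the coordinate space itself, the same type is used for vector-valued forms.
\<close>
type_synonym ('n, 'b) mform = "(nat \<Rightarrow> real^'n) \<Rightarrow> 'b"

definition alternating :: "nat \<Rightarrow> ('n::finite, 'b::real_vector) mform \<Rightarrow> bool" where
  "alternating k a \<longleftrightarrow>
     (\<forall>v w. (\<forall>i<k. v i = w i) \<longrightarrow> a v = a w) \<and>
     (\<forall>i<k. \<forall>v. linear (\<lambda>u. a (v(i := u)))) \<and>
     (\<forall>i<k. \<forall>j<k. \<forall>v. i \<noteq> j \<and> v i = v j \<longrightarrow> a v = 0)"

definition wedge :: "nat \<Rightarrow> nat \<Rightarrow> ('n, real) mform \<Rightarrow> ('n, real) mform \<Rightarrow> ('n, real) mform" where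
  "wedge k l a b v =
     (\<Sum>\<sigma> | \<sigma> permutes {..<k + l}.
        of_int (sign \<sigma>) * a (\<lambda>n. v (\<sigma> n)) * b (\<lambda>n. v (\<sigma> (k + n)))) / (fact k * fact l)"

text \<open>Contraction of a \<open>k\<close>-form; zero on \<open>0\<close>-forms.\<close>
definition interior_prod :: "nat \<Rightarrow> real^'n \<Rightarrow> ('n, 'b::zero) mform \<Rightarrow> ('n, 'b) mform" where
  "interior_prod k u a v = (if k = 0 then 0 else a (case_nat u v))"

text \<open>
  For covectors \<open>\<epsilon> i\<close> and indices \<open>i\<^sub>1, \<dots>, i\<^sub>k\<close>, this is
  \<open>\<epsilon> i\<^sub>1 \<and> \<dots> \<and> \<epsilon> i\<^sub>k\<close>, normalised as for \<^const>\<open>wedge\<close>, i.e.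
  \<open>(v\<^sub>1, \<dots>, v\<^sub>k) \<mapsto> det (\<epsilon> i\<^sub>r v\<^sub>s)\<close>.
\<close>
definition wedge_list :: "('i \<Rightarrow> real^'n \<Rightarrow> real) \<Rightarrow> 'i list \<Rightarrow> ('n, real) mform" where
  "wedge_list \<epsilon> is v =
     (\<Sum>\<sigma> | \<sigma> permutes {..<length is}.
        of_int (sign \<sigma>) * (\<Prod>r<length is. \<epsilon> (is ! r) (v (\<sigma> r))))"


section \<open>Calculus on open subsets of coordinate space\<close>

definition ext_deriv ::
  "nat \<Rightarrow> (real^'n \<Rightarrow> ('n::finite, real) mform) \<Rightarrow> real^'n \<Rightarrow> ('n, real) mform" where
  "ext_deriv k \<alpha> x v =
     (\<Sum>i\<le>k. (-1) ^ i * deriv_at (\<lambda>y. \<alpha> y (\<lambda>n. if n < i then v n else v (Suc n))) x (v i))"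

definition lie_bracket ::
  "(real^'n \<Rightarrow> real^'n) \<Rightarrow> (real^'n \<Rightarrow> real^'n) \<Rightarrow> real^'n::finite \<Rightarrow> real^'n" where
  "lie_bracket X Y x = deriv_at Y x (X x) - deriv_at X x (Y x)"

text \<open>
  The formula \<open>(\<L>\<^sub>X \<alpha>)(v\<^sub>1, \<dots>) = X (\<alpha>(v\<^sub>1, \<dots>)) - \<Sum>\<^sub>i \<alpha>(\<dots>, [X, v\<^sub>i], \<dots>)\<close>
  for constant \<open>v\<^sub>i\<close>, where \<open>[X, v\<^sub>i]\<close> is minus the derivative of \<open>X\<close> in direction \<open>v\<^sub>i\<close>.
\<close>
definition lie_deriv ::
  "(real^'n \<Rightarrow> real^'n) \<Rightarrow> nat \<Rightarrow> (real^'n \<Rightarrow> ('n::finite, real) mform) \<Rightarrow>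
   real^'n \<Rightarrow> ('n, real) mform" where
  "lie_deriv X k \<alpha> x v =
     deriv_at (\<lambda>y. \<alpha> y v) x (X x) + (\<Sum>i<k. \<alpha> x (v(i := deriv_at X x (v i))))"

text \<open>The bracket of the decomposable forms \<open>\<alpha> \<otimes> X\<close> and \<open>\<beta> \<otimes> Y\<close> of degrees \<open>k\<close> and \<open>l\<close>.\<close>
definition fn_decomposable ::
  "nat \<Rightarrow> (real^'n \<Rightarrow> ('n::finite, real) mform) \<Rightarrow> (real^'n \<Rightarrow> real^'n) \<Rightarrow>
   nat \<Rightarrow> (real^'n \<Rightarrow> ('n, real) mform) \<Rightarrow> (real^'n \<Rightarrow> real^'n) \<Rightarrow>
   real^'n \<Rightarrow> ('n, real^'n) mform" where
  "fn_decomposable k \<alpha> X l \<beta> Y x v =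
     wedge k l (\<alpha> x) (\<beta> x) v *\<^sub>R lie_bracket X Y x
     + wedge k l (\<alpha> x) (lie_deriv X l \<beta> x) v *\<^sub>R Y x
     - wedge k l (lie_deriv Y k \<alpha> x) (\<beta> x) v *\<^sub>R X x
     + (-1) ^ k *\<^sub>R
        (wedge (k + 1) (l - 1) (ext_deriv k \<alpha> x) (interior_prod l (X x) (\<beta> x)) v *\<^sub>R Y x
         + wedge (k - 1) (l + 1) (interior_prod k (Y x) (\<alpha> x)) (ext_deriv l \<beta> x) v *\<^sub>R X x)"

text \<open>
  In coordinates every vector-valued form is \<open>K = \<Sum>\<^sub>i K\<^sup>i \<otimes> \<partial>\<^sub>i\<close> with scalar forms \<open>K\<^sup>i\<close>,
  so bilinearity determines the bracket from its values on decomposable forms.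
\<close>
definition fn_local ::
  "nat \<Rightarrow> (real^'n \<Rightarrow> ('n::finite, real^'n) mform) \<Rightarrow>
   nat \<Rightarrow> (real^'n \<Rightarrow> ('n, real^'n) mform) \<Rightarrow> real^'n \<Rightarrow> ('n, real^'n) mform" where
  "fn_local k K l L x v =
     (\<Sum>i\<in>UNIV. \<Sum>j\<in>UNIV.
        fn_decomposable k (\<lambda>y w. K y w $ i) (\<lambda>_. axis i 1) l (\<lambda>y w. L y w $ j) (\<lambda>_. axis j 1) x v)"


section \<open>Tensor fields on a manifold\<close>

text \<open>
  A tensor field on a manifold with atlas \<open>A\<close> is the family of its representatives in the charts:
  \<open>T c x\<close> is its value at the point with coordinates \<open>x\<close> in the chart \<open>c\<close>, where the tangent
  space is identified with the coordinate space by the coordinate frame of \<open>c\<close>.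
  Representatives in different charts are related by the transformation law.
\<close>
type_synonym ('a, 'n, 'b) field = "('a, 'n) chart \<Rightarrow> real^'n \<Rightarrow> 'b"

definition diff_form ::
  "('a, 'n) chart set \<Rightarrow> nat \<Rightarrow> ('a, 'n::finite, ('n, real) mform) field \<Rightarrow> bool" where
  "diff_form A k \<omega> \<longleftrightarrow>
     (\<forall>c\<in>A. (\<forall>x\<in>chart_image c. alternating k (\<omega> c x)) \<and>
            (\<forall>v. smooth_on (\<lambda>x. \<omega> c x v) (chart_image c))) \<and>
     (\<forall>c\<in>A. \<forall>d\<in>A. \<forall>x\<in>overlap c d. \<forall>v.
        \<omega> c x v = \<omega> d (transition c d x) (\<lambda>n. deriv_at (transition c d) x (v n)))"

definition riemannian_metric ::
  "('a, 'n) chart set \<Rightarrow> ('a, 'n::finite, real^'n \<Rightarrow> real^'n \<Rightarrow> real) field \<Rightarrow> bool" where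
  "riemannian_metric A g \<longleftrightarrow>
     (\<forall>c\<in>A. (\<forall>x\<in>chart_image c. bilinear (g c x) \<and> (\<forall>u v. g c x u v = g c x v u) \<and>
               (\<forall>u. u \<noteq> 0 \<longrightarrow> 0 < g c x u u)) \<and>
            (\<forall>u v. smooth_on (\<lambda>x. g c x u v) (chart_image c))) \<and>
     (\<forall>c\<in>A. \<forall>d\<in>A. \<forall>x\<in>overlap c d. \<forall>u v.
        g c x u v = g d (transition c d x)
          (deriv_at (transition c d) x u) (deriv_at (transition c d) x v))"

text \<open>
  A tensor vanishes iff its components do; by the transformation law it makes no difference
  whether this is asked of one or of every chart around \<open>p\<close>.
\<close>
definition vanishes_at ::
  "('a, 'n) chart set \<Rightarrow> 'a \<Rightarrow> ('a, 'n, ('n, 'b::zero) mform) field \<Rightarrow> bool" where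
  "vanishes_at A p T \<longleftrightarrow> (\<forall>c\<in>A. p \<in> fst c \<longrightarrow> (\<forall>v. T c (snd c p) v = 0))"

text \<open>The bracket is local and natural under diffeomorphisms, hence computed chart by chart.\<close>
definition fn_bracket ::
  "nat \<Rightarrow> ('a, 'n::finite, ('n, real^'n) mform) field \<Rightarrow>
   nat \<Rightarrow> ('a, 'n, ('n, real^'n) mform) field \<Rightarrow> ('a, 'n, ('n, real^'n) mform) field" where
  "fn_bracket k K l L c = fn_local k (K c) l (L c)"


section \<open>Connections\<close>

text \<open>
  An affine connection is given by the bilinear maps \<open>\<Gamma> c x\<close> with
  \<open>\<nabla>\<^sub>X Y = dY(X) + \<Gamma>(X, Y)\<close> in the chart \<open>c\<close>. The transformation law says that
  \<open>\<nabla>\<^sub>X Y\<close> does not depend on the chart.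
\<close>
definition affine_connection ::
  "('a, 'n) chart set \<Rightarrow> ('a, 'n::finite, real^'n \<Rightarrow> real^'n \<Rightarrow> real^'n) field \<Rightarrow> bool" where
  "affine_connection A \<Gamma> \<longleftrightarrow>
     (\<forall>c\<in>A. (\<forall>x\<in>chart_image c. bilinear (\<Gamma> c x)) \<and>
            (\<forall>u v. smooth_on (\<lambda>x. \<Gamma> c x u v) (chart_image c))) \<and>
     (\<forall>c\<in>A. \<forall>d\<in>A. \<forall>x\<in>overlap c d. \<forall>u v.
        deriv_at (transition c d) x (\<Gamma> c x u v) =
          deriv_at (\<lambda>y. deriv_at (transition c d) y v) x u
          + \<Gamma> d (transition c d x) (deriv_at (transition c d) x u) (deriv_at (transition c d) x v))"

definition cov_deriv_vec ::
  "(real^'n \<Rightarrow> real^'n \<Rightarrow> real^'n \<Rightarrow> real^'n) \<Rightarrow> (real^'n \<Rightarrow> real^'n) \<Rightarrow> (real^'n \<Rightarrow> real^'n) \<Rightarrow>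
   real^'n::finite \<Rightarrow> real^'n" where
  "cov_deriv_vec \<Gamma> X Y x = deriv_at Y x (X x) + \<Gamma> x (X x) (Y x)"

definition levi_civita ::
  "('a, 'n) chart set \<Rightarrow> ('a, 'n::finite, real^'n \<Rightarrow> real^'n \<Rightarrow> real) field \<Rightarrow>
   ('a, 'n, real^'n \<Rightarrow> real^'n \<Rightarrow> real^'n) field \<Rightarrow> bool" where
  "levi_civita A g \<Gamma> \<longleftrightarrow>
     affine_connection A \<Gamma> \<and>
     (\<forall>c\<in>A. \<forall>X Y. smooth_on X (chart_image c) \<and> smooth_on Y (chart_image c) \<longrightarrow>
        (\<forall>x\<in>chart_image c.
           cov_deriv_vec (\<Gamma> c) X Y x - cov_deriv_vec (\<Gamma> c) Y X x = lie_bracket X Y x)) \<and>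
     (\<forall>c\<in>A. \<forall>X Y Z. smooth_on X (chart_image c) \<and> smooth_on Y (chart_image c) \<and>
          smooth_on Z (chart_image c) \<longrightarrow>
        (\<forall>x\<in>chart_image c.
           deriv_at (\<lambda>y. g c y (Y y) (Z y)) x (X x) =
             g c x (cov_deriv_vec (\<Gamma> c) X Y x) (Z x) + g c x (Y x) (cov_deriv_vec (\<Gamma> c) X Z x)))"

text \<open>
  The covariant derivative of a \<open>k\<close>-form, as a \<open>(k+1)\<close>-linear map whose first argument is the
  direction of differentiation: \<open>(v\<^sub>0, v\<^sub>1, \<dots>) \<mapsto> (\<nabla>\<^bsub>v\<^sub>0\<^esub> \<omega>)(v\<^sub>1, \<dots>)\<close>.
\<close>
definition cov_deriv ::
  "('a, 'n::finite, real^'n \<Rightarrow> real^'n \<Rightarrow> real^'n) field \<Rightarrow> nat \<Rightarrow>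
   ('a, 'n, ('n, real) mform) field \<Rightarrow> ('a, 'n, ('n, real) mform) field" where
  "cov_deriv \<Gamma> k \<omega> c x v =
     deriv_at (\<lambda>y. \<omega> c y (\<lambda>n. v (Suc n))) x (v 0)
     - (\<Sum>i<k. \<omega> c x ((\<lambda>n. v (Suc n))(i := \<Gamma> c x (v 0) (v (Suc i)))))"


section \<open>Linear algebra of an inner product on coordinate space\<close>

definition gram :: "(real^'n \<Rightarrow> real^'n \<Rightarrow> real) \<Rightarrow> real^'n^'n::finite" where
  "gram g = (\<chi> i j. g (axis i 1) (axis j 1))"

text \<open>The vector \<open>w\<close> with \<open>g w u = \<alpha> u\<close> for all \<open>u\<close>, for a covector \<open>\<alpha>\<close>.\<close>
definition sharp :: "(real^'n \<Rightarrow> real^'n \<Rightarrow> real) \<Rightarrow> (real^'n \<Rightarrow> real) \<Rightarrow> real^'n::finite" where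
  "sharp g \<alpha> = matrix_inv (gram g) *v (\<chi> i. \<alpha> (axis i 1))"

text \<open>\<open>\<delta>\<^sub>g(\<Psi>)\<close>, computed in the coordinate frame; its value does not depend on the frame.\<close>
definition delta_form ::
  "(real^'n \<Rightarrow> real^'n \<Rightarrow> real) \<Rightarrow> ('n::finite, real) mform \<Rightarrow> ('n, real^'n) mform" where
  "delta_form g \<Psi> v = (\<Sum>i\<in>UNIV. \<Psi> (case_nat (axis i 1) v) *\<^sub>R sharp g (\<lambda>u. u $ i))"

definition vol_form :: "(real^7 \<Rightarrow> real^7 \<Rightarrow> real) \<Rightarrow> (7, real) mform" where
  "vol_form g v = sqrt (det (gram g)) * wedge_list (\<lambda>i u. u $ i) [1, 2, 3, 4, 5, 6, 7] v"

text \<open>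
  The Hodge star of a \<open>k\<close>-form with respect to \<open>g\<close> and the standard orientation, by
  \<open>(\<star>\<omega>)(v\<^sub>1, \<dots>) = 1/k! \<Sum> \<omega>(e\<^sup>i\<^sub>1\<sharp>, \<dots>, e\<^sup>i\<^sub>k\<sharp>) vol(e\<^sub>i\<^sub>1, \<dots>, e\<^sub>i\<^sub>k, v\<^sub>1, \<dots>)\<close>
  (sum over all index tuples).
\<close>
definition hodge ::
  "(real^7 \<Rightarrow> real^7 \<Rightarrow> real) \<Rightarrow> nat \<Rightarrow> (7, real) mform \<Rightarrow> (7, real) mform" where
  "hodge g k \<omega> v =
     (\<Sum>I \<in> {..<k} \<rightarrow>\<^sub>E UNIV.
        \<omega> (\<lambda>n. sharp g (\<lambda>u. u $ I n))
        * vol_form g (\<lambda>n. if n < k then axis (I n) 1 else v (n - k))) / fact k"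


section \<open>G2-structures\<close>

text \<open>The matrix with columns \<open>e i\<close>, and the covectors dual to a basis \<open>e\<close>.\<close>
definition frame_matrix :: "('n \<Rightarrow> real^'n) \<Rightarrow> real^'n^'n::finite" where
  "frame_matrix e = (\<chi> i j. e j $ i)"

definition dual_basis :: "('n \<Rightarrow> real^'n) \<Rightarrow> 'n \<Rightarrow> real^'n::finite \<Rightarrow> real" where
  "dual_basis e i u = (matrix_inv (frame_matrix e) *v u) $ i"

text \<open>
  Since all charts are compatible with the orientation, a positive determinant means a positively
  oriented basis. The indices have type \<open>7\<close>, where \<open>7 = 0\<close>.
\<close>
definition g2_frame :: "(7, real) mform \<Rightarrow> (7 \<Rightarrow> real^7) \<Rightarrow> bool" where
  "g2_frame a e \<longleftrightarrow>
     0 < det (frame_matrix e) \<and>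
     (let E = wedge_list (dual_basis e) in
      \<forall>v. a v = E [1,2,3] v + E [1,4,5] v + E [1,6,7] v + E [2,4,6] v
                - E [2,5,7] v - E [3,4,7] v - E [3,5,6] v)"

definition g2_structure :: "('a, 7) chart set \<Rightarrow> ('a, 7, (7, real) mform) field \<Rightarrow> bool" where
  "g2_structure A \<phi> \<longleftrightarrow>
     diff_form A 3 \<phi> \<and> (\<forall>c\<in>A. \<forall>x\<in>chart_image c. \<exists>e. g2_frame (\<phi> c x) e)"

text \<open>There is exactly one such \<open>g\<close> (on the chart images) for a G2-structure \<open>\<phi>\<close>.\<close>
definition g2_metric ::
  "('a, 7) chart set \<Rightarrow> ('a, 7, (7, real) mform) field \<Rightarrow>
   ('a, 7, real^7 \<Rightarrow> real^7 \<Rightarrow> real) field \<Rightarrow> bool" where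
  "g2_metric A \<phi> g \<longleftrightarrow>
     riemannian_metric A g \<and>
     (\<forall>c\<in>A. \<forall>x\<in>chart_image c. \<forall>e. g2_frame (\<phi> c x) e \<longrightarrow>
        (\<forall>i j. g c x (e i) (e j) = (if i = j then 1 else 0)))"

definition two_fold_cross ::
  "('a, 7, real^7 \<Rightarrow> real^7 \<Rightarrow> real) field \<Rightarrow> ('a, 7, (7, real) mform) field \<Rightarrow>
   ('a, 7, (7, real^7) mform) field" where
  "two_fold_cross g \<phi> c x = delta_form (g c x) (\<phi> c x)"

definition three_fold_cross ::
  "('a, 7, real^7 \<Rightarrow> real^7 \<Rightarrow> real) field \<Rightarrow> ('a, 7, (7, real) mform) field \<Rightarrow>
   ('a, 7, (7, real^7) mform) field" where
  "three_fold_cross g \<phi> c x v = - delta_form (g c x) (hodge (g c x) 3 (\<phi> c x)) v"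

end

theory Submission
  imports Defs
begin

text \<open>
  Fix a chart and a point \<open>p\<close>, and write \<open>\<times>\<close> for \<open>Cr\<close>. Expanding the wedge products over shuffles turns
  the bracket of \<open>K\<close> and \<open>L\<close> into a signed sum of terms such as \<open>D\<^bsub>K(\<dots>)\<^esub> L(\<dots>)\<close> and \<open>L((D\<^bsub>v\<^esub> K)(\<dots>), \<dots>)\<close>,
  and the partial derivatives may be replaced by covariant ones because the Levi-Civita connection is
  torsion-free. Near \<open>p\<close> we have \<open>\<chi>(a, b, c) = g(a, c) b - g(a, b) c - a \<times> (b \<times> c)\<close>, so \<open>\<nabla>\<chi>\<close> is
  determined by \<open>\<nabla>Cr\<close>, that is, by \<open>\<nabla>\<phi>\<close>; in particular both brackets vanish if \<open>(\<nabla>\<phi>)\<^sub>p = 0\<close>.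

  Conversely, \<open>\<nabla>\<^sub>u \<chi>\<close> is alternating, which says \<open>(\<nabla>\<^sub>u Cr)(a, a \<times> b) = - a \<times> (\<nabla>\<^sub>u Cr)(a, b)\<close>. This forces
  \<open>\<nabla>\<^sub>u \<phi>\<close> to be the contraction of \<open>\<star>\<phi>\<close> with a vector \<open>T(u)\<close>, and the \<open>49\<close> components of \<open>T\<close> in a
  \<open>G\<^sub>2\<close>-frame are the only unknowns left. Evaluated on frame vectors, each bracket becomes a system of
  linear equations for these components whose only solution is \<open>T = 0\<close>.
\<close>

section \<open>Alternating forms and wedge products\<close>

text \<open>No smooth local \<open>G\<^sub>2\<close>-frame is constructed. A frame is chosen
  separately at each point and serves to prove identities between the metric and the cross products
  that do not mention it. These identities hold throughout the chart and can therefore be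
  differentiated. Components in a frame are needed only at the one point where the brackets are
  evaluated.

  A symmetry splits the final linear systems. Read the indices 1 to 7 in binary, as the nonzero
  vectors of a three-dimensional space over the field with two elements. Each triple of indices
  occurring in \<phi> has bitwise sum zero, so \<phi> is preserved if every \<open>e i\<close> is
  multiplied by a sign that depends multiplicatively on its label. Consequently a given component of
  a bracket contains only those \<open>T (e i) m\<close> for which the bitwise sum of
  \<open>i\<close> and \<open>m\<close> has one prescribed value. The 49 unknowns fall into the
  seven diagonal ones and seven blocks of six, the block of \<open>k\<close> consisting of the
  \<open>T (e i) m\<close> with \<open>e i \<times> e m\<close> equal to \<open>e k\<close> up to
  sign.\<close>

definition rotate_front :: "nat \<Rightarrow> nat \<Rightarrow> nat" where
  "rotate_front r i = (if i < r then Suc i else if i = r then 0 else i)"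

lemma rotate_front_0: "rotate_front 0 = id"
  by (auto simp: rotate_front_def)

lemma rotate_front_Suc: "rotate_front (Suc r) = rotate_front r \<circ> Transposition.transpose r (Suc r)"
  by (auto simp: rotate_front_def Transposition.transpose_def fun_eq_iff)

lemma rotate_front_permutes: "r \<le> n \<Longrightarrow> rotate_front r permutes {..<Suc n}"
proof (induction r)
  case 0
  then show ?case unfolding rotate_front_0 by (simp only: permutes_id)
next
  case (Suc r)
  have "Transposition.transpose r (Suc r) permutes {..<Suc n}"
    using Suc.prems by (intro permutes_swap_id) auto
  then show ?case
    unfolding rotate_front_Suc using Suc by (intro permutes_compose) auto
qed

lemma sign_rotate_front: "sign (rotate_front r) = (-1) ^ r"
proof (induction r)
  case 0
  then show ?case by (simp add: rotate_front_0)
next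
  case (Suc r)
  have "permutation (rotate_front r)"
    using rotate_front_permutes[of r r] permutation_permutes by blast
  then show ?case
    unfolding rotate_front_Suc sign_compose[OF _ permutation_swap_id]
    by (simp add: sign_compose[OF _ permutation_swap_id] sign_swap_id Suc del: o_apply)
qed

text \<open>Position \<open>r\<close> receives the value \<open>0\<close>; the remaining positions,
  closed up, follow \<tau> with all values raised by one. Enumerating permutations by
  \<open>r\<close> and \<tau> is the combinatorics of expanding an alternating sum along one
  argument, and lets wedge products be unfolded one vector at a time.\<close>

definition lift_perm :: "nat \<Rightarrow> nat \<Rightarrow> (nat \<Rightarrow> nat) \<Rightarrow> nat \<Rightarrow> nat" where
  "lift_perm n r \<tau> = map_permutation {..<n} Suc \<tau> \<circ> rotate_front r"

lemma map_permutation_Suc_permutes: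
  assumes "\<tau> permutes {..<n}"
  shows "map_permutation {..<n} Suc \<tau> permutes {..<Suc n}"
proof -
  have "map_permutation {..<n} Suc \<tau> permutes Suc ` {..<n}"
    by (rule map_permutation_permutes[OF _ assms]) (simp add: bij_betw_def)
  then show ?thesis
    by (rule permutes_subset) auto
qed

lemma map_permutation_Suc_0: "map_permutation {..<n} Suc \<tau> 0 = 0"
  by (auto simp: map_permutation_def restrict_id_def)

lemma map_permutation_Suc_Suc: "i < n \<Longrightarrow> map_permutation {..<n} Suc \<tau> (Suc i) = Suc (\<tau> i)"
  by (rule map_permutation_apply) auto

lemma lift_perm_apply:
  assumes "r \<le> n" "i \<le> n"
  shows "lift_perm n r \<tau> i = (if i < r then Suc (\<tau> i) else if i = r then 0 else Suc (\<tau> (i - 1)))"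
  using assms map_permutation_Suc_Suc[of i n \<tau>] map_permutation_Suc_Suc[of "i - 1" n \<tau>]
  by (auto simp: lift_perm_def rotate_front_def map_permutation_Suc_0)

lemma lift_perm_permutes:
  assumes "\<tau> permutes {..<n}" "r \<le> n"
  shows "lift_perm n r \<tau> permutes {..<Suc n}"
  unfolding lift_perm_def
  by (intro permutes_compose rotate_front_permutes map_permutation_Suc_permutes assms)

lemma sign_lift_perm:
  assumes "\<tau> permutes {..<n}" "r \<le> n"
  shows "sign (lift_perm n r \<tau>) = (-1) ^ r * sign \<tau>"
proof -
  have "permutation (map_permutation {..<n} Suc \<tau>)" "permutation (rotate_front r)"
    using map_permutation_Suc_permutes[OF assms(1)] rotate_front_permutes[OF assms(2)]
      permutation_permutes by blast+
  moreover have "sign (map_permutation {..<n} Suc \<tau>) = sign \<tau>"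
    by (rule sign_map_permutation) (use assms in auto)
  ultimately show ?thesis
    by (simp add: lift_perm_def sign_compose sign_rotate_front)
qed

text \<open>The position \<open>r\<close> is recovered as the one with value \<open>0\<close>, and
  \<tau> from the values at the other positions.\<close>

lemma lift_perm_inj:
  "inj_on (\<lambda>(r, \<tau>). lift_perm n r \<tau>) ({..n} \<times> {\<tau>. \<tau> permutes {..<n}})"
proof (rule inj_onI, clarify)
  fix r \<tau> r' \<tau>'
  assume r: "r \<le> n" "r' \<le> n" and \<tau>: "\<tau> permutes {..<n}" "\<tau>' permutes {..<n}"
    and eq: "lift_perm n r \<tau> = lift_perm n r' \<tau>'"
  have "lift_perm n r' \<tau>' r = 0"
    using eq r lift_perm_apply[of r n r \<tau>] by simp
  then have "r = r'"
    using lift_perm_apply[of r' n r \<tau>'] r by (auto split: if_splits)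
  moreover have "\<tau> i = \<tau>' i" for i
  proof (cases "i < n")
    case True
    show ?thesis
    proof (cases "i < r")
      case True
      then show ?thesis
        using fun_cong[OF eq, of i] \<open>r = r'\<close> r by (simp add: lift_perm_apply)
    next
      case False
      then show ?thesis
        using fun_cong[OF eq, of "Suc i"] \<open>r = r'\<close> r \<open>i < n\<close> by (simp add: lift_perm_apply)
    qed
  next
    case False
    then show ?thesis using \<tau> by (auto simp: permutes_def)
  qed
  ultimately show "r = r' \<and> \<tau> = \<tau>'" by auto
qed

text \<open>Given injectivity it suffices to count: \<open>(n + 1) * n!\<close> pairs against
  \<open>(n + 1)!\<close> permutations.\<close>

lemma lift_perm_image:
  "(\<lambda>(r, \<tau>). lift_perm n r \<tau>) ` ({..n} \<times> {\<tau>. \<tau> permutes {..<n}}) = {\<sigma>. \<sigma> permutes {..<Suc n}}"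
proof (rule card_subset_eq)
  show "finite {\<sigma>. \<sigma> permutes {..<Suc n}}" by (rule finite_permutations) simp
  show "(\<lambda>(r, \<tau>). lift_perm n r \<tau>) ` ({..n} \<times> {\<tau>. \<tau> permutes {..<n}}) \<subseteq> {\<sigma>. \<sigma> permutes {..<Suc n}}"
    by (auto intro: lift_perm_permutes)
  show "card ((\<lambda>(r, \<tau>). lift_perm n r \<tau>) ` ({..n} \<times> {\<tau>. \<tau> permutes {..<n}}))
      = card {\<sigma>. \<sigma> permutes {..<Suc n}}"
    by (simp add: card_image[OF lift_perm_inj] card_cartesian_product
        card_permutations[where n = n] card_permutations[where n = "Suc n"])
qed

lemma sum_permutations_Suc:
  "(\<Sum>\<sigma> | \<sigma> permutes {..<Suc n}. F \<sigma>) = (\<Sum>r\<le>n. \<Sum>\<tau> | \<tau> permutes {..<n}. F (lift_perm n r \<tau>))"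
  unfolding lift_perm_image[symmetric] sum.reindex[OF lift_perm_inj] sum.cartesian_product
  by (simp add: case_prod_unfold)

section \<open>Contraction and the recursion for wedge products\<close>

lemma alternating_cong: "alternating k a \<Longrightarrow> (\<And>i. i < k \<Longrightarrow> v i = w i) \<Longrightarrow> a v = a w"
  unfolding alternating_def by blast

lemma alternating_linear: "alternating k a \<Longrightarrow> i < k \<Longrightarrow> linear (\<lambda>u. a (v(i := u)))"
  unfolding alternating_def by blast

lemma alternating_eq_0: "alternating k a \<Longrightarrow> i < k \<Longrightarrow> j < k \<Longrightarrow> i \<noteq> j \<Longrightarrow> v i = v j \<Longrightarrow> a v = 0"
  unfolding alternating_def by blast

text \<open>Polarisation: expand the form with \<open>v i + v j\<close> in both slots.\<close>

lemma alternating_swap: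
  assumes a: "alternating k a" and ij: "i < k" "j < k" "i \<noteq> j"
  shows "a (v \<circ> Transposition.transpose i j) = - a v"
proof -
  let ?f = "\<lambda>x y. a (v(i := x, j := y))"
  have l1: "?f (x + x') y = ?f x y + ?f x' y" for x x' y
    using linear_add[OF alternating_linear[OF a ij(1), of "v(j := y)"], of x x'] ij(3)
    by (simp add: fun_upd_twist)
  have l2: "?f x (y + y') = ?f x y + ?f x y'" for x y y'
    using linear_add[OF alternating_linear[OF a ij(2), of "v(i := x)"], of y y'] by simp
  have z: "?f x x = 0" for x
    by (rule alternating_eq_0[OF a ij]) (use ij in auto)
  have "?f (v i + v j) (v i + v j) = ?f (v j) (v i) + ?f (v i) (v j)"
    unfolding l1 l2 by (simp only: z add_0_left add_0_right)
  then have "?f (v j) (v i) + ?f (v i) (v j) = 0"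
    unfolding z by (rule sym)
  then have "?f (v j) (v i) = - ?f (v i) (v j)"
    by (simp only: eq_neg_iff_add_eq_0)
  moreover have "v(i := v j, j := v i) = v \<circ> Transposition.transpose i j"
    by (auto simp: fun_eq_iff Transposition.transpose_def)
  ultimately show ?thesis by simp
qed

definition insert_arg :: "nat \<Rightarrow> 'b \<Rightarrow> (nat \<Rightarrow> 'b) \<Rightarrow> nat \<Rightarrow> 'b" where
  "insert_arg r u w n = (if n < r then w n else if n = r then u else w (n - 1))"

lemma insert_arg_0: "insert_arg 0 u w = case_nat u w"
  by (auto simp: insert_arg_def fun_eq_iff split: nat.split)

text \<open>Each exchange with the left neighbour costs one sign, and \<open>r\<close> of them bring
  \<open>u\<close> to the front.\<close>

lemma alternating_insert_arg:
  assumes a: "alternating k a"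
  shows "r < k \<Longrightarrow> a (insert_arg r u w) = (-1) ^ r *\<^sub>R a (case_nat u w)"
proof (induction r)
  case 0
  then show ?case by (simp add: insert_arg_0)
next
  case (Suc r)
  have "insert_arg (Suc r) u w = insert_arg r u w \<circ> Transposition.transpose r (Suc r)"
    by (auto simp: fun_eq_iff insert_arg_def Transposition.transpose_def)
  then have "a (insert_arg (Suc r) u w) = - a (insert_arg r u w)"
    using alternating_swap[OF a, of r "Suc r" "insert_arg r u w"] Suc.prems by simp
  then show ?case using Suc by simp
qed

lemma alternating_interior_prod:
  assumes a: "alternating (Suc k) a"
  shows "alternating k (interior_prod (Suc k) u a)"
  unfolding alternating_def interior_prod_def
proof (intro conjI allI impI)
  fix v w :: "nat \<Rightarrow> real^'a"
  assume "\<forall>i<k. v i = w i"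
  then show "(if Suc k = 0 then 0 else a (case_nat u v)) = (if Suc k
      = 0 then 0 else a (case_nat u w))"
    by (auto intro!: alternating_cong[OF a] split: nat.split)
next
  fix i and v :: "nat \<Rightarrow> real^'a" assume "i < k"
  have "case_nat u (v(i := x)) = (case_nat u v)(Suc i := x)" for x
    by (auto simp: fun_eq_iff split: nat.split)
  then show "linear (\<lambda>x. if Suc k = 0 then 0 else a (case_nat u (v(i := x))))"
    using alternating_linear[OF a, of "Suc i" "case_nat u v"] \<open>i < k\<close> by simp
next
  fix i j and v :: "nat \<Rightarrow> real^'a" assume "i < k" "j < k" "i \<noteq> j \<and> v i = v j"
  then show "(if Suc k = 0 then 0 else a (case_nat u v)) = 0"
    using alternating_eq_0[OF a, of "Suc i" "Suc j" "case_nat u v"] by simp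
qed

text \<open>Contraction with \<open>v 0\<close> is a graded derivation. The permutations are sorted
  by the position \<open>r\<close> that receives \<open>v 0\<close>: the \<open>k\<close> positions
  inside \<open>a\<close> contribute equally, and so do the \<open>l\<close> positions inside
  \<open>b\<close>. The recursion avoids the sums over 120 or 720 permutations that the definition
  would produce in the degrees of the two brackets.\<close>

lemma wedge_rec:
  assumes a: "alternating k a" and b: "alternating l b" and kl: "0 < k + l"
  shows "wedge k l a b v =
     wedge (k - 1) l (interior_prod k (v 0) a) b (\<lambda>n. v (Suc n))
     + (-1) ^ k * wedge k (l - 1) a (interior_prod l (v 0) b) (\<lambda>n. v (Suc n))"
proof -
  obtain n where n: "k + l = Suc n" using kl gr0_implies_Suc by blast
  let ?P = "{\<tau>. \<tau> permutes {..<n}}"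
  let ?T = "\<lambda>\<sigma>. of_int (sign \<sigma>) * a (\<lambda>m. v (\<sigma> m)) * b (\<lambda>m. v (\<sigma> (k + m)))"
  let ?A = "\<lambda>\<tau>. of_int (sign \<tau>) * a (case_nat (v 0) (\<lambda>m. v (Suc (\<tau> m)))) * b (\<lambda>m. v (Suc (\<tau> (k - 1
      + m))))"
  let ?B = "\<lambda>\<tau>. of_int (sign \<tau>) * a (\<lambda>m. v (Suc (\<tau> m))) * b (case_nat (v 0) (\<lambda>m. v (Suc (\<tau> (k
      + m)))))"
  have TA: "?T (lift_perm n r \<tau>) = ?A \<tau>" if "r < k" and \<tau>: "\<tau> permutes {..<n}" for r \<tau>
  proof -
    have "a (\<lambda>m. v (lift_perm n r \<tau> m)) = a (insert_arg r (v 0) (\<lambda>m. v (Suc (\<tau> m))))"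
      by (rule alternating_cong[OF a]) (use n that in \<open>auto simp: lift_perm_apply insert_arg_def\<close>)
    moreover have "b (\<lambda>m. v (lift_perm n r \<tau> (k + m))) = b (\<lambda>m. v (Suc (\<tau> (k - 1 + m))))"
      by (rule alternating_cong[OF b]) (use n that in \<open>auto simp: lift_perm_apply\<close>)
    ultimately show ?thesis
      using that n by (simp add: sign_lift_perm alternating_insert_arg[OF a] flip:
          power_mult_distrib)
  qed
  have TB: "?T (lift_perm n r \<tau>) = (-1) ^ k * ?B \<tau>"
    if "k \<le> r" "r \<le> n" and \<tau>: "\<tau> permutes {..<n}" for r \<tau>
  proof -
    have "a (\<lambda>m. v (lift_perm n r \<tau> m)) = a (\<lambda>m. v (Suc (\<tau> m)))"
      by (rule alternating_cong[OF a]) (use n that in \<open>auto simp: lift_perm_apply\<close>)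
    moreover have "b (\<lambda>m. v (lift_perm n r \<tau> (k + m)))
        = b (insert_arg (r - k) (v 0) (\<lambda>m. v (Suc (\<tau> (k + m)))))"
      by (rule alternating_cong[OF b]) (use n that in \<open>auto simp: lift_perm_apply insert_arg_def\<close>)
    moreover have "r - k < l" using that n by auto
    \<comment> \<open>Of these signs \<open>r\<close> come from \<open>lift_perm\<close>, and
      \<open>r - k\<close> from moving \<open>v 0\<close> to the front of \<open>b\<close>.\<close>
    moreover have "(-1::real) ^ r * (-1) ^ (r - k) = (-1) ^ k"
      using that by (simp add: minus_one_power_iff)
    ultimately show ?thesis
      using that n by (simp add: sign_lift_perm alternating_insert_arg[OF b])
  qed
  have split: "(\<Sum>r\<le>n. G r) = (\<Sum>r<k. G r) + (\<Sum>r=k..n. G r)" for G :: "nat \<Rightarrow> real"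
    using n by (subst sum.union_disjoint[symmetric]) (auto intro!: sum.cong)
  have "(\<Sum>\<sigma> | \<sigma> permutes {..<Suc n}. ?T \<sigma>)
      = (\<Sum>r<k. \<Sum>\<tau>\<in>?P. ?T (lift_perm n r \<tau>)) + (\<Sum>r=k..n. \<Sum>\<tau>\<in>?P. ?T (lift_perm n r \<tau>))"
    unfolding sum_permutations_Suc by (rule split)
  also have "\<dots> = (\<Sum>r<k. \<Sum>\<tau>\<in>?P. ?A \<tau>) + (\<Sum>r=k..n. \<Sum>\<tau>\<in>?P. (-1) ^ k * ?B \<tau>)"
    by (intro arg_cong2[where f = "(+)"] sum.cong refl TA TB) auto
  also have "\<dots> = of_nat k * (\<Sum>\<tau>\<in>?P. ?A \<tau>) + of_nat l * ((-1) ^ k * (\<Sum>\<tau>\<in>?P. ?B \<tau>))"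
  proof -
    have "card {k..n} = l" using n by simp
    then show ?thesis by (simp only: sum_constant card_lessThan sum_distrib_left)
  qed
  finally have sum: "(\<Sum>\<sigma> | \<sigma> permutes {..<Suc n}. ?T \<sigma>)
      = of_nat k * (\<Sum>\<tau>\<in>?P. ?A \<tau>) + of_nat l * ((-1) ^ k * (\<Sum>\<tau>\<in>?P. ?B \<tau>))" .
  \<comment> \<open>The factor \<open>k\<close> turns \<open>1 / k!\<close> into
    \<open>1 / (k - 1)!\<close>. For \<open>k = 0\<close> both sides are zero because a 0-form
    contracts to zero, so the truncated difference \<open>k - 1\<close> does no harm.\<close>
  have A: "of_nat k * (\<Sum>\<tau>\<in>?P. ?A \<tau>) / (fact k * fact l)
      = wedge (k - 1) l (interior_prod k (v 0) a) b (\<lambda>n. v (Suc n))"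
  proof (cases k)
    case 0
    then show ?thesis by (simp add: wedge_def interior_prod_def)
  next
    case (Suc k')
    have "of_nat (Suc k') * S / (fact (Suc k') * fact l) = S / (fact k' * fact l)" for S :: real
      by (simp only: fact_Suc of_nat_mult mult.assoc) (simp del: of_nat_Suc)
    then show ?thesis using n Suc by (simp add: wedge_def interior_prod_def del: of_nat_Suc
        fact_Suc)
  qed
  have B: "of_nat l * (\<Sum>\<tau>\<in>?P. ?B \<tau>) / (fact k * fact l)
      = wedge k (l - 1) a (interior_prod l (v 0) b) (\<lambda>n. v (Suc n))"
  proof (cases l)
    case 0
    then show ?thesis by (simp add: wedge_def interior_prod_def)
  next
    case (Suc l')
    have "of_nat (Suc l') * S / (fact k * fact (Suc l')) = S / (fact k * fact l')" for S :: real
      by (simp only: fact_Suc of_nat_mult mult.assoc mult.left_commute[of "fact k"])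
        (simp del: of_nat_Suc)
    then show ?thesis using n Suc by (simp add: wedge_def interior_prod_def del: of_nat_Suc
        fact_Suc)
  qed
  show ?thesis
    unfolding A[symmetric] B[symmetric] by (simp add: wedge_def[of k l] n sum add_divide_distrib)
qed

lemma wedge_0_0: "wedge 0 0 a b v = a v * b v"
  by (simp add: wedge_def)

lemma wedge_zero: "wedge k l (interior_prod 0 u a) b v = 0" "wedge k l a (interior_prod 0 u b) v
    = 0"
  by (simp_all add: wedge_def interior_prod_def)

text \<open>Base case of the recursion. Peeling off the arguments of \<open>b\<close> leaves only
  the second summand each time, since a form of degree 0 contracts to zero.\<close>

lemma wedge_0_left:
  assumes a: "alternating 0 a"
  shows "alternating l b \<Longrightarrow> wedge 0 l a b v = a v * b v"
proof (induction l arbitrary: b v)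
  case 0
  then show ?case by (simp add: wedge_0_0)
next
  case (Suc l)
  have "a (\<lambda>n. v (Suc n)) = a v" by (rule alternating_cong[OF a]) simp
  moreover have "case_nat (v 0) (\<lambda>n. v (Suc n)) = v" by (auto simp: fun_eq_iff split: nat.split)
  moreover have "alternating l (interior_prod (Suc l) (v 0) b)"
    by (rule alternating_interior_prod[OF Suc.prems])
  ultimately show ?case
    by (simp add: wedge_rec[OF a Suc.prems] wedge_zero Suc.IH) (simp add: interior_prod_def)
qed

lemma wedge_0_right:
  assumes b: "alternating 0 b"
  shows "alternating k a \<Longrightarrow> wedge k 0 a b v = a v * b v"
proof (induction k arbitrary: a v)
  case 0
  then show ?case by (simp add: wedge_0_0)
next
  case (Suc k)
  have "b (\<lambda>n. v (Suc n)) = b v" by (rule alternating_cong[OF b]) simp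
  moreover have "case_nat (v 0) (\<lambda>n. v (Suc n)) = v" by (auto simp: fun_eq_iff split: nat.split)
  moreover have "alternating k (interior_prod (Suc k) (v 0) a)"
    by (rule alternating_interior_prod[OF Suc.prems])
  ultimately show ?case
    by (simp add: wedge_rec[OF Suc.prems b] wedge_zero Suc.IH) (simp add: interior_prod_def)
qed

text \<open>Laplace expansion of the determinant along the column of \<open>v 0\<close>.\<close>

lemma wedge_list_rec:
  assumes n: "length is = Suc n"
  shows "wedge_list \<epsilon> is v =
    (\<Sum>r\<le>n. (-1) ^ r * \<epsilon> (is ! r) (v 0) * wedge_list \<epsilon> (take r is @ drop (Suc r) is) (\<lambda>n. v (Suc
        n)))"
proof -
  have "(\<Prod>s<Suc n. \<epsilon> (is ! s) (v (lift_perm n r \<tau> s)))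
      = \<epsilon> (is ! r) (v 0) * (\<Prod>s<n. \<epsilon> ((take r is @ drop (Suc r) is) ! s) (v (Suc (\<tau> s))))"
    if r: "r \<le> n" for r \<tau>
  proof -
    let ?f = "\<lambda>s. \<epsilon> (is ! s) (v (lift_perm n r \<tau> s))"
    have "(\<Prod>s<Suc n. ?f s) = ?f r * prod ?f ({..<Suc n} - {r})"
      by (rule prod.remove) (use r in auto)
    \<comment> \<open>The positions other than \<open>r\<close> are renumbered by skipping
      \<open>r\<close>; on the list this deletes its entry at \<open>r\<close>.\<close>
    also have "{..<Suc n} - {r} = (\<lambda>s. if s < r then s else Suc s) ` {..<n}"
    proof (intro equalityI subsetI)
      fix s assume s: "s \<in> {..<Suc n} - {r}"
      show "s \<in> (\<lambda>s. if s < r then s else Suc s) ` {..<n}"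
        by (rule image_eqI[of _ _ "if s < r then s else s - 1"]) (use s r in auto)
    qed (use r in auto)
    also have "prod ?f \<dots> = (\<Prod>s<n. ?f (if s < r then s else Suc s))"
      by (subst prod.reindex) (auto simp: inj_on_def split: if_splits)
    also have "\<dots> = (\<Prod>s<n. \<epsilon> ((take r is @ drop (Suc r) is) ! s) (v (Suc (\<tau> s))))"
      by (intro prod.cong refl) (use r n in \<open>auto simp: lift_perm_apply nth_append\<close>)
    finally show ?thesis using r by (simp add: lift_perm_apply)
  qed
  note prod_eq = this
  have len: "length (take r is @ drop (Suc r) is) = n" if "r \<le> n" for r
    using that n by simp
  show ?thesis
    unfolding wedge_list_def n sum_permutations_Suc sum_distrib_left
    by (intro sum.cong refl) (auto simp: len prod_eq sign_lift_perm simp del: prod.lessThan_Suc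
        length_append)
qed

lemma wedge_list_Nil: "wedge_list \<epsilon> [] v = 1"
  by (simp add: wedge_list_def)

text \<open>\<open>det\<close> sums over permutations of the index type, \<open>wedge_list\<close>
  over permutations of list positions. A list enumerating the type translates one into the other,
  and \<open>h\<close> translates back, from an index to its position.\<close>

lemma wedge_list_eq_det:
  fixes \<epsilon> :: "'m::finite \<Rightarrow> real^'n::finite \<Rightarrow> real"
  assumes d: "distinct is" and s: "set is = UNIV"
    and h: "\<And>r. r < length is \<Longrightarrow> h (is ! r) = r"
  shows "wedge_list \<epsilon> is v = det (\<chi> i j. \<epsilon> i (v (h j)))"
proof -
  let ?n = "length is"
  have bij: "bij_betw ((!) is) {..<?n} (UNIV :: 'm set)"
    using bij_betw_nth[OF d refl s[symmetric]] by simp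
  let ?m = "map_permutation {..<?n} ((!) is)"
  have inj: "inj_on ?m {\<sigma>. \<sigma> permutes {..<?n}}"
  proof (rule inj_onI, clarify)
    fix \<sigma> \<tau> assume p: "\<sigma> permutes {..<?n}" "\<tau> permutes {..<?n}" and e: "?m \<sigma> = ?m \<tau>"
    show "\<sigma> = \<tau>"
    proof
      fix i
      show "\<sigma> i = \<tau> i"
      proof (cases "i < ?n")
        case True
        have "is ! \<sigma> i = is ! \<tau> i"
          using fun_cong[OF e, of "is ! i"] True bij by (simp add: map_permutation_apply
              bij_betw_def)
        moreover have "\<sigma> i < ?n" "\<tau> i < ?n"
          using True p permutes_in_image[of _ "{..<?n}" i] by auto
        ultimately show ?thesis using d by (simp add: nth_eq_iff_index_eq)
      qed (use p in \<open>auto simp: permutes_def\<close>)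
    qed
  qed
  have img: "?m ` {\<sigma>. \<sigma> permutes {..<?n}} = {p. p permutes UNIV}"
  proof (rule card_subset_eq)
    show "?m ` {\<sigma>. \<sigma> permutes {..<?n}} \<subseteq> {p. p permutes UNIV}"
      using map_permutation_permutes[OF bij] by auto
    have "card {\<sigma>. \<sigma> permutes {..<?n}} = fact ?n"
      by (rule card_permutations) auto
    moreover have "card {p. p permutes (UNIV :: 'm set)} = fact (CARD('m))"
      by (rule card_permutations) auto
    moreover have "CARD('m) = ?n"
      using d s distinct_card by metis
    ultimately show "card (?m ` {\<sigma>. \<sigma> permutes {..<?n}}) = card {p. p permutes (UNIV :: 'm set)}"
      by (simp add: card_image[OF inj])
  qed (simp add: finite_permutations)
  have "sign (?m \<sigma>) = sign \<sigma>" if "\<sigma> permutes {..<?n}" for \<sigma>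
    using that bij by (intro sign_map_permutation) (auto simp: bij_betw_def)
  moreover have "(\<Prod>i\<in>UNIV. \<epsilon> i (v (h (?m \<sigma> i)))) = (\<Prod>r<?n. \<epsilon> (is ! r) (v (\<sigma> r)))"
    if "\<sigma> permutes {..<?n}" for \<sigma>
  proof -
    have "\<sigma> r < ?n" if "r < ?n" for r
      using that \<open>\<sigma> permutes {..<?n}\<close> permutes_in_image[of _ "{..<?n}" r] by auto
    then show ?thesis
      using bij by (simp add: prod.reindex_bij_betw[OF bij, symmetric] map_permutation_apply h
          bij_betw_def)
  qed
  ultimately show ?thesis
    unfolding wedge_list_def det_def img[symmetric] sum.reindex[OF inj]
    by (intro sum.cong refl) simp
qed

section \<open>The bracket in terms of shuffles\<close>

text \<open>The recursion as a rewrite rule: both degrees are successors, so unfolding stops as soon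
  as one of them is 0, where \<open>wedge_0_left\<close> and \<open>wedge_0_right\<close> take
  over.\<close>

lemma wedge_Suc_Suc:
  assumes "alternating (Suc k) a" "alternating (Suc l) b"
  shows "wedge (Suc k) (Suc l) a b v =
     wedge k (Suc l) (interior_prod (Suc k) (v 0) a) b (\<lambda>n. v (Suc n))
     - (-1) ^ k * wedge (Suc k) l a (interior_prod (Suc l) (v 0) b) (\<lambda>n. v (Suc n))"
  by (simp add: wedge_rec[OF assms])

text \<open>A bracket in degrees \<open>k\<close> and \<open>l\<close> involves wedge products in
  the degrees \<open>(k, l)\<close>, \<open>(k + 1, l - 1)\<close> and
  \<open>(k - 1, l + 1)\<close>. For \<open>(2, 3)\<close> and \<open>(3, 3)\<close> these are the
  six pairs treated from here on. The terms correspond to shuffles: 5, 10, 15 or 20 of them.\<close>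

lemma wedge_1_4:
  assumes "alternating 1 (\<lambda>w. A (w 0))"
    and "alternating 4 (\<lambda>w. B (w 0) (w 1) (w 2) (w 3))"
  shows "wedge 1 4 (\<lambda>w. A (w 0)) (\<lambda>w. B (w 0) (w 1) (w 2) (w 3)) v =
     A (v 0) * B (v 1) (v 2) (v 3) (v 4) - A (v 1) * B (v 0) (v 2) (v 3) (v 4)
     + A (v 2) * B (v 0) (v 1) (v 3) (v 4) - A (v 3) * B (v 0) (v 1) (v 2) (v 4)
     + A (v 4) * B (v 0) (v 1) (v 2) (v 3)"
  using assms
  by (simp only: numeral_eq_Suc pred_numeral_simps One_nat_def wedge_Suc_Suc wedge_0_left
      wedge_0_right
      alternating_interior_prod BitM.simps arith_simps)
    (simp add: interior_prod_def)

lemma wedge_2_3: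
  assumes "alternating 2 (\<lambda>w. A (w 0) (w 1))"
    and "alternating 3 (\<lambda>w. B (w 0) (w 1) (w 2))"
  shows "wedge 2 3 (\<lambda>w. A (w 0) (w 1)) (\<lambda>w. B (w 0) (w 1) (w 2)) v =
     A (v 0) (v 1) * B (v 2) (v 3) (v 4) - A (v 0) (v 2) * B (v 1) (v 3) (v 4)
     + A (v 0) (v 3) * B (v 1) (v 2) (v 4) - A (v 0) (v 4) * B (v 1) (v 2) (v 3)
     + A (v 1) (v 2) * B (v 0) (v 3) (v 4) - A (v 1) (v 3) * B (v 0) (v 2) (v 4)
     + A (v 1) (v 4) * B (v 0) (v 2) (v 3) + A (v 2) (v 3) * B (v 0) (v 1) (v 4)
     - A (v 2) (v 4) * B (v 0) (v 1) (v 3) + A (v 3) (v 4) * B (v 0) (v 1) (v 2)"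
  using assms
  by (simp only: numeral_eq_Suc pred_numeral_simps One_nat_def wedge_Suc_Suc wedge_0_left
      wedge_0_right
      alternating_interior_prod BitM.simps arith_simps)
    (simp add: interior_prod_def)

lemma wedge_3_2:
  assumes "alternating 3 (\<lambda>w. A (w 0) (w 1) (w 2))"
    and "alternating 2 (\<lambda>w. B (w 0) (w 1))"
  shows "wedge 3 2 (\<lambda>w. A (w 0) (w 1) (w 2)) (\<lambda>w. B (w 0) (w 1)) v =
     A (v 0) (v 1) (v 2) * B (v 3) (v 4) - A (v 0) (v 1) (v 3) * B (v 2) (v 4)
     + A (v 0) (v 1) (v 4) * B (v 2) (v 3) + A (v 0) (v 2) (v 3) * B (v 1) (v 4)
     - A (v 0) (v 2) (v 4) * B (v 1) (v 3) + A (v 0) (v 3) (v 4) * B (v 1) (v 2)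
     - A (v 1) (v 2) (v 3) * B (v 0) (v 4) + A (v 1) (v 2) (v 4) * B (v 0) (v 3)
     - A (v 1) (v 3) (v 4) * B (v 0) (v 2) + A (v 2) (v 3) (v 4) * B (v 0) (v 1)"
  using assms
  by (simp only: numeral_eq_Suc pred_numeral_simps One_nat_def wedge_Suc_Suc wedge_0_left
      wedge_0_right
      alternating_interior_prod BitM.simps arith_simps)
    (simp add: interior_prod_def)

lemma wedge_2_4:
  assumes "alternating 2 (\<lambda>w. A (w 0) (w 1))"
    and "alternating 4 (\<lambda>w. B (w 0) (w 1) (w 2) (w 3))"
  shows "wedge 2 4 (\<lambda>w. A (w 0) (w 1)) (\<lambda>w. B (w 0) (w 1) (w 2) (w 3)) v =
     A (v 0) (v 1) * B (v 2) (v 3) (v 4) (v 5) - A (v 0) (v 2) * B (v 1) (v 3) (v 4) (v 5)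
     + A (v 0) (v 3) * B (v 1) (v 2) (v 4) (v 5) - A (v 0) (v 4) * B (v 1) (v 2) (v 3) (v 5)
     + A (v 0) (v 5) * B (v 1) (v 2) (v 3) (v 4) + A (v 1) (v 2) * B (v 0) (v 3) (v 4) (v 5)
     - A (v 1) (v 3) * B (v 0) (v 2) (v 4) (v 5) + A (v 1) (v 4) * B (v 0) (v 2) (v 3) (v 5)
     - A (v 1) (v 5) * B (v 0) (v 2) (v 3) (v 4) + A (v 2) (v 3) * B (v 0) (v 1) (v 4) (v 5)
     - A (v 2) (v 4) * B (v 0) (v 1) (v 3) (v 5) + A (v 2) (v 5) * B (v 0) (v 1) (v 3) (v 4)
     + A (v 3) (v 4) * B (v 0) (v 1) (v 2) (v 5) - A (v 3) (v 5) * B (v 0) (v 1) (v 2) (v 4)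
     + A (v 4) (v 5) * B (v 0) (v 1) (v 2) (v 3)"
  using assms
  by (simp only: numeral_eq_Suc pred_numeral_simps One_nat_def wedge_Suc_Suc wedge_0_left
      wedge_0_right
      alternating_interior_prod BitM.simps arith_simps)
    (simp add: interior_prod_def)

lemma wedge_4_2:
  assumes "alternating 4 (\<lambda>w. A (w 0) (w 1) (w 2) (w 3))"
    and "alternating 2 (\<lambda>w. B (w 0) (w 1))"
  shows "wedge 4 2 (\<lambda>w. A (w 0) (w 1) (w 2) (w 3)) (\<lambda>w. B (w 0) (w 1)) v =
     A (v 0) (v 1) (v 2) (v 3) * B (v 4) (v 5) - A (v 0) (v 1) (v 2) (v 4) * B (v 3) (v 5)
     + A (v 0) (v 1) (v 2) (v 5) * B (v 3) (v 4) + A (v 0) (v 1) (v 3) (v 4) * B (v 2) (v 5)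
     - A (v 0) (v 1) (v 3) (v 5) * B (v 2) (v 4) + A (v 0) (v 1) (v 4) (v 5) * B (v 2) (v 3)
     - A (v 0) (v 2) (v 3) (v 4) * B (v 1) (v 5) + A (v 0) (v 2) (v 3) (v 5) * B (v 1) (v 4)
     - A (v 0) (v 2) (v 4) (v 5) * B (v 1) (v 3) + A (v 0) (v 3) (v 4) (v 5) * B (v 1) (v 2)
     + A (v 1) (v 2) (v 3) (v 4) * B (v 0) (v 5) - A (v 1) (v 2) (v 3) (v 5) * B (v 0) (v 4)
     + A (v 1) (v 2) (v 4) (v 5) * B (v 0) (v 3) - A (v 1) (v 3) (v 4) (v 5) * B (v 0) (v 2)
     + A (v 2) (v 3) (v 4) (v 5) * B (v 0) (v 1)"
  using assms
  by (simp only: numeral_eq_Suc pred_numeral_simps One_nat_def wedge_Suc_Suc wedge_0_left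
      wedge_0_right
      alternating_interior_prod BitM.simps arith_simps)
    (simp add: interior_prod_def)

lemma wedge_3_3:
  assumes "alternating 3 (\<lambda>w. A (w 0) (w 1) (w 2))"
    and "alternating 3 (\<lambda>w. B (w 0) (w 1) (w 2))"
  shows "wedge 3 3 (\<lambda>w. A (w 0) (w 1) (w 2)) (\<lambda>w. B (w 0) (w 1) (w 2)) v =
     A (v 0) (v 1) (v 2) * B (v 3) (v 4) (v 5) - A (v 0) (v 1) (v 3) * B (v 2) (v 4) (v 5)
     + A (v 0) (v 1) (v 4) * B (v 2) (v 3) (v 5) - A (v 0) (v 1) (v 5) * B (v 2) (v 3) (v 4)
     + A (v 0) (v 2) (v 3) * B (v 1) (v 4) (v 5) - A (v 0) (v 2) (v 4) * B (v 1) (v 3) (v 5)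
     + A (v 0) (v 2) (v 5) * B (v 1) (v 3) (v 4) + A (v 0) (v 3) (v 4) * B (v 1) (v 2) (v 5)
     - A (v 0) (v 3) (v 5) * B (v 1) (v 2) (v 4) + A (v 0) (v 4) (v 5) * B (v 1) (v 2) (v 3)
     - A (v 1) (v 2) (v 3) * B (v 0) (v 4) (v 5) + A (v 1) (v 2) (v 4) * B (v 0) (v 3) (v 5)
     - A (v 1) (v 2) (v 5) * B (v 0) (v 3) (v 4) - A (v 1) (v 3) (v 4) * B (v 0) (v 2) (v 5)
     + A (v 1) (v 3) (v 5) * B (v 0) (v 2) (v 4) - A (v 1) (v 4) (v 5) * B (v 0) (v 2) (v 3)
     + A (v 2) (v 3) (v 4) * B (v 0) (v 1) (v 5) - A (v 2) (v 3) (v 5) * B (v 0) (v 1) (v 4)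
     + A (v 2) (v 4) (v 5) * B (v 0) (v 1) (v 3) - A (v 3) (v 4) (v 5) * B (v 0) (v 1) (v 2)"
  using assms
  by (simp only: numeral_eq_Suc pred_numeral_simps One_nat_def wedge_Suc_Suc wedge_0_left
      wedge_0_right
      alternating_interior_prod BitM.simps arith_simps)
    (simp add: interior_prod_def)

section \<open>Curried alternating maps of two, three and four vectors\<close>

definition alt2 :: "('v::real_vector \<Rightarrow> 'v \<Rightarrow> 'b::real_vector) \<Rightarrow> bool" where
  "alt2 f \<longleftrightarrow> (\<forall>b. linear (\<lambda>a. f a b)) \<and> (\<forall>a. linear (f a)) \<and> (\<forall>a. f a a = 0)"

text \<open>Only neighbouring equal arguments are required to give zero; for the outer pair this
  follows by a swap, see \<open>alt3_same\<close>.\<close>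

definition alt3 :: "('v::real_vector \<Rightarrow> 'v \<Rightarrow> 'v \<Rightarrow> 'b::real_vector) \<Rightarrow> bool" where
  "alt3 f \<longleftrightarrow> (\<forall>c. alt2 (\<lambda>a b. f a b c)) \<and> (\<forall>a. alt2 (f a))"

lemma alt2_linear: "alt2 f \<Longrightarrow> linear (\<lambda>a. f a b)" "alt2 f \<Longrightarrow> linear (f a)"
  by (simp_all add: alt2_def)

lemma alt2_same: "alt2 f \<Longrightarrow> f a a = 0"
  by (simp add: alt2_def)

lemma alt2_swap: assumes "alt2 f" shows "f b a = - f a b"
proof -
  have "f (a + b) (a + b) = f a b + f b a"
    unfolding alt2_linear[OF assms, THEN linear_add] by (simp add: alt2_same[OF assms])
  then show ?thesis
    unfolding alt2_same[OF assms] by (simp add: eq_neg_iff_add_eq_0 add.commute)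
qed

lemma alt3_linear:
  "alt3 f \<Longrightarrow> linear (\<lambda>a. f a b c)" "alt3 f \<Longrightarrow> linear (\<lambda>b. f a b c)" "alt3 f \<Longrightarrow> linear (f a b)"
  by (simp_all add: alt3_def alt2_def)

lemma alt3_swap: "alt3 f \<Longrightarrow> f b a c = - f a b c" "alt3 f \<Longrightarrow> f a c b = - f a b c"
  using alt2_swap[of "\<lambda>a b. f a b c" b a] alt2_swap[of "f a" c b] by (simp_all add: alt3_def)

lemma alt3_same: "alt3 f \<Longrightarrow> f a a c = 0" "alt3 f \<Longrightarrow> f c a a = 0" "alt3 f \<Longrightarrow> f a c a = 0"
  using alt3_swap(1)[of f a c a] by (simp_all add: alt3_def alt2_def)

lemma alternating_1: "linear f \<Longrightarrow> alternating 1 (\<lambda>w. f (w 0))"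
  by (simp add: alternating_def)

lemma nat_less_2_iff: "(i::nat) < 2 \<longleftrightarrow> i = 0 \<or> i = 1"
  by auto

lemma nat_less_3_iff: "(i::nat) < 3 \<longleftrightarrow> i = 0 \<or> i = 1 \<or> i = 2"
  by auto

lemma nat_less_4_iff: "(i::nat) < 4 \<longleftrightarrow> i = 0 \<or> i = 1 \<or> i = 2 \<or> i = 3"
  by auto

lemma alternating_2: "alt2 f \<Longrightarrow> alternating 2 (\<lambda>w. f (w 0) (w 1))"
  unfolding alternating_def nat_less_2_iff
  by (auto simp: alt2_linear alt2_same)

lemma alternating_3: "alt3 f \<Longrightarrow> alternating 3 (\<lambda>w. f (w 0) (w 1) (w 2))"
  unfolding alternating_def nat_less_3_iff
  by (auto simp: alt3_linear alt3_same)

lemma alternating_4I: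
  assumes "\<And>b c d. linear (\<lambda>a. f a b c d)" "\<And>a c d. linear (\<lambda>b. f a b c d)"
    and "\<And>a b d. linear (\<lambda>c. f a b c d)" "\<And>a b c. linear (\<lambda>d. f a b c d)"
    and "\<And>a c d. f a a c d = 0" "\<And>a b d. f a b a d = 0" "\<And>a b c. f a b c a = 0"
    and "\<And>a b d. f a b b d = 0" "\<And>a b c. f a b c b = 0" "\<And>a b c. f a b c c = 0"
  shows "alternating 4 (\<lambda>w. f (w 0) (w 1) (w 2) (w 3))"
  unfolding alternating_def nat_less_4_iff
  using assms by (auto simp: eval_nat_numeral)

lemma linear_vec_nth_comp:
  fixes f :: "'v::real_vector \<Rightarrow> real^'n::finite"
  shows "linear f \<Longrightarrow> linear (\<lambda>x. f x $ i)"
  using linear_compose[OF _ bounded_linear.linear[OF bounded_linear_vec_nth[of i]], of f]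
  by (simp add: comp_def)

text \<open>If \<open>D u\<close> is the derivative of a 2-form in the constant direction
  \<open>u\<close>, this is the exterior derivative of that form; \<open>skew4\<close> is the same
  for 3-forms.\<close>

definition skew3 :: "('v \<Rightarrow> 'v \<Rightarrow> 'v \<Rightarrow> 'b::real_vector) \<Rightarrow> 'v \<Rightarrow> 'v \<Rightarrow> 'v \<Rightarrow> 'b" where
  "skew3 D a b c = D a b c - D b a c + D c a b"

definition skew4 ::
  "('v \<Rightarrow> 'v \<Rightarrow> 'v \<Rightarrow> 'v \<Rightarrow> 'b::real_vector) \<Rightarrow> 'v \<Rightarrow> 'v \<Rightarrow> 'v \<Rightarrow> 'v \<Rightarrow> 'b" where
  "skew4 D a b c d = D a b c d - D b a c d + D c a b d - D d a b c"

lemma alt3_skew3: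
  assumes lin: "\<And>a b. linear (\<lambda>u. D u a b)" and D: "\<And>u. alt2 (D u)"
  shows "alt3 (skew3 D)"
  unfolding alt3_def alt2_def skew3_def
  using lin alt2_linear[OF D] alt2_same[OF D]
  by (auto intro!: linear_compose_add linear_compose_sub)

lemma alternating_skew4:
  assumes lin: "\<And>a b c. linear (\<lambda>u. D u a b c)" and D: "\<And>u. alt3 (D u)"
  shows "alternating 4 (\<lambda>w. skew4 D (w 0) (w 1) (w 2) (w 3))"
proof (rule alternating_4I)
  \<comment> \<open>If a vector is repeated, at most the two terms having it as direction survive,
    and a swap shows that they cancel.\<close>
  have s: "D a b a d = - D a a b d" for a b d by (rule alt3_swap(1)[OF D])
  have s': "D a b c a = D a a b c" for a b c
    using alt3_swap(1)[OF D, of a b a c] alt3_swap(2)[OF D, of a b a c] by simp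
  have s'': "D b a c b = - D b a b c" for a b c by (rule alt3_swap(2)[OF D])
  fix a b c d
  show "skew4 D a a c d = 0" "skew4 D a b b d = 0" "skew4 D a b c c = 0"
    by (simp_all add: skew4_def alt3_same[OF D])
  show "skew4 D a b a d = 0" using s[of a b d] by (simp add: skew4_def alt3_same[OF D])
  show "skew4 D a b c a = 0" using s'[of a b c] by (simp add: skew4_def alt3_same[OF D])
  show "skew4 D a b c b = 0" using s''[of b a c] by (simp add: skew4_def alt3_same[OF D])
  have l: "linear (\<lambda>a. D u a b c)" "linear (\<lambda>b. D u a b c)" "linear (\<lambda>c. D u a b c)" for u a b c
    by (rule alt3_linear[OF D])+
  show "linear (\<lambda>a. skew4 D a b c d)" "linear (\<lambda>b. skew4 D a b c d)"
    "linear (\<lambda>c. skew4 D a b c d)" "linear (\<lambda>d. skew4 D a b c d)"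
    unfolding skew4_def by (intro linear_compose_add linear_compose_sub lin l)+
qed

section \<open>The bracket at a point in terms of values and first derivatives\<close>

lemma has_derivative_vec_nth:
  "(f has_derivative f') (at x) \<Longrightarrow> ((\<lambda>y. f y $ i) has_derivative (\<lambda>u. f' u $ i)) (at x)"
  by (rule bounded_linear.has_derivative[OF bounded_linear_vec_nth])

lemma deriv_at_nth:
  "(f has_derivative f') (at x) \<Longrightarrow> deriv_at (\<lambda>y. f y $ i) x u = f' u $ i"
  by (drule has_derivative_vec_nth[of _ _ _ i]) (simp add: frechet_derivative_at[symmetric])

lemma deriv_at_const: "deriv_at (\<lambda>_. c) x = (\<lambda>_. 0)"
  using frechet_derivative_at[OF has_derivative_const[of c "at x"]] by simp

text \<open>Along a coordinate field every correction term has a zero argument, which leaves a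
  partial derivative.\<close>

lemma lie_deriv_const:
  assumes "alternating k (\<alpha> x)"
  shows "lie_deriv (\<lambda>_. c) k \<alpha> x v = deriv_at (\<lambda>y. \<alpha> y v) x c"
proof -
  have "\<alpha> x (v(i := 0)) = 0" if "i < k" for i
    using linear_0[OF alternating_linear[OF assms that, of v]] by simp
  then show ?thesis by (simp add: lie_deriv_def deriv_at_const)
qed

lemma alternating_nth:
  fixes a :: "('n::finite, real^'m::finite) mform"
  assumes a: "alternating k a"
  shows "alternating k (\<lambda>w. a w $ i)"
  unfolding alternating_def
proof (intro conjI allI impI)
  show "a v $ i = a w $ i" if "\<forall>i<k. v i = w i" for v w
    using alternating_cong[OF a, of v w] that by simp
  show "linear (\<lambda>u. a (v(m := u)) $ i)" if "m < k" for m v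
    using that by (intro linear_vec_nth_comp[of "\<lambda>u. a (v(m := u))"] alternating_linear[OF a])
  show "a v $ i = 0" if "m < k" "n < k" "m \<noteq> n \<and> v m = v n" for m n v
    using alternating_eq_0[OF a, of m n v] that by simp
qed

definition ext_deriv_form ::
  "nat \<Rightarrow> (real^'n \<Rightarrow> ('n, real^'n) mform) \<Rightarrow> 'n \<Rightarrow> ('n::finite, real) mform" where
  "ext_deriv_form k D i w = (\<Sum>m\<le>k. (-1) ^ m * D (w m) (\<lambda>n. if n < m then w n else w (Suc n)) $ i)"

text \<open>In the double sum that defines \<open>fn_local\<close>, each term is a multiple of the
  coordinate field belonging to one of the two indices. Taking the component \<open>j\<close> fixes
  that index and leaves a single sum.\<close>

lemma double_sum_axis:
  fixes a b d e :: "'n::finite \<Rightarrow> 'n \<Rightarrow> real"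
  shows "(\<Sum>i\<in>UNIV. \<Sum>m\<in>UNIV. a i m * axis m 1 $ j - b i m * axis i 1 $ j
       + c * (d i m * axis m 1 $ j + e i m * axis i 1 $ j))
    = (\<Sum>i\<in>UNIV. a i j) - (\<Sum>i\<in>UNIV. b j i) + c * ((\<Sum>i\<in>UNIV. d i j) + (\<Sum>i\<in>UNIV. e j i))"
proof -
  have 1: "(\<Sum>i\<in>UNIV. \<Sum>m\<in>UNIV. f i m * axis m 1 $ j) = (\<Sum>i\<in>UNIV. f i j)" for f :: "'n \<Rightarrow> 'n \<Rightarrow> real"
    by (simp add: axis_def if_distrib cong: if_cong)
  have 2: "(\<Sum>i\<in>UNIV. \<Sum>m\<in>UNIV. f i m * axis i 1 $ j) = (\<Sum>m\<in>UNIV. f j m)" for f :: "'n \<Rightarrow> 'n \<Rightarrow> real"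
    by (subst sum.swap) (simp add: axis_def if_distrib cong: if_cong)
  show ?thesis
    unfolding sum.distrib sum_subtractf 1 2 sum_distrib_left[symmetric] ..
qed

text \<open>The vector fields of the decomposition are coordinate fields: their Lie brackets vanish
  and their Lie derivatives are partial derivatives. Hence the bracket at \<open>x\<close> is an
  algebraic expression in the values and first derivatives of \<open>K\<close> and \<open>L\<close>
  at \<open>x\<close>.\<close>

lemma fn_local_nth:
  fixes K L :: "real^'n \<Rightarrow> ('n::finite, real^'n) mform"
  assumes K: "\<And>w. ((\<lambda>y. K y w) has_derivative (\<lambda>u. DK u w)) (at x)" "alternating k (K x)"
    and L: "\<And>w. ((\<lambda>y. L y w) has_derivative (\<lambda>u. DL u w)) (at x)" "alternating l (L x)"
  shows "fn_local k K l L x v $ j =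
     (\<Sum>i\<in>UNIV. wedge k l (\<lambda>w. K x w $ i) (\<lambda>w. DL (axis i 1) w $ j) v)
     - (\<Sum>i\<in>UNIV. wedge k l (\<lambda>w. DK (axis i 1) w $ j) (\<lambda>w. L x w $ i) v)
     + (-1) ^ k *
       ((\<Sum>i\<in>UNIV. wedge (k + 1) (l - 1) (ext_deriv_form k DK i)
           (interior_prod l (axis i 1) (\<lambda>w. L x w $ j)) v)
        + (\<Sum>i\<in>UNIV. wedge (k - 1) (l + 1) (interior_prod k (axis i 1) (\<lambda>w. K x w $ j))
           (ext_deriv_form l DL i) v))"
proof -
  have dK: "lie_deriv (\<lambda>_. c) k (\<lambda>y w. K y w $ i) x = (\<lambda>w. DK c w $ i)" for c i
    by (rule ext) (simp add: lie_deriv_const alternating_nth K deriv_at_nth[OF K(1)])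
  have dL: "lie_deriv (\<lambda>_. c) l (\<lambda>y w. L y w $ i) x = (\<lambda>w. DL c w $ i)" for c i
    by (rule ext) (simp add: lie_deriv_const alternating_nth L deriv_at_nth[OF L(1)])
  have eK: "ext_deriv k (\<lambda>y w. K y w $ i) x = ext_deriv_form k DK i" for i
    by (rule ext) (simp add: ext_deriv_def ext_deriv_form_def deriv_at_nth[OF K(1)])
  have eL: "ext_deriv l (\<lambda>y w. L y w $ i) x = ext_deriv_form l DL i" for i
    by (rule ext) (simp add: ext_deriv_def ext_deriv_form_def deriv_at_nth[OF L(1)])
  have lb: "lie_bracket (\<lambda>_. a) (\<lambda>_. b) x = 0" for a b :: "real^'n"
    by (simp add: lie_bracket_def deriv_at_const)
  show ?thesis
    unfolding fn_local_def fn_decomposable_def sum_component vector_add_component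
      vector_minus_component vector_scaleR_component dK dL eK eL lb
    by (simp add: double_sum_axis)
qed

text \<open>
  In \<open>fn23\<close> and \<open>fn33\<close>, the arguments \<open>K\<close>, \<open>L\<close> and \<open>DK\<close>, \<open>DL\<close> stand for the values at a point of two
  vector-valued forms and of their derivatives; a derivative takes its direction as first argument.
\<close>
definition fn23 ::
  "('v \<Rightarrow> 'v \<Rightarrow> 'v) \<Rightarrow> ('v \<Rightarrow> 'v \<Rightarrow> 'v \<Rightarrow> 'v) \<Rightarrow> ('v \<Rightarrow> 'v \<Rightarrow> 'v \<Rightarrow> 'v) \<Rightarrow>
   ('v \<Rightarrow> 'v \<Rightarrow> 'v \<Rightarrow> 'v \<Rightarrow> 'v) \<Rightarrow> 'v \<Rightarrow> 'v \<Rightarrow> 'v \<Rightarrow> 'v \<Rightarrow> 'v \<Rightarrow> 'v::real_vector" where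
  "fn23 K DK L DL v0 v1 v2 v3 v4 =
     DL (K v0 v1) v2 v3 v4 - DL (K v0 v2) v1 v3 v4 + DL (K v0 v3) v1 v2 v4
     - DL (K v0 v4) v1 v2 v3 + DL (K v1 v2) v0 v3 v4 - DL (K v1 v3) v0 v2 v4
     + DL (K v1 v4) v0 v2 v3 + DL (K v2 v3) v0 v1 v4 - DL (K v2 v4) v0 v1 v3
     + DL (K v3 v4) v0 v1 v2 - DK (L v2 v3 v4) v0 v1 + DK (L v1 v3 v4) v0 v2
     - DK (L v1 v2 v4) v0 v3 + DK (L v1 v2 v3) v0 v4 - DK (L v0 v3 v4) v1 v2
     + DK (L v0 v2 v4) v1 v3 - DK (L v0 v2 v3) v1 v4 - DK (L v0 v1 v4) v2 v3
     + DK (L v0 v1 v3) v2 v4 - DK (L v0 v1 v2) v3 v4 + L (skew3 DK v0 v1 v2) v3 v4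
     - L (skew3 DK v0 v1 v3) v2 v4 + L (skew3 DK v0 v1 v4) v2 v3 + L (skew3 DK v0 v2 v3) v1 v4
     - L (skew3 DK v0 v2 v4) v1 v3 + L (skew3 DK v0 v3 v4) v1 v2 - L (skew3 DK v1 v2 v3) v0 v4
     + L (skew3 DK v1 v2 v4) v0 v3 - L (skew3 DK v1 v3 v4) v0 v2 + L (skew3 DK v2 v3 v4) v0 v1
     + K (skew4 DL v1 v2 v3 v4) v0 - K (skew4 DL v0 v2 v3 v4) v1 + K (skew4 DL v0 v1 v3 v4) v2
     - K (skew4 DL v0 v1 v2 v4) v3 + K (skew4 DL v0 v1 v2 v3) v4"

definition fn33 ::
  "('v \<Rightarrow> 'v \<Rightarrow> 'v \<Rightarrow> 'v) \<Rightarrow> ('v \<Rightarrow> 'v \<Rightarrow> 'v \<Rightarrow> 'v \<Rightarrow> 'v) \<Rightarrow> 'v \<Rightarrow> 'v \<Rightarrow> 'v \<Rightarrow> 'v \<Rightarrow> 'v \<Rightarrow> 'v \<Rightarrow> 'v::real_vector"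
      where
  "fn33 K DK v0 v1 v2 v3 v4 v5 =
     DK (K v0 v1 v2) v3 v4 v5 - DK (K v0 v1 v3) v2 v4 v5 + DK (K v0 v1 v4) v2 v3 v5
     - DK (K v0 v1 v5) v2 v3 v4 + DK (K v0 v2 v3) v1 v4 v5 - DK (K v0 v2 v4) v1 v3 v5
     + DK (K v0 v2 v5) v1 v3 v4 + DK (K v0 v3 v4) v1 v2 v5 - DK (K v0 v3 v5) v1 v2 v4
     + DK (K v0 v4 v5) v1 v2 v3 - DK (K v1 v2 v3) v0 v4 v5 + DK (K v1 v2 v4) v0 v3 v5
     - DK (K v1 v2 v5) v0 v3 v4 - DK (K v1 v3 v4) v0 v2 v5 + DK (K v1 v3 v5) v0 v2 v4
     - DK (K v1 v4 v5) v0 v2 v3 + DK (K v2 v3 v4) v0 v1 v5 - DK (K v2 v3 v5) v0 v1 v4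
     + DK (K v2 v4 v5) v0 v1 v3 - DK (K v3 v4 v5) v0 v1 v2 - K (skew4 DK v0 v1 v2 v3) v4 v5
     + K (skew4 DK v0 v1 v2 v4) v3 v5 - K (skew4 DK v0 v1 v2 v5) v3 v4
     - K (skew4 DK v0 v1 v3 v4) v2 v5 + K (skew4 DK v0 v1 v3 v5) v2 v4
     - K (skew4 DK v0 v1 v4 v5) v2 v3 + K (skew4 DK v0 v2 v3 v4) v1 v5
     - K (skew4 DK v0 v2 v3 v5) v1 v4 + K (skew4 DK v0 v2 v4 v5) v1 v3
     - K (skew4 DK v0 v3 v4 v5) v1 v2 - K (skew4 DK v1 v2 v3 v4) v0 v5
     + K (skew4 DK v1 v2 v3 v5) v0 v4 - K (skew4 DK v1 v2 v4 v5) v0 v3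
     + K (skew4 DK v1 v3 v4 v5) v0 v2 - K (skew4 DK v2 v3 v4 v5) v0 v1"

text \<open>This eliminates the summation over coordinates: the component of a vector, multiplied
  with a map that has the corresponding \<open>axis i 1\<close> in a slot, becomes that vector in
  the slot.\<close>

lemma sum_axis_linear:
  fixes f :: "real^'n::finite \<Rightarrow> real^'n"
  assumes "linear f"
  shows "(\<Sum>i\<in>UNIV. x $ i * f (axis i 1) $ j) = f x $ j"
proof -
  have "f x = f (\<Sum>i\<in>UNIV. (x $ i) *\<^sub>R axis i 1)"
    using basis_expansion[of x] by (simp add: scalar_mult_eq_scaleR)
  also have "\<dots> = (\<Sum>i\<in>UNIV. (x $ i) *\<^sub>R f (axis i 1))"
    by (simp add: linear_sum[OF assms] linear_cmul[OF assms])
  finally show ?thesis by (simp add: sum_component)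
qed

lemma sum_axis_linear':
  fixes f :: "real^'n::finite \<Rightarrow> real^'n"
  shows "linear f \<Longrightarrow> (\<Sum>i\<in>UNIV. f (axis i 1) $ j * x $ i) = f x $ j"
  using sum_axis_linear[of f x j] by (simp only: mult.commute)

lemma ext_deriv_form_2:
  "ext_deriv_form 2 (\<lambda>u w. D u (w 0) (w 1)) i = (\<lambda>w. skew3 D (w 0) (w 1) (w 2) $ i)"
  by (rule ext) (simp add: ext_deriv_form_def skew3_def eval_nat_numeral)

lemma ext_deriv_form_3:
  "ext_deriv_form 3 (\<lambda>u w. D u (w 0) (w 1) (w 2)) i = (\<lambda>w. skew4 D (w 0) (w 1) (w 2) (w 3) $ i)"
  by (rule ext) (simp add: ext_deriv_form_def skew4_def eval_nat_numeral)

lemma interior_prod_2: "interior_prod 2 u (\<lambda>w. f (w 0) (w 1) $ j) = (\<lambda>w. f u (w 0) $ j)"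
  by (rule ext) (simp add: interior_prod_def)

lemma interior_prod_3: "interior_prod 3 u (\<lambda>w. f (w 0) (w 1) (w 2) $ j) = (\<lambda>w. f u (w 0) (w 1) $ j)"
  by (rule ext) (simp add: interior_prod_def numeral_2_eq_2)

lemma fn_local_2_3:
  fixes k :: "real^'n::finite \<Rightarrow> real^'n \<Rightarrow> real^'n"
  assumes K: "K x = (\<lambda>w. k (w 0) (w 1))"
      "\<And>w. ((\<lambda>y. K y w) has_derivative (\<lambda>u. dk u (w 0) (w 1))) (at x)"
    and L: "L x = (\<lambda>w. l (w 0) (w 1) (w 2))"
      "\<And>w. ((\<lambda>y. L y w) has_derivative (\<lambda>u. dl u (w 0) (w 1) (w 2))) (at x)"
    and alt: "alt2 k" "\<And>u. alt2 (dk u)" "alt3 l" "\<And>u. alt3 (dl u)"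
  shows "fn_local 2 K 3 L x v = fn23 k dk l dl (v 0) (v 1) (v 2) (v 3) (v 4)"
proof -
  have lk: "linear (\<lambda>u. dk u a b)" for a b
    using has_derivative_linear[OF K(2)[of "case_nat a (\<lambda>_. b)"]] by simp
  have ll: "linear (\<lambda>u. dl u a b c)" for a b c
    using has_derivative_linear[OF L(2)[of "case_nat a (case_nat b (\<lambda>_. c))"]]
    by (simp add: numeral_2_eq_2)
  have aK: "alternating 2 (K x)" unfolding K(1) by (rule alternating_2[OF alt(1)])
  have aL: "alternating 3 (L x)" unfolding L(1) by (rule alternating_3[OF alt(3)])
  have s3: "alt3 (skew3 dk)" by (rule alt3_skew3[OF lk alt(2)])
  have a: "alternating 2 (\<lambda>w. k (w 0) (w 1) $ i)" "alternating 2 (\<lambda>w. dk u (w 0) (w 1) $ i)"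
    "alternating 3 (\<lambda>w. l (w 0) (w 1) (w 2) $ i)" "alternating 3 (\<lambda>w. dl u (w 0) (w 1) (w 2) $ i)"
    "alternating 3 (\<lambda>w. skew3 dk (w 0) (w 1) (w 2) $ i)"
    "alternating 4 (\<lambda>w. skew4 dl (w 0) (w 1) (w 2) (w 3) $ i)"
    "alternating 1 (\<lambda>w. k u (w 0) $ i)" "alternating 2 (\<lambda>w. l u (w 0) (w 1) $ i)" for u i
    using alt s3 by (intro alternating_nth alternating_2 alternating_3 alternating_1
        alternating_skew4 ll;
        simp add: alt3_def alt2_def)+
  have ax: "(\<Sum>i\<in>UNIV. z $ i * k (axis i 1) b $ j) = k z b $ j"
    "(\<Sum>i\<in>UNIV. z $ i * l (axis i 1) b c $ j) = l z b c $ j"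
    "(\<Sum>i\<in>UNIV. z $ i * dk (axis i 1) b c $ j) = dk z b c $ j"
    "(\<Sum>i\<in>UNIV. z $ i * dl (axis i 1) b c d $ j) = dl z b c d $ j" for z b c d j
    by (intro sum_axis_linear[of "\<lambda>a. k a b"] sum_axis_linear[of "\<lambda>a. l a b c"]
        sum_axis_linear[of "\<lambda>a. dk a b c"] sum_axis_linear[of "\<lambda>a. dl a b c d"]
        alt2_linear alt3_linear alt lk ll)+
  have ax': "(\<Sum>i\<in>UNIV. k (axis i 1) b $ j * z $ i) = k z b $ j"
    "(\<Sum>i\<in>UNIV. l (axis i 1) b c $ j * z $ i) = l z b c $ j"
    "(\<Sum>i\<in>UNIV. dk (axis i 1) b c $ j * z $ i) = dk z b c $ j"
    "(\<Sum>i\<in>UNIV. dl (axis i 1) b c d $ j * z $ i) = dl z b c d $ j" for z b c d j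
    by (intro sum_axis_linear'[of "\<lambda>a. k a b"] sum_axis_linear'[of "\<lambda>a. l a b c"]
        sum_axis_linear'[of "\<lambda>a. dk a b c"] sum_axis_linear'[of "\<lambda>a. dl a b c d"]
        alt2_linear alt3_linear alt lk ll)+
  have d: "2 + 1 = (3::nat)" "3 - 1 = (2::nat)" "2 - 1 = (1::nat)" "3 + 1 = (4::nat)" by simp_all
  show ?thesis
  proof (rule vec_eq_iff[THEN iffD2, rule_format])
    fix j
    show "fn_local 2 K 3 L x v $ j = fn23 k dk l dl (v 0) (v 1) (v 2) (v 3) (v 4) $ j"
      unfolding fn_local_nth[OF K(2) aK L(2) aL] K(1) L(1) ext_deriv_form_2 ext_deriv_form_3 d
        interior_prod_2 interior_prod_3 fn23_def wedge_2_3[OF a(1) a(4)] wedge_2_3[OF a(2) a(3)]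
        wedge_3_2[OF a(5) a(8)] wedge_1_4[OF a(7) a(6)]
      by (simp add: sum.distrib sum_subtractf ax ax' del: One_nat_def)
  qed
qed

text \<open>The bracket of a 3-form with itself consists of two equal halves. Exchanging the factors
  reverses the sign of the wedge product of two 3-forms, matching the opposite signs of the first
  two sums, and preserves that of a 4-form and a 2-form. Hence the factor 2; \<open>fn33\<close> is
  one half.\<close>

lemma fn_local_3_3:
  fixes k :: "real^'n::finite \<Rightarrow> real^'n \<Rightarrow> real^'n \<Rightarrow> real^'n"
  assumes K: "K x = (\<lambda>w. k (w 0) (w 1) (w 2))"
      "\<And>w. ((\<lambda>y. K y w) has_derivative (\<lambda>u. dk u (w 0) (w 1) (w 2))) (at x)"
    and alt: "alt3 k" "\<And>u. alt3 (dk u)"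
  shows "fn_local 3 K 3 K x v = 2 *\<^sub>R fn33 k dk (v 0) (v 1) (v 2) (v 3) (v 4) (v 5)"
proof -
  have lk: "linear (\<lambda>u. dk u a b c)" for a b c
    using has_derivative_linear[OF K(2)[of "case_nat a (case_nat b (\<lambda>_. c))"]]
    by (simp add: numeral_2_eq_2)
  have aK: "alternating 3 (K x)" unfolding K(1) by (rule alternating_3[OF alt(1)])
  have a: "alternating 3 (\<lambda>w. k (w 0) (w 1) (w 2) $ i)"
      "alternating 3 (\<lambda>w. dk u (w 0) (w 1) (w 2) $ i)"
    "alternating 4 (\<lambda>w. skew4 dk (w 0) (w 1) (w 2) (w 3) $ i)"
    "alternating 2 (\<lambda>w. k u (w 0) (w 1) $ i)" for u i
    using alt by (intro alternating_nth alternating_2 alternating_3 alternating_skew4 lk;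
        simp add: alt3_def)+
  have ax: "(\<Sum>i\<in>UNIV. z $ i * k (axis i 1) b c $ j) = k z b c $ j"
    "(\<Sum>i\<in>UNIV. z $ i * dk (axis i 1) b c d $ j) = dk z b c d $ j" for z b c d j
    by (intro sum_axis_linear[of "\<lambda>a. k a b c"] sum_axis_linear[of "\<lambda>a. dk a b c d"]
        alt3_linear alt lk)+
  have ax': "(\<Sum>i\<in>UNIV. k (axis i 1) b c $ j * z $ i) = k z b c $ j"
    "(\<Sum>i\<in>UNIV. dk (axis i 1) b c d $ j * z $ i) = dk z b c d $ j" for z b c d j
    by (intro sum_axis_linear'[of "\<lambda>a. k a b c"] sum_axis_linear'[of "\<lambda>a. dk a b c d"]
        alt3_linear alt lk)+
  show ?thesis
  proof (rule vec_eq_iff[THEN iffD2, rule_format])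
    fix j
    show "fn_local 3 K 3 K x v $ j =
        (2 *\<^sub>R fn33 k dk (v 0) (v 1) (v 2) (v 3) (v 4) (v 5)) $ j"
      unfolding fn_local_nth[OF K(2) aK K(2) aK] K(1) ext_deriv_form_3 interior_prod_3 fn33_def
        wedge_3_3[OF a(1) a(2)] wedge_3_3[OF a(2) a(1)] add_diff_cancel_left' numeral_plus_one
      by (simp add: wedge_4_2[OF a(3) a(4)] wedge_2_4[OF a(4) a(3)] sum.distrib sum_subtractf ax ax'
          del: One_nat_def)
  qed
qed

text \<open>Alternation over the direction cancels all terms with the symmetric \<open>G\<close>
  inside \<open>K\<close>. Those with \<open>G\<close> outside remain and cancel only within the
  full bracket.\<close>

lemma skew3_flat:
  assumes K: "alt2 K" and G: "\<And>u v. G u v = G v u"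
    and DK: "\<And>u a b. DK u a b = Q u a b - G u (K a b) + K (G u a) b + K a (G u b)"
  shows "skew3 DK a b c = skew3 Q a b c - (G a (K b c) - G b (K a c) + G c (K a b))"
proof -
  have m: "K x (G y z) = - K (G y z) x" for x y z by (rule alt2_swap[OF K])
  have g: "G b a = G a b" "G c a = G a c" "G c b = G b c" by (rule G)+
  show ?thesis by (simp add: skew3_def DK m g)
qed

lemma skew4_flat:
  assumes L: "alt3 L" and G: "\<And>u v. G u v = G v u"
    and DL: "\<And>u a b c. DL u a b c =
      R u a b c - G u (L a b c) + L (G u a) b c + L a (G u b) c + L a b (G u c)"
  shows "skew4 DL a b c d = skew4 R a b c d -
      (G a (L b c d) - G b (L a c d) + G c (L a b d) - G d (L a b c))"
proof -
  have m: "L x (G y z) w = - L (G y z) x w" for x y z w by (rule alt3_swap[OF L])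
  have m': "L x w (G y z) = L (G y z) x w" for x y z w
    using alt3_swap(2)[OF L, of x "G y z" w] m by simp
  have g: "G b a = G a b" "G c a = G a c" "G c b = G b c" "G d a = G a d" "G d b = G b d" "G d c
      = G c d"
    by (rule G)+
  show ?thesis by (simp add: skew4_def DL m m' g)
qed

text \<open>
  All terms with the symmetric \<open>G\<close> cancel: this is where torsion-freeness of the connection enters.
\<close>
lemma fn23_flat:
  assumes K: "alt2 K" and L: "alt3 L" and G: "\<And>u v. G u v = G v u"
    and DK: "\<And>u a b. DK u a b = Q u a b - G u (K a b) + K (G u a) b + K a (G u b)"
    and DL: "\<And>u a b c. DL u a b c =
      R u a b c - G u (L a b c) + L (G u a) b c + L a (G u b) c + L a b (G u c)"
  shows "fn23 K DK L DL a b c d e = fn23 K Q L R a b c d e"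
proof -
  have m: "K x (G y z) = - K (G y z) x" for x y z by (rule alt2_swap[OF K])
  have n: "L x (G y z) w = - L (G y z) x w" for x y z w by (rule alt3_swap[OF L])
  have n': "L x w (G y z) = L (G y z) x w" for x y z w
    using alt3_swap(2)[OF L, of x "G y z" w] n by simp
  note lin = alt2_linear(1)[OF K, THEN linear_add] alt2_linear(1)[OF K, THEN linear_diff]
    alt3_linear(1)[OF L, THEN linear_add] alt3_linear(1)[OF L, THEN linear_diff]
  have s3: "skew3 DK a b c = skew3 Q a b c - (G a (K b c) - G b (K a c) + G c (K a b))" for a b c
    by (rule skew3_flat[where G = G and DK = DK and Q = Q, OF K G DK])
  have s4: "skew4 DL a b c d = skew4 R a b c d -
      (G a (L b c d) - G b (L a c d) + G c (L a b d) - G d (L a b c))" for a b c d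
    by (rule skew4_flat[where G = G and DL = DL and R = R, OF L G DL])
  \<comment> \<open>Every remaining occurrence of \<open>G\<close> receives a name that fixes the
    order of its two arguments. After that the cancellation is mere addition of vectors.\<close>
  define P where "P x y w x' y' = G (K x y) (L w x' y')" for x y w x' y'
  have P: "G (K x y) (L w x' y') = P x y w x' y'" "G (L w x' y') (K x y) = P x y w x' y'"
    for x y w x' y' using G by (auto simp: P_def)
  define g1 where "g1 z x y = G z (K x y)" for z x y
  define g2 where "g2 z x y w = G z (L x y w)" for z x y w
  have g1: "G (K x y) a = g1 a x y" "G (K x y) b = g1 b x y" "G (K x y) c = g1 c x y"
    "G (K x y) d = g1 d x y" "G (K x y) e = g1 e x y"
    "G a (K x y) = g1 a x y" "G b (K x y) = g1 b x y" "G c (K x y) = g1 c x y"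
    "G d (K x y) = g1 d x y" "G e (K x y) = g1 e x y" for x y
    using G by (auto simp: g1_def)
  have g2: "G (L x y w) a = g2 a x y w" "G (L x y w) b = g2 b x y w" "G (L x y w) c = g2 c x y w"
    "G (L x y w) d = g2 d x y w" "G (L x y w) e = g2 e x y w"
    "G a (L x y w) = g2 a x y w" "G b (L x y w) = g2 b x y w" "G c (L x y w) = g2 c x y w"
    "G d (L x y w) = g2 d x y w" "G e (L x y w) = g2 e x y w" for x y w
    using G by (auto simp: g2_def)
  show ?thesis
    unfolding fn23_def
    unfolding s3 s4
    unfolding DK DL
    unfolding lin
    unfolding P
    unfolding n'
    unfolding m n
    unfolding g1 g2 by (simp add: algebra_simps)
qed

lemma fn33_flat:
  assumes L: "alt3 L" and G: "\<And>u v. G u v = G v u"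
    and DL: "\<And>u a b c. DL u a b c =
      R u a b c - G u (L a b c) + L (G u a) b c + L a (G u b) c + L a b (G u c)"
  shows "fn33 L DL a b c d e f = fn33 L R a b c d e f"
proof -
  have n: "L x (G y z) w = - L (G y z) x w" for x y z w by (rule alt3_swap[OF L])
  have n': "L x w (G y z) = L (G y z) x w" for x y z w
    using alt3_swap(2)[OF L, of x "G y z" w] n by simp
  note lin = alt3_linear(1)[OF L, THEN linear_add] alt3_linear(1)[OF L, THEN linear_diff]
  have s4: "skew4 DL a b c d = skew4 R a b c d -
      (G a (L b c d) - G b (L a c d) + G c (L a b d) - G d (L a b c))" for a b c d
    by (rule skew4_flat[where G = G and DL = DL and R = R, OF L G DL])
  \<comment> \<open>These are the ten ways of splitting six vectors into two triples.\<close>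
  have P: "G (L d e f) (L a b c) = G (L a b c) (L d e f)" "G (L c e f) (L a b d)
      = G (L a b d) (L c e f)"
    "G (L c d f) (L a b e) = G (L a b e) (L c d f)" "G (L c d e) (L a b f) = G (L a b f) (L c d e)"
    "G (L b e f) (L a c d) = G (L a c d) (L b e f)" "G (L b d f) (L a c e) = G (L a c e) (L b d f)"
    "G (L b d e) (L a c f) = G (L a c f) (L b d e)" "G (L b c f) (L a d e) = G (L a d e) (L b c f)"
    "G (L b c e) (L a d f) = G (L a d f) (L b c e)" "G (L b c d) (L a e f) = G (L a e f) (L b c d)"
    by (rule G)+
  define g where "g z x y w = G z (L x y w)" for z x y w
  have g: "G (L x y w) a = g a x y w" "G (L x y w) b = g b x y w" "G (L x y w) c = g c x y w"
    "G (L x y w) d = g d x y w" "G (L x y w) e = g e x y w" "G (L x y w) f = g f x y w"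
    "G a (L x y w) = g a x y w" "G b (L x y w) = g b x y w" "G c (L x y w) = g c x y w"
    "G d (L x y w) = g d x y w" "G e (L x y w) = g e x y w" "G f (L x y w) = g f x y w" for x y w
    using G by (auto simp: g_def)
  show ?thesis
    unfolding fn33_def
    unfolding s4
    unfolding DL
    unfolding lin
    unfolding P
    unfolding n'
    unfolding n
    unfolding g by (simp add: algebra_simps)
qed

section \<open>Linear algebra of a single G2-form\<close>

lemma UNIV_7: "(UNIV :: 7 set) = {1, 2, 3, 4, 5, 6, 7}"
proof -
  have "card {1, 2, 3, 4, 5, 6, 7 :: 7} = CARD(7)" by simp
  then show ?thesis by (metis card_subset_eq finite_class.finite_UNIV subset_UNIV)
qed

lemma forall_7: "(\<forall>i::7. P i) \<longleftrightarrow> P 1 \<and> P 2 \<and> P 3 \<and> P 4 \<and> P 5 \<and> P 6 \<and> P 7"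
  using UNIV_7 by (metis UNIV_I empty_iff insert_iff)

lemma sum_7: "sum f (UNIV :: 7 set) = f 1 + f 2 + f 3 + f 4 + f 5 + f 6 + f 7"
  for f :: "7 \<Rightarrow> 'b::comm_monoid_add"
  unfolding UNIV_7 by (simp add: add_ac)

lemma matrix_inv:
  fixes A :: "real^'n^'n"
  assumes "invertible A"
  shows "A ** matrix_inv A = mat 1" "matrix_inv A ** A = mat 1"
  using assms someI_ex[of "\<lambda>B. A ** B = mat 1 \<and> B ** A = mat 1"]
  by (auto simp: invertible_def matrix_inv_def)

lemma linear_axis_sum:
  fixes q :: "real^'n \<Rightarrow> real"
  assumes "linear q"
  shows "(\<Sum>i\<in>UNIV. (u $ i) * q (axis i 1)) = q u"
proof -
  have "q (\<Sum>i\<in>UNIV. (u $ i) *\<^sub>R axis i 1) = (\<Sum>i\<in>UNIV. (u $ i) * q (axis i 1))"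
    by (simp add: linear_sum[OF assms] linear_cmul[OF assms])
  then show ?thesis
    using basis_expansion[of u] by (simp add: scalar_mult_eq_scaleR)
qed

lemma linear_wedge_list:
  assumes \<epsilon>: "\<And>j. linear (\<epsilon> j)"
  shows "i < length is \<Longrightarrow> linear (\<lambda>u. wedge_list \<epsilon> is (v(i := u)))"
proof (induction i arbitrary: "is" v)
  case 0
  then obtain n where n: "length is = Suc n" by (cases "is") auto
  show ?case
    unfolding wedge_list_rec[OF n]
    by (intro linear_compose_sum ballI)
      (simp add: linear_iff linear_add[OF \<epsilon>] linear_cmul[OF \<epsilon>] algebra_simps)
next
  case (Suc i)
  then obtain n where n: "length is = Suc n" by (cases "is") auto
  have eq: "(\<lambda>m. (v(Suc i := u)) (Suc m)) = (\<lambda>m. v (Suc m))(i := u)" for u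
    by auto
  have "linear (\<lambda>u. wedge_list \<epsilon> (take r is @ drop (Suc r) is) ((\<lambda>m. v (Suc m))(i := u)))"
    if "r \<le> n" for r
    by (rule Suc.IH) (use n Suc.prems that in auto)
  then show ?case
    unfolding wedge_list_rec[OF n] eq
    by (intro linear_compose_sum ballI) (simp add: linear_iff algebra_simps)
qed

lemma wedge_list_Cons:
  "wedge_list \<epsilon> (i # is) v =
    (\<Sum>r\<le>length is. (-1) ^ r * \<epsilon> ((i # is) ! r) (v 0)
       * wedge_list \<epsilon> (take r (i # is) @ drop (Suc r) (i # is)) (\<lambda>n. v (Suc n)))"
  by (rule wedge_list_rec) simp

lemma wedge_list_3:
  "wedge_list \<epsilon> [i, j, k] v =
     \<epsilon> i (v 0) * (\<epsilon> j (v 1) * \<epsilon> k (v 2) - \<epsilon> k (v 1) * \<epsilon> j (v 2))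
     - \<epsilon> j (v 0) * (\<epsilon> i (v 1) * \<epsilon> k (v 2) - \<epsilon> k (v 1) * \<epsilon> i (v 2))
     + \<epsilon> k (v 0) * (\<epsilon> i (v 1) * \<epsilon> j (v 2) - \<epsilon> j (v 1) * \<epsilon> i (v 2))"
  by (simp add: wedge_list_Cons wedge_list_Nil numeral_2_eq_2)

lemma wedge_list_4:
  "wedge_list \<epsilon> [i, j, k, l] v =
     \<epsilon> i (v 0) * wedge_list \<epsilon> [j, k, l] (\<lambda>n. v (Suc n))
     - \<epsilon> j (v 0) * wedge_list \<epsilon> [i, k, l] (\<lambda>n. v (Suc n))
     + \<epsilon> k (v 0) * wedge_list \<epsilon> [i, j, l] (\<lambda>n. v (Suc n))
     - \<epsilon> l (v 0) * wedge_list \<epsilon> [i, j, k] (\<lambda>n. v (Suc n))"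
  by (simp add: wedge_list_Cons[of \<epsilon> i "[j, k, l]"] numeral_3_eq_3)

lemma sum_PiE_3:
  "(\<Sum>I \<in> {..<3::nat} \<rightarrow>\<^sub>E (UNIV :: 'i::finite set). F (I 0) (I 1) (I 2)) =
     (\<Sum>i\<in>UNIV. \<Sum>j\<in>UNIV. \<Sum>k\<in>UNIV. F i j k)"
proof -
  \<comment> \<open>The members of \<open>\<rightarrow>\<^sub>E\<close> are \<open>undefined\<close>
    off the domain, so the inverse map has to take this value there as well.\<close>
  let ?f = "\<lambda>(i, j, k). \<lambda>n::nat. if n = 0 then i else if n = 1 then j else if n
      = 2 then k else undefined"
  have "(\<Sum>I \<in> {..<3::nat} \<rightarrow>\<^sub>E (UNIV :: 'i set). F (I 0) (I 1) (I 2))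
      = (\<Sum>(i, j, k) \<in> UNIV \<times> UNIV \<times> UNIV. F i j k)"
    by (rule sum.reindex_bij_witness[of _ ?f "\<lambda>I. (I 0, I 1, I 2)"])
      (auto simp: fun_eq_iff PiE_def extensional_def nat_less_3_iff)
  then show ?thesis by (simp add: sum.cartesian_product)
qed

section \<open>A single tangent space with a \<open>G\<^sub>2\<close>-frame: metric, volume and
  Hodge star\<close>

locale g2_point =
  fixes \<alpha> :: "(7, real) mform" and g :: "real^7 \<Rightarrow> real^7 \<Rightarrow> real" and e :: "7 \<Rightarrow> real^7"
  assumes alternating: "alternating 3 \<alpha>" and frame: "g2_frame \<alpha> e"
    and bilinear: "bilinear g" and sym: "g u v = g v u"
    and orthonormal: "g (e i) (e j) = (if i = j then 1 else 0)"
begin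

abbreviation "x \<equiv> dual_basis e"
abbreviation "M \<equiv> frame_matrix e"

lemma det_pos: "0 < det M"
  using frame by (simp add: g2_frame_def)

lemma invertible: "invertible M"
  using det_pos by (simp add: invertible_det_nz)

lemma column_frame_matrix: "column j M = e j"
  by (simp add: column_def frame_matrix_def vec_eq_iff)

lemma linear_x: "linear (x i)"
  unfolding dual_basis_def
  by (rule linear_vec_nth_comp) (rule matrix_vector_mul_linear)

lemma x_frame: "x i (e j) = (if i = j then 1 else 0)"
proof -
  have "matrix_inv M *v (M *v axis j 1) = axis j 1"
    by (simp add: matrix_vector_mul_assoc matrix_inv(2)[OF invertible])
  then have "matrix_inv M *v e j = axis j 1"
    by (simp only: matrix_vector_mult_basis column_frame_matrix)
  then show ?thesis
    by (simp add: dual_basis_def axis_def)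
qed

lemma frame_expansion: "u = (\<Sum>j\<in>UNIV. x j u *\<^sub>R e j)"
proof -
  have "u = M *v (matrix_inv M *v u)"
    by (simp add: matrix_vector_mul_assoc matrix_inv(1)[OF invertible])
  then show ?thesis
    by (simp add: matrix_mult_sum column_frame_matrix dual_basis_def scalar_mult_eq_scaleR)
qed

lemma x_eqI: "(\<And>i. x i u = x i v) \<Longrightarrow> u = v"
  using frame_expansion[of u] frame_expansion[of v] by simp

lemma linear_g: "linear (g u)" "linear (\<lambda>u. g u v)"
  using bilinear by (simp_all add: bilinear_def)

lemma g_frame: "g (e i) u = x i u"
proof -
  have "g (e i) u = g (e i) (\<Sum>j\<in>UNIV. x j u *\<^sub>R e j)"
    using frame_expansion[of u] by simp
  also have "\<dots> = x i u"
    by (simp add: linear_sum[OF linear_g(1)] linear_cmul[OF linear_g(1)] orthonormal if_distrib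
        cong: if_cong)
  finally show ?thesis .
qed

lemma g_eq: "g u v = (\<Sum>i\<in>UNIV. x i u * x i v)"
proof -
  have "g u v = g (\<Sum>j\<in>UNIV. x j u *\<^sub>R e j) v"
    using frame_expansion[of u] by simp
  then show ?thesis
    by (simp add: linear_sum[OF linear_g(2)] linear_cmul[OF linear_g(2)] g_frame)
qed

lemma gram_eq: "gram g = transpose (matrix_inv M) ** matrix_inv M"
proof -
  have "x k (axis i 1) = matrix_inv M $ k $ i" for k i
    by (simp add: dual_basis_def matrix_vector_mult_basis column_def)
  then show ?thesis
    by (simp add: gram_def vec_eq_iff g_eq matrix_matrix_mult_def transpose_def)
qed

lemma det_inv: "det (matrix_inv M) = 1 / det M"
proof -
  have "det M * det (matrix_inv M) = 1"
    by (simp add: det_mul[symmetric] matrix_inv(1)[OF invertible])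
  then show ?thesis using det_pos by (simp add: field_simps)
qed

text \<open>Here the orientation enters: the determinant of a positively oriented frame is positive,
  so the square root is \<open>1 / det M\<close> and not its negative.\<close>

lemma det_gram: "sqrt (det (gram g)) = 1 / det M"
  using det_pos by (simp add: gram_eq det_mul det_transpose det_inv real_sqrt_mult real_sqrt_divide)

lemma invertible_gram: "invertible (gram g)"
  using det_pos by (simp add: invertible_det_nz gram_eq det_mul det_transpose det_inv)

lemma g_sharp:
  assumes "linear f"
  shows "g (sharp g f) u = f u"
proof -
  have nth: "(gram g *v w) $ j = g (axis j 1) w" for w j
  proof -
    have "g (axis j 1) w = g (axis j 1) (\<Sum>i\<in>UNIV. (w $ i) *\<^sub>R axis i 1)"
      using basis_expansion[of w] by (simp add: scalar_mult_eq_scaleR)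
    then show ?thesis
      by (simp add: linear_sum[OF linear_g(1)] linear_cmul[OF linear_g(1)] matrix_vector_mult_def
          gram_def mult.commute)
  qed
  have "gram g *v sharp g f = (\<chi> i. f (axis i 1))"
    by (simp add: sharp_def matrix_vector_mul_assoc matrix_inv(1)[OF invertible_gram])
  then have axis: "g (axis j 1) (sharp g f) = f (axis j 1)" for j
    using nth[of "sharp g f" j] by simp
  have u: "u = (\<Sum>i\<in>UNIV. (u $ i) *\<^sub>R axis i 1)"
    using basis_expansion[of u] by (simp add: scalar_mult_eq_scaleR)
  have "g (sharp g f) u = g u (sharp g f)" by (rule sym)
  also have "\<dots> = (\<Sum>i\<in>UNIV. u $ i * f (axis i 1))"
    by (subst u) (simp add: linear_sum[OF linear_g(2)] linear_cmul[OF linear_g(2)] axis)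
  also have "\<dots> = f u"
    by (rule linear_axis_sum[OF assms])
  finally show ?thesis .
qed

lemma linear_coord: "linear (\<lambda>u::real^7. u $ i)"
  by (rule bounded_linear.linear[OF bounded_linear_vec_nth])

text \<open>The inverse metric, as the sum of the tensors of a frame with the sharps of its dual
  frame, does not depend on the frame. The coordinate frame is exchanged for the orthonormal frame
  \<open>e\<close>, in which the sharp of each dual covector is the frame vector itself.\<close>

lemma sum_sharp:
  fixes p q :: "real^7 \<Rightarrow> real"
  assumes p: "linear p" and q: "linear q"
  shows "(\<Sum>i\<in>UNIV. p (sharp g (\<lambda>u. u $ i)) * q (axis i 1)) = (\<Sum>m\<in>UNIV. p (e m) * q (e m))"
proof -
  have "x m (sharp g (\<lambda>u. u $ i)) = e m $ i" for i m
    using g_frame[of m] sym g_sharp[OF linear_coord] by metis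
  then have "sharp g (\<lambda>u. u $ i) = (\<Sum>m\<in>UNIV. (e m $ i) *\<^sub>R e m)" for i
    using frame_expansion[of "sharp g (\<lambda>u. u $ i)"] by simp
  then have "p (sharp g (\<lambda>u. u $ i)) = (\<Sum>m\<in>UNIV. (e m $ i) * p (e m))" for i
    by (simp add: linear_sum[OF p] linear_cmul[OF p])
  then have "(\<Sum>i\<in>UNIV. p (sharp g (\<lambda>u. u $ i)) * q (axis i 1))
      = (\<Sum>i\<in>UNIV. \<Sum>m\<in>UNIV. p (e m) * ((e m $ i) * q (axis i 1)))"
    by (simp only: sum_distrib_right) (simp only: mult_ac)
  also have "\<dots> = (\<Sum>m\<in>UNIV. p (e m) * (\<Sum>i\<in>UNIV. (e m $ i) * q (axis i 1)))"
    by (subst sum.swap) (simp add: sum_distrib_left)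
  finally show ?thesis by (simp only: linear_axis_sum[OF q])
qed

lemma g_delta_form:
  assumes "linear (\<lambda>u. \<Psi> (case_nat u v))"
  shows "g (delta_form g \<Psi> v) u = \<Psi> (case_nat u v)"
proof -
  have "g (delta_form g \<Psi> v) u = (\<Sum>i\<in>UNIV. u $ i * \<Psi> (case_nat (axis i 1) v))"
    unfolding delta_form_def
    by (simp add: linear_sum[OF linear_g(2)] linear_cmul[OF linear_g(2)] g_sharp[OF linear_coord]
        mult.commute)
  also have "\<dots> = \<Psi> (case_nat u v)"
    by (rule linear_axis_sum[OF assms])
  finally show ?thesis .
qed

lemma x_delta_form:
  "linear (\<lambda>u. \<Psi> (case_nat u v)) \<Longrightarrow> x i (delta_form g \<Psi> v) = \<Psi> (case_nat (e i) v)"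
  using g_delta_form[of \<Psi> v "e i"] by (simp add: g_frame[symmetric] sym[of "e i"])

text \<open>Passing from coordinates to components in the frame multiplies the determinant by
  \<open>det M\<close>, which cancels the factor found in \<open>det_gram\<close>.\<close>

lemma vol_form_eq: "vol_form g v = wedge_list x [1, 2, 3, 4, 5, 6, 7] v"
proof -
  let ?is = "[1, 2, 3, 4, 5, 6, 7] :: 7 list"
  have d: "distinct ?is" by simp
  have s: "set ?is = UNIV" unfolding UNIV_7 by simp
  define h where "h = the_inv_into {..<length ?is} ((!) ?is)"
  have h: "h (?is ! r) = r" if "r < length ?is" for r
    unfolding h_def
    by (rule the_inv_into_f_f) (use that d in \<open>auto simp: inj_on_nth simp del: length_Cons\<close>)
  note det = wedge_list_eq_det[OF d s h]
  have "(\<chi> i j. v (h j) $ i) = M ** (\<chi> i j. x i (v (h j)))"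
  proof -
    have "v (h j) $ i = (\<Sum>m\<in>UNIV. x m (v (h j)) *\<^sub>R e m) $ i" for i j
      using frame_expansion[of "v (h j)"] by simp
    then show ?thesis
      by (simp add: vec_eq_iff matrix_matrix_mult_def frame_matrix_def sum_component mult.commute)
  qed
  moreover have "wedge_list (\<lambda>i u. u $ i) ?is v = det (\<chi> i j. v (h j) $ i)"
    by (rule det)
  moreover have "wedge_list x ?is v = det (\<chi> i j. x i (v (h j)))"
    by (rule det)
  ultimately show ?thesis
    using det_pos by (simp only: vol_form_def det_gram det_mul) simp
qed

definition trip :: "'v \<Rightarrow> 'v \<Rightarrow> 'v \<Rightarrow> (nat \<Rightarrow> 'v) \<Rightarrow> nat \<Rightarrow> 'v" where
  "trip a b c v n = (if n = 0 then a else if n = 1 then b else if n = 2 then c else v (n - 3))"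

lemma form_eq: "\<alpha> v = wedge_list x [1,2,3] v + wedge_list x [1,4,5] v + wedge_list x [1,6,7] v
    + wedge_list x [2,4,6] v - wedge_list x [2,5,7] v - wedge_list x [3,4,7] v
        - wedge_list x [3,5,6] v"
  using frame by (simp add: g2_frame_def Let_def)

text \<open>On frame vectors a monomial is an alternating sum of products of Kronecker symbols, so
  only six of the 343 terms survive.\<close>

lemma contract_vol:
  "(\<Sum>a\<in>UNIV. \<Sum>b\<in>UNIV. \<Sum>c\<in>UNIV.
     wedge_list x [i, j, k] (trip (e a) (e b) (e c) u) * W a b c)
   = W i j k - W i k j - W j i k + W k i j + W j k i - W k j i" (is "?l = ?r")
proof -
  have 0: "(\<Sum>a\<in>UNIV. \<Sum>b\<in>UNIV. \<Sum>c\<in>UNIV.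
      (x i (e a) * x j (e b) * x k (e c)) * W a b c) = W i j k" for i j k
  proof -
    have "(\<Sum>c\<in>UNIV. if P then f c else 0) = (if P then sum f UNIV else 0)" for P and f :: "7 \<Rightarrow> real"
      by simp
    then show ?thesis
      by (simp add: x_frame if_distrib[of "\<lambda>y. y * _"] cong: if_cong)
  qed
  have "?l = (\<Sum>a\<in>UNIV. \<Sum>b\<in>UNIV. \<Sum>c\<in>UNIV.
      (x i (e a) * x j (e b) * x k (e c)) * W a b c - (x i (e a) * x k (e b) * x j (e c)) * W a b c
      - (x j (e a) * x i (e b) * x k (e c)) * W a b c
          + (x k (e a) * x i (e b) * x j (e c)) * W a b c
      + (x j (e a) * x k (e b) * x i (e c)) * W a b c
          - (x k (e a) * x j (e b) * x i (e c)) * W a b c)"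
    by (intro sum.cong refl) (simp add: wedge_list_3 trip_def algebra_simps)
  also have "\<dots> = ?r"
    unfolding sum.distrib sum_subtractf 0 ..
  finally show ?thesis .
qed

text \<open>Contracting a monomial with a frame vector deletes one factor, with a sign given by the
  number of factors before it. Stated with \<open>takeWhile\<close> and \<open>remove1\<close>, the
  result can be computed on explicit lists.\<close>

lemma wedge_list_frame:
  assumes v: "v 0 = e i" and i: "i \<in> set is" and d: "distinct is"
  shows "wedge_list x is v =
    (-1) ^ length (takeWhile ((\<noteq>) i) is) * wedge_list x (remove1 i is) (\<lambda>n. v (Suc n))"
proof -
  obtain ys zs where is_eq: "is = ys @ i # zs" and ys: "i \<notin> set ys"
    using split_list_first[OF i] by blast
  have n: "length is = Suc (length ys + length zs)" by (simp add: is_eq)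
  have x: "x (is ! r) (v 0) = (if r = length ys then 1 else 0)" if "r \<le> length ys + length zs" for r
    using nth_eq_iff_index_eq[OF d, of r "length ys"] that by (simp add: v x_frame n is_eq)
  have "wedge_list x is v = (\<Sum>r\<le>length ys + length zs. if r = length ys
      then (-1) ^ r * wedge_list x (take r is @ drop (Suc r) is) (\<lambda>n. v (Suc n)) else 0)"
    unfolding wedge_list_rec[OF n] by (intro sum.cong refl) (simp add: x)
  moreover have "takeWhile ((\<noteq>) i) is = ys"
    unfolding is_eq by (subst takeWhile_append2) (use ys in auto)
  moreover have "remove1 i is = ys @ zs"
    using ys by (simp add: is_eq remove1_append)
  ultimately show ?thesis by (simp add: is_eq)
qed

text \<open>The star is defined by sums over the coordinate frame. Each of the three sums is turned
  into one over the frame \<open>e\<close> by \<open>sum_sharp\<close>; there every monomial of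
  \<phi> yields, by \<open>contract_vol\<close>, six equal contributions, which account for the
  factor \<open>3! = 6\<close>.\<close>

lemma hodge_eq:
  "hodge g 3 \<alpha> v = wedge_list x [4,5,6,7] v + wedge_list x [2,3,6,7] v + wedge_list x [2,3,4,5] v
    + wedge_list x [1,3,5,7] v - wedge_list x [1,3,4,6] v - wedge_list x [1,2,5,6] v
    - wedge_list x [1,2,4,7] v"
proof -
  let ?s = "\<lambda>i. sharp g (\<lambda>u. u $ i)"
  let ?is = "[1,2,3,4,5,6,7] :: 7 list"
  \<comment> \<open>The 3-form does not see the tail \<open>v\<close>; it is carried along so that
    both factors depend on the three vectors through the same \<open>trip\<close>.\<close>
  define A where "A a b c = \<alpha> (trip a b c v)" for a b c
  define W where "W a b c = wedge_list x ?is (trip a b c v)" for a b c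
  have upd: "trip a b c v = (trip 0 b c v)(0 := a)" "trip a b c v = (trip a 0 c v)(1 := b)"
    "trip a b c v = (trip a b 0 v)(2 := c)" for a b c
    by (auto simp: trip_def fun_eq_iff)
  have linA: "linear (\<lambda>a. A a b c)" "linear (\<lambda>b. A a b c)" "linear (\<lambda>c. A a b c)" for a b c
    unfolding A_def
    by (subst upd(1), rule alternating_linear[OF alternating], simp)
      (subst upd(2), rule alternating_linear[OF alternating], simp,
       subst upd(3), rule alternating_linear[OF alternating], simp)
  have linW: "linear (\<lambda>a. W a b c)" "linear (\<lambda>b. W a b c)" "linear (\<lambda>c. W a b c)" for a b c
    unfolding W_def
    by (subst upd(1), rule linear_wedge_list[OF linear_x], simp)
      (subst upd(2), rule linear_wedge_list[OF linear_x], simp,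
       subst upd(3), rule linear_wedge_list[OF linear_x], simp)
  have "\<alpha> (\<lambda>n. ?s (I n)) = A (?s (I 0)) (?s (I 1)) (?s (I 2))" for I
    unfolding A_def
    by (rule alternating_cong[OF alternating]) (auto simp: trip_def nat_less_3_iff)
  moreover have "vol_form g (\<lambda>n. if n < 3 then axis (I n) 1 else v (n - 3))
      = W (axis (I 0) 1) (axis (I 1) 1) (axis (I 2) 1)" for I
    unfolding W_def vol_form_eq
    by (rule arg_cong[where f = "wedge_list x ?is"]) (auto simp: trip_def fun_eq_iff
        nat_less_3_iff)
  ultimately have "hodge g 3 \<alpha> v * 6 = (\<Sum>i\<in>UNIV. \<Sum>j\<in>UNIV. \<Sum>k\<in>UNIV.
      A (?s i) (?s j) (?s k) * W (axis i 1) (axis j 1) (axis k 1))"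
    by (simp add: hodge_def fact_numeral
        sum_PiE_3[of "\<lambda>i j k. A (?s i) (?s j) (?s k) * W (axis i 1) (axis j 1) (axis k 1)"]
        del: One_nat_def)
  \<comment> \<open>One index at a time is moved to the innermost sum and converted there.\<close>
  also have "\<dots> = (\<Sum>i\<in>UNIV. \<Sum>j\<in>UNIV. \<Sum>c\<in>UNIV. A (?s i) (?s j) (e c) * W (axis i 1) (axis j 1) (e c))"
    by (intro sum.cong refl sum_sharp linA linW)
  also have "\<dots> = (\<Sum>i\<in>UNIV. \<Sum>c\<in>UNIV. \<Sum>j\<in>UNIV. A (?s i) (?s j) (e c) * W (axis i 1) (axis j 1) (e c))"
    by (intro sum.cong refl sum.swap)
  also have "\<dots> = (\<Sum>i\<in>UNIV. \<Sum>c\<in>UNIV. \<Sum>b\<in>UNIV. A (?s i) (e b) (e c) * W (axis i 1) (e b) (e c))"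
    by (intro sum.cong refl sum_sharp linA linW)
  also have "\<dots> = (\<Sum>i\<in>UNIV. \<Sum>b\<in>UNIV. \<Sum>c\<in>UNIV. A (?s i) (e b) (e c) * W (axis i 1) (e b) (e c))"
    by (intro sum.cong refl sum.swap)
  also have "\<dots> = (\<Sum>b\<in>UNIV. \<Sum>i\<in>UNIV. \<Sum>c\<in>UNIV. A (?s i) (e b) (e c) * W (axis i 1) (e b) (e c))"
    by (rule sum.swap)
  also have "\<dots> = (\<Sum>b\<in>UNIV. \<Sum>c\<in>UNIV. \<Sum>i\<in>UNIV. A (?s i) (e b) (e c) * W (axis i 1) (e b) (e c))"
    by (intro sum.cong refl sum.swap)
  also have "\<dots> = (\<Sum>b\<in>UNIV. \<Sum>c\<in>UNIV. \<Sum>a\<in>UNIV. A (e a) (e b) (e c) * W (e a) (e b) (e c))"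
    by (intro sum.cong refl sum_sharp linA linW)
  also have "\<dots> = (\<Sum>b\<in>UNIV. \<Sum>a\<in>UNIV. \<Sum>c\<in>UNIV. A (e a) (e b) (e c) * W (e a) (e b) (e c))"
    by (intro sum.cong refl sum.swap)
  also have "\<dots> = (\<Sum>a\<in>UNIV. \<Sum>b\<in>UNIV. \<Sum>c\<in>UNIV. A (e a) (e b) (e c) * W (e a) (e b) (e c))"
    by (rule sum.swap)
  finally have h: "hodge g 3 \<alpha> v * 6 =
      (\<Sum>a\<in>UNIV. \<Sum>b\<in>UNIV. \<Sum>c\<in>UNIV. A (e a) (e b) (e c) * W (e a) (e b) (e c))" .
  \<comment> \<open>Three successive contractions leave the complementary monomial, with a sign that
    simplification can evaluate for numerals.\<close>
  have W: "W (e i) (e j) (e k) =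
      (-1) ^ (length (takeWhile ((\<noteq>) i) ?is) + length (takeWhile ((\<noteq>) j) (remove1 i ?is))
        + length (takeWhile ((\<noteq>) k) (remove1 j (remove1 i ?is))))
      * wedge_list x (remove1 k (remove1 j (remove1 i ?is))) v"
    if ijk: "i \<noteq> j" "i \<noteq> k" "j \<noteq> k" for i j k
  proof -
    have d: "distinct ?is" by simp
    have s: "set ?is = UNIV" unfolding UNIV_7 by simp
    have 1: "i \<in> set ?is" "j \<in> set (remove1 i ?is)" "k \<in> set (remove1 j (remove1 i ?is))"
      using ijk unfolding set_remove1_eq[OF d] set_remove1_eq[OF distinct_remove1[OF d]] s by auto
    show ?thesis
      unfolding W_def
      by (simp add: wedge_list_frame[OF _ 1(1) d] wedge_list_frame[OF _ 1(2) distinct_remove1[OF d]]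
          wedge_list_frame[OF _ 1(3) distinct_remove1[OF distinct_remove1[OF d]]]
          trip_def power_add del: takeWhile.simps remove1.simps)
  qed
  show ?thesis
    using h unfolding A_def form_eq distrib_right left_diff_distrib sum.distrib sum_subtractf
        contract_vol
    by (simp add: W)
qed

section \<open>The two cross products and their coordinates in the frame\<close>

definition cr :: "real^7 \<Rightarrow> real^7 \<Rightarrow> real^7" where
  "cr a b = delta_form g \<alpha> (case_nat a (\<lambda>_. b))"

lemma linear_slot_0: "linear (\<lambda>u. \<alpha> (case_nat u w))"
proof -
  have "linear (\<lambda>u. \<alpha> ((case_nat 0 w)(0 := u)))"
    by (rule alternating_linear[OF alternating]) simp
  also have "(\<lambda>u. (case_nat 0 w)(0 := u)) = (\<lambda>u. case_nat u w)"
    by (auto simp: fun_eq_iff split: nat.split)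
  finally show ?thesis .
qed

lemma delta_form_eq_cr: "delta_form g \<alpha> w = cr (w 0) (w 1)"
  unfolding cr_def delta_form_def
  by (intro sum.cong refl arg_cong2[where f = scaleR] alternating_cong[OF alternating])
    (auto simp: nat_less_3_iff split: nat.split)

lemma g_cr: "g (cr a b) c = \<alpha> (case_nat c (case_nat a (\<lambda>_. b)))"
  unfolding cr_def by (rule g_delta_form[OF linear_slot_0])

lemma x_cr: "x i (cr a b) = \<alpha> (case_nat (e i) (case_nat a (\<lambda>_. b)))"
  using g_cr[of a b "e i"] by (simp add: g_frame[symmetric] sym[of "e i"])

lemma x_cr_coords:
  "x 1 (cr a b) = x 2 a * x 3 b - x 3 a * x 2 b + x 4 a * x 5 b - x 5 a * x 4 b + x 6 a * x 7 b
      - x 7 a * x 6 b"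
  "x 2 (cr a b) = x 3 a * x 1 b - x 1 a * x 3 b + x 4 a * x 6 b - x 6 a * x 4 b - x 5 a * x 7 b
      + x 7 a * x 5 b"
  "x 3 (cr a b) = x 1 a * x 2 b - x 2 a * x 1 b - x 4 a * x 7 b + x 7 a * x 4 b - x 5 a * x 6 b
      + x 6 a * x 5 b"
  "x 4 (cr a b) = x 5 a * x 1 b - x 1 a * x 5 b + x 6 a * x 2 b - x 2 a * x 6 b + x 3 a * x 7 b
      - x 7 a * x 3 b"
  "x 5 (cr a b) = x 1 a * x 4 b - x 4 a * x 1 b - x 7 a * x 2 b + x 2 a * x 7 b - x 6 a * x 3 b
      + x 3 a * x 6 b"
  "x 6 (cr a b) = x 7 a * x 1 b - x 1 a * x 7 b + x 2 a * x 4 b - x 4 a * x 2 b - x 3 a * x 5 b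
      + x 5 a * x 3 b"
  "x 7 (cr a b) = x 1 a * x 6 b - x 6 a * x 1 b - x 2 a * x 5 b + x 5 a * x 2 b - x 3 a * x 4 b
      + x 4 a * x 3 b"
  by (simp_all add: x_cr form_eq wedge_list_3 x_frame numeral_2_eq_2)

lemma g_coords: "g u v = x 1 u * x 1 v + x 2 u * x 2 v + x 3 u * x 3 v + x 4 u * x 4 v
   + x 5 u * x 5 v + x 6 u * x 6 v + x 7 u * x 7 v"
  by (simp only: g_eq sum_7)

lemma x_eq7I:
  assumes "x 1 u = x 1 v" "x 2 u = x 2 v" "x 3 u = x 3 v" "x 4 u = x 4 v" "x 5 u = x 5 v"
    "x 6 u = x 6 v" "x 7 u = x 7 v"
  shows "u = v"
proof -
  have "\<forall>i. x i u = x i v" unfolding forall_7 using assms by blast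
  then show ?thesis by (intro x_eqI) blast
qed

lemmas x_linear = linear_x[THEN linear_add] linear_x[THEN linear_diff] linear_x[THEN linear_cmul]
  linear_x[THEN linear_neg]

text \<open>This is what makes the three-fold cross product vanish when its first two arguments
  agree.\<close>

lemma cr_cr: "cr a (cr a b) = g a b *\<^sub>R a - g a a *\<^sub>R b"
  by (rule x_eq7I; simp only: x_linear x_cr_coords g_coords; simp add: algebra_simps)

lemma x_delta_hodge:
  "x i (delta_form g (hodge g 3 \<alpha>) w) = hodge g 3 \<alpha> (case_nat (e i) w)"
proof -
  have eq: "case_nat u w = (case_nat 0 w)(0 := u)" for u by (auto simp: fun_eq_iff split: nat.split)
  have "linear (\<lambda>u. hodge g 3 \<alpha> (case_nat u w))"
    unfolding hodge_eq
    by (intro linear_compose_add linear_compose_sub; subst eq, rule linear_wedge_list[OF linear_x];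
        simp)
  then show ?thesis by (rule x_delta_form)
qed

text \<open>Both sides are compared component by component in the frame. The formula replaces the
  Hodge star by the metric and \<open>cr\<close>, and so reduces the derivative of \<chi> to those
  of the metric and of \<open>cr\<close>.\<close>

lemma three_fold_cross_eq:
  "- delta_form g (hodge g 3 \<alpha>) w =
    g (w 0) (w 2) *\<^sub>R w 1 - g (w 0) (w 1) *\<^sub>R w 2 - cr (w 0) (cr (w 1) (w 2))"
  by (rule x_eq7I; simp only: x_linear x_cr_coords g_coords x_delta_hodge hodge_eq wedge_list_4;
      simp add: x_frame wedge_list_3 numeral_2_eq_2; simp add: algebra_simps)

end

section \<open>The torsion of a G2-form\<close>

context g2_point
begin

text \<open>The cross product is the imaginary part of octonion multiplication. Up to sign, the
  index of the product of two different frame vectors is the bitwise sum of their indices.\<close>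

lemma cr_frame:
  "cr (e 1) (e 1) = 0" "cr (e 1) (e 2) = e 3" "cr (e 1) (e 3) = - e 2" "cr (e 1) (e 4) = e 5"
    "cr (e 1) (e 5) = - e 4" "cr (e 1) (e 6) = e 7" "cr (e 1) (e 7) = - e 6"
  "cr (e 2) (e 1) = - e 3" "cr (e 2) (e 2) = 0" "cr (e 2) (e 3) = e 1" "cr (e 2) (e 4) = e 6"
    "cr (e 2) (e 5) = - e 7" "cr (e 2) (e 6) = - e 4" "cr (e 2) (e 7) = e 5"
  "cr (e 3) (e 1) = e 2" "cr (e 3) (e 2) = - e 1" "cr (e 3) (e 3) = 0" "cr (e 3) (e 4) = - e 7"
    "cr (e 3) (e 5) = - e 6" "cr (e 3) (e 6) = e 5" "cr (e 3) (e 7) = e 4"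
  "cr (e 4) (e 1) = - e 5" "cr (e 4) (e 2) = - e 6" "cr (e 4) (e 3) = e 7" "cr (e 4) (e 4) = 0"
    "cr (e 4) (e 5) = e 1" "cr (e 4) (e 6) = e 2" "cr (e 4) (e 7) = - e 3"
  "cr (e 5) (e 1) = e 4" "cr (e 5) (e 2) = e 7" "cr (e 5) (e 3) = e 6" "cr (e 5) (e 4) = - e 1"
    "cr (e 5) (e 5) = 0" "cr (e 5) (e 6) = - e 3" "cr (e 5) (e 7) = - e 2"
  "cr (e 6) (e 1) = - e 7" "cr (e 6) (e 2) = e 4" "cr (e 6) (e 3) = - e 5" "cr (e 6) (e 4) = - e 2"
    "cr (e 6) (e 5) = e 3" "cr (e 6) (e 6) = 0" "cr (e 6) (e 7) = e 1"
  "cr (e 7) (e 1) = e 6" "cr (e 7) (e 2) = - e 5" "cr (e 7) (e 3) = - e 4" "cr (e 7) (e 4) = e 3"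
    "cr (e 7) (e 5) = e 2" "cr (e 7) (e 6) = - e 1" "cr (e 7) (e 7) = 0"
  by (rule x_eq7I; simp add: x_cr_coords x_frame x_linear linear_0[OF linear_x])+

lemma alt2_cr: "alt2 cr"
proof -
  have "linear (\<lambda>a. cr a b)" "linear (cr a)" for a b
    by (rule linearI; rule x_eq7I; simp add: x_cr_coords x_linear algebra_simps)+
  moreover have "cr a a = 0" for a
    by (rule x_eq7I; simp add: x_cr_coords linear_0[OF linear_x])
  ultimately show ?thesis by (simp add: alt2_def)
qed

lemmas cr_linear =
  alt2_linear[OF alt2_cr, THEN linear_add] alt2_linear[OF alt2_cr, THEN linear_diff]
  alt2_linear[OF alt2_cr, THEN linear_cmul] alt2_linear[OF alt2_cr, THEN linear_neg]
  alt2_linear[OF alt2_cr, THEN linear_0]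

lemmas g_linear =
  linear_g[THEN linear_add] linear_g[THEN linear_diff] linear_g[THEN linear_cmul]
  linear_g[THEN linear_neg] linear_g[THEN linear_0]

lemma g_cr_alt3: "alt3 (\<lambda>a b c. g (cr a b) c)"
proof -
  have l: "linear (\<lambda>b. g (cr a b) c)" "linear (\<lambda>a. g (cr a b) c)" for a b c
    by (simp_all add: linear_iff cr_linear g_linear)
  have "g (cr a b) b = 0" for a b
    by (simp add: g_coords x_cr_coords algebra_simps)
  then show ?thesis
    by (simp add: alt3_def alt2_def l linear_g alt2_same[OF alt2_cr] g_linear)
qed

definition ch :: "real^7 \<Rightarrow> real^7 \<Rightarrow> real^7 \<Rightarrow> real^7" where
  "ch a b c = g a c *\<^sub>R b - g a b *\<^sub>R c - cr a (cr b c)"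

lemma g_frame_table:
  "g (e 1) (e 1) = 1" "g (e 1) (e 2) = 0" "g (e 1) (e 3) = 0" "g (e 1) (e 4) = 0" "g (e 1) (e 5)
      = 0" "g (e 1) (e 6) = 0" "g (e 1) (e 7) = 0"
  "g (e 2) (e 1) = 0" "g (e 2) (e 2) = 1" "g (e 2) (e 3) = 0" "g (e 2) (e 4) = 0" "g (e 2) (e 5)
      = 0" "g (e 2) (e 6) = 0" "g (e 2) (e 7) = 0"
  "g (e 3) (e 1) = 0" "g (e 3) (e 2) = 0" "g (e 3) (e 3) = 1" "g (e 3) (e 4) = 0" "g (e 3) (e 5)
      = 0" "g (e 3) (e 6) = 0" "g (e 3) (e 7) = 0"
  "g (e 4) (e 1) = 0" "g (e 4) (e 2) = 0" "g (e 4) (e 3) = 0" "g (e 4) (e 4) = 1" "g (e 4) (e 5)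
      = 0" "g (e 4) (e 6) = 0" "g (e 4) (e 7) = 0"
  "g (e 5) (e 1) = 0" "g (e 5) (e 2) = 0" "g (e 5) (e 3) = 0" "g (e 5) (e 4) = 0" "g (e 5) (e 5)
      = 1" "g (e 5) (e 6) = 0" "g (e 5) (e 7) = 0"
  "g (e 6) (e 1) = 0" "g (e 6) (e 2) = 0" "g (e 6) (e 3) = 0" "g (e 6) (e 4) = 0" "g (e 6) (e 5)
      = 0" "g (e 6) (e 6) = 1" "g (e 6) (e 7) = 0"
  "g (e 7) (e 1) = 0" "g (e 7) (e 2) = 0" "g (e 7) (e 3) = 0" "g (e 7) (e 4) = 0" "g (e 7) (e 5)
      = 0" "g (e 7) (e 6) = 0" "g (e 7) (e 7) = 1"
  by (simp_all add: orthonormal)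

text \<open>The last two arguments are listed in increasing order only. When \<open>fn23\<close> or
  \<open>fn33\<close> is applied to an increasing list of frame vectors, these slots always receive
  an increasing pair, whereas the first slot may receive any combination of frame vectors.\<close>

lemma ch_frame:
  "ch (e 1) (e 1) (e 2) = 0" "ch (e 1) (e 1) (e 3) = 0" "ch (e 1) (e 1) (e 4) = 0"
  "ch (e 1) (e 1) (e 5) = 0" "ch (e 1) (e 1) (e 6) = 0" "ch (e 1) (e 1) (e 7) = 0"
  "ch (e 1) (e 2) (e 3) = 0" "ch (e 1) (e 2) (e 4) = - e 7" "ch (e 1) (e 2) (e 5) = - e 6"
  "ch (e 1) (e 2) (e 6) = e 5" "ch (e 1) (e 2) (e 7) = e 4" "ch (e 1) (e 3) (e 4) = - e 6"
  "ch (e 1) (e 3) (e 5) = e 7" "ch (e 1) (e 3) (e 6) = e 4" "ch (e 1) (e 3) (e 7) = - e 5"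
  "ch (e 1) (e 4) (e 5) = 0" "ch (e 1) (e 4) (e 6) = - e 3" "ch (e 1) (e 4) (e 7) = - e 2"
  "ch (e 1) (e 5) (e 6) = - e 2" "ch (e 1) (e 5) (e 7) = e 3" "ch (e 1) (e 6) (e 7) = 0"
  "ch (e 2) (e 1) (e 2) = 0" "ch (e 2) (e 1) (e 3) = 0" "ch (e 2) (e 1) (e 4) = e 7"
  "ch (e 2) (e 1) (e 5) = e 6" "ch (e 2) (e 1) (e 6) = - e 5" "ch (e 2) (e 1) (e 7) = - e 4"
  "ch (e 2) (e 2) (e 3) = 0" "ch (e 2) (e 2) (e 4) = 0" "ch (e 2) (e 2) (e 5) = 0"
  "ch (e 2) (e 2) (e 6) = 0" "ch (e 2) (e 2) (e 7) = 0" "ch (e 2) (e 3) (e 4) = e 5"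
  "ch (e 2) (e 3) (e 5) = - e 4" "ch (e 2) (e 3) (e 6) = e 7" "ch (e 2) (e 3) (e 7) = - e 6"
  "ch (e 2) (e 4) (e 5) = e 3" "ch (e 2) (e 4) (e 6) = 0" "ch (e 2) (e 4) (e 7) = e 1"
  "ch (e 2) (e 5) (e 6) = e 1" "ch (e 2) (e 5) (e 7) = 0" "ch (e 2) (e 6) (e 7) = e 3"
  "ch (e 3) (e 1) (e 2) = 0" "ch (e 3) (e 1) (e 3) = 0" "ch (e 3) (e 1) (e 4) = e 6"
  "ch (e 3) (e 1) (e 5) = - e 7" "ch (e 3) (e 1) (e 6) = - e 4" "ch (e 3) (e 1) (e 7) = e 5"
  "ch (e 3) (e 2) (e 3) = 0" "ch (e 3) (e 2) (e 4) = - e 5" "ch (e 3) (e 2) (e 5) = e 4"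
  "ch (e 3) (e 2) (e 6) = - e 7" "ch (e 3) (e 2) (e 7) = e 6" "ch (e 3) (e 3) (e 4) = 0"
  "ch (e 3) (e 3) (e 5) = 0" "ch (e 3) (e 3) (e 6) = 0" "ch (e 3) (e 3) (e 7) = 0"
  "ch (e 3) (e 4) (e 5) = - e 2" "ch (e 3) (e 4) (e 6) = e 1" "ch (e 3) (e 4) (e 7) = 0"
  "ch (e 3) (e 5) (e 6) = 0" "ch (e 3) (e 5) (e 7) = - e 1" "ch (e 3) (e 6) (e 7) = - e 2"
  "ch (e 4) (e 1) (e 2) = - e 7" "ch (e 4) (e 1) (e 3) = - e 6" "ch (e 4) (e 1) (e 4) = 0"
  "ch (e 4) (e 1) (e 5) = 0" "ch (e 4) (e 1) (e 6) = e 3" "ch (e 4) (e 1) (e 7) = e 2"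
  "ch (e 4) (e 2) (e 3) = e 5" "ch (e 4) (e 2) (e 4) = 0" "ch (e 4) (e 2) (e 5) = - e 3"
  "ch (e 4) (e 2) (e 6) = 0" "ch (e 4) (e 2) (e 7) = - e 1" "ch (e 4) (e 3) (e 4) = 0"
  "ch (e 4) (e 3) (e 5) = e 2" "ch (e 4) (e 3) (e 6) = - e 1" "ch (e 4) (e 3) (e 7) = 0"
  "ch (e 4) (e 4) (e 5) = 0" "ch (e 4) (e 4) (e 6) = 0" "ch (e 4) (e 4) (e 7) = 0"
  "ch (e 4) (e 5) (e 6) = e 7" "ch (e 4) (e 5) (e 7) = - e 6" "ch (e 4) (e 6) (e 7) = e 5"
  "ch (e 5) (e 1) (e 2) = - e 6" "ch (e 5) (e 1) (e 3) = e 7" "ch (e 5) (e 1) (e 4) = 0"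
  "ch (e 5) (e 1) (e 5) = 0" "ch (e 5) (e 1) (e 6) = e 2" "ch (e 5) (e 1) (e 7) = - e 3"
  "ch (e 5) (e 2) (e 3) = - e 4" "ch (e 5) (e 2) (e 4) = e 3" "ch (e 5) (e 2) (e 5) = 0"
  "ch (e 5) (e 2) (e 6) = - e 1" "ch (e 5) (e 2) (e 7) = 0" "ch (e 5) (e 3) (e 4) = - e 2"
  "ch (e 5) (e 3) (e 5) = 0" "ch (e 5) (e 3) (e 6) = 0" "ch (e 5) (e 3) (e 7) = e 1"
  "ch (e 5) (e 4) (e 5) = 0" "ch (e 5) (e 4) (e 6) = - e 7" "ch (e 5) (e 4) (e 7) = e 6"
  "ch (e 5) (e 5) (e 6) = 0" "ch (e 5) (e 5) (e 7) = 0" "ch (e 5) (e 6) (e 7) = - e 4"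
  "ch (e 6) (e 1) (e 2) = e 5" "ch (e 6) (e 1) (e 3) = e 4" "ch (e 6) (e 1) (e 4) = - e 3"
  "ch (e 6) (e 1) (e 5) = - e 2" "ch (e 6) (e 1) (e 6) = 0" "ch (e 6) (e 1) (e 7) = 0"
  "ch (e 6) (e 2) (e 3) = e 7" "ch (e 6) (e 2) (e 4) = 0" "ch (e 6) (e 2) (e 5) = e 1"
  "ch (e 6) (e 2) (e 6) = 0" "ch (e 6) (e 2) (e 7) = - e 3" "ch (e 6) (e 3) (e 4) = e 1"
  "ch (e 6) (e 3) (e 5) = 0" "ch (e 6) (e 3) (e 6) = 0" "ch (e 6) (e 3) (e 7) = e 2"
  "ch (e 6) (e 4) (e 5) = e 7" "ch (e 6) (e 4) (e 6) = 0" "ch (e 6) (e 4) (e 7) = - e 5"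
  "ch (e 6) (e 5) (e 6) = 0" "ch (e 6) (e 5) (e 7) = e 4" "ch (e 6) (e 6) (e 7) = 0"
  "ch (e 7) (e 1) (e 2) = e 4" "ch (e 7) (e 1) (e 3) = - e 5" "ch (e 7) (e 1) (e 4) = - e 2"
  "ch (e 7) (e 1) (e 5) = e 3" "ch (e 7) (e 1) (e 6) = 0" "ch (e 7) (e 1) (e 7) = 0"
  "ch (e 7) (e 2) (e 3) = - e 6" "ch (e 7) (e 2) (e 4) = e 1" "ch (e 7) (e 2) (e 5) = 0"
  "ch (e 7) (e 2) (e 6) = e 3" "ch (e 7) (e 2) (e 7) = 0" "ch (e 7) (e 3) (e 4) = 0"
  "ch (e 7) (e 3) (e 5) = - e 1" "ch (e 7) (e 3) (e 6) = - e 2" "ch (e 7) (e 3) (e 7) = 0"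
  "ch (e 7) (e 4) (e 5) = - e 6" "ch (e 7) (e 4) (e 6) = e 5" "ch (e 7) (e 4) (e 7) = 0"
  "ch (e 7) (e 5) (e 6) = - e 4" "ch (e 7) (e 5) (e 7) = 0" "ch (e 7) (e 6) (e 7) = 0"
  by (simp_all add: ch_def g_frame_table cr_frame cr_linear)

lemma ch_linear:
  "ch (a + a') b c = ch a b c + ch a' b c" "ch (a - a') b c = ch a b c - ch a' b c"
  "ch (r *\<^sub>R a) b c = r *\<^sub>R ch a b c" "ch (- a) b c = - ch a b c" "ch 0 b c = 0"
  by (simp_all add: ch_def cr_linear g_linear algebra_simps)

lemma ch_same: "ch a a c = 0" "ch a b b = 0"
proof -
  show "ch a a c = 0" by (simp add: ch_def cr_cr)
  have "cr b b = 0" by (rule alt2_same[OF alt2_cr])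
  then show "ch a b b = 0" by (simp add: ch_def cr_linear)
qed

lemma alt3_ch: "alt3 ch"
proof -
  have "linear (\<lambda>a. ch a b c)" "linear (\<lambda>b. ch a b c)" "linear (ch a b)" for a b c
    by (simp_all add: ch_def linear_iff cr_linear g_linear algebra_simps)
  then show ?thesis by (simp add: alt3_def alt2_def ch_same)
qed

end

text \<open>
  Here \<open>Q u\<close> plays the role of \<open>\<nabla>\<^sub>u Cr\<close> at a point, and \<open>R u\<close> below that of \<open>\<nabla>\<^sub>u \<chi>\<close>.
\<close>
locale g2_torsion = g2_point +
  fixes Q :: "real^7 \<Rightarrow> real^7 \<Rightarrow> real^7 \<Rightarrow> real^7"
  assumes linear_Q: "linear (\<lambda>u. Q u a b)" and alt2_Q: "alt2 (Q u)"
    and g_Q: "g (Q u a b) b = 0"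
    and Q_cr: "Q u a (cr a b) = - cr a (Q u a b)"
begin

text \<open>The Leibniz rule applied to the formula for \<open>ch\<close>; its metric terms do not
  contribute because the metric is parallel.\<close>

definition R :: "real^7 \<Rightarrow> real^7 \<Rightarrow> real^7 \<Rightarrow> real^7 \<Rightarrow> real^7" where
  "R u a b c = - Q u a (cr b c) - cr a (Q u b c)"

lemmas Q_linear =
  alt2_linear[OF alt2_Q, THEN linear_add] alt2_linear[OF alt2_Q, THEN linear_diff]
  alt2_linear[OF alt2_Q, THEN linear_cmul] alt2_linear[OF alt2_Q, THEN linear_neg]
  alt2_linear[OF alt2_Q, THEN linear_0]
  linear_Q[THEN linear_add] linear_Q[THEN linear_diff] linear_Q[THEN linear_cmul]
  linear_Q[THEN linear_neg] linear_Q[THEN linear_0]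

section \<open>The components of the torsion in a frame\<close>

definition P :: "real^7 \<Rightarrow> real^7 \<Rightarrow> real^7 \<Rightarrow> real^7 \<Rightarrow> real" where
  "P u a b c = g (Q u a b) c"

lemma alt3_P: "alt3 (P u)"
proof -
  have "linear (\<lambda>b. P u a b c)" "linear (\<lambda>a. P u a b c)" "linear (P u a b)" for a b c
    unfolding P_def
    by (simp_all add: linear_iff Q_linear g_linear)
  then show ?thesis
    by (simp add: alt3_def alt2_def P_def g_Q alt2_same[OF alt2_Q] g_linear)
qed

text \<open>Since \<open>cr a\<close> is skew for the metric, the sign in \<open>Q_cr\<close>
  disappears and \<open>cr a\<close> moves from one slot of the 3-form to the next. On frame vectors
  this becomes a relation between at most two components.\<close>

lemma P_cr: "P u a (cr a b) c = P u a b (cr a c)"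
proof -
  have "g (cr a q) c = - g q (cr a c)" for q
    using alt3_swap(2)[OF g_cr_alt3, of a q c] sym[of q "cr a c"] by simp
  then show ?thesis by (simp add: P_def Q_cr g_linear)
qed

lemma P_sort:
  "P u (e 2) (e 1) c = - P u (e 1) (e 2) c" "P u c (e 2) (e 1) = - P u c (e 1) (e 2)"
  "P u (e 3) (e 1) c = - P u (e 1) (e 3) c" "P u c (e 3) (e 1) = - P u c (e 1) (e 3)"
  "P u (e 4) (e 1) c = - P u (e 1) (e 4) c" "P u c (e 4) (e 1) = - P u c (e 1) (e 4)"
  "P u (e 5) (e 1) c = - P u (e 1) (e 5) c" "P u c (e 5) (e 1) = - P u c (e 1) (e 5)"
  "P u (e 6) (e 1) c = - P u (e 1) (e 6) c" "P u c (e 6) (e 1) = - P u c (e 1) (e 6)"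
  "P u (e 7) (e 1) c = - P u (e 1) (e 7) c" "P u c (e 7) (e 1) = - P u c (e 1) (e 7)"
  "P u (e 3) (e 2) c = - P u (e 2) (e 3) c" "P u c (e 3) (e 2) = - P u c (e 2) (e 3)"
  "P u (e 4) (e 2) c = - P u (e 2) (e 4) c" "P u c (e 4) (e 2) = - P u c (e 2) (e 4)"
  "P u (e 5) (e 2) c = - P u (e 2) (e 5) c" "P u c (e 5) (e 2) = - P u c (e 2) (e 5)"
  "P u (e 6) (e 2) c = - P u (e 2) (e 6) c" "P u c (e 6) (e 2) = - P u c (e 2) (e 6)"
  "P u (e 7) (e 2) c = - P u (e 2) (e 7) c" "P u c (e 7) (e 2) = - P u c (e 2) (e 7)"
  "P u (e 4) (e 3) c = - P u (e 3) (e 4) c" "P u c (e 4) (e 3) = - P u c (e 3) (e 4)"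
  "P u (e 5) (e 3) c = - P u (e 3) (e 5) c" "P u c (e 5) (e 3) = - P u c (e 3) (e 5)"
  "P u (e 6) (e 3) c = - P u (e 3) (e 6) c" "P u c (e 6) (e 3) = - P u c (e 3) (e 6)"
  "P u (e 7) (e 3) c = - P u (e 3) (e 7) c" "P u c (e 7) (e 3) = - P u c (e 3) (e 7)"
  "P u (e 5) (e 4) c = - P u (e 4) (e 5) c" "P u c (e 5) (e 4) = - P u c (e 4) (e 5)"
  "P u (e 6) (e 4) c = - P u (e 4) (e 6) c" "P u c (e 6) (e 4) = - P u c (e 4) (e 6)"
  "P u (e 7) (e 4) c = - P u (e 4) (e 7) c" "P u c (e 7) (e 4) = - P u c (e 4) (e 7)"
  "P u (e 6) (e 5) c = - P u (e 5) (e 6) c" "P u c (e 6) (e 5) = - P u c (e 5) (e 6)"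
  "P u (e 7) (e 5) c = - P u (e 5) (e 7) c" "P u c (e 7) (e 5) = - P u c (e 5) (e 7)"
  "P u (e 7) (e 6) c = - P u (e 6) (e 7) c" "P u c (e 7) (e 6) = - P u c (e 6) (e 7)"
  using alt3_swap[OF alt3_P] by blast+

lemmas P_linear =
  alt3_linear[OF alt3_P, THEN linear_neg] alt3_linear[OF alt3_P, THEN linear_0]

text \<open>
  The component \<open>T u m\<close> of the vector \<open>T(u)\<close> with \<open>\<nabla>\<^sub>u \<phi> = \<iota>\<^bsub>T(u)\<^esub> \<star>\<phi>\<close> occurs, up to sign, as four
  components of \<open>\<nabla>\<^sub>u \<phi>\<close>; any of them can serve as its definition.
\<close>
definition T :: "real^7 \<Rightarrow> 7 \<Rightarrow> real" where
  "T u m = (if m = 1 then - P u (e 2) (e 4) (e 7) else if m = 2 then P u (e 1) (e 4) (e 7) else 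
     if m = 3 then P u (e 1) (e 4) (e 6) else if m = 4 then - P u (e 1) (e 2) (e 7) else 
     if m = 5 then - P u (e 1) (e 2) (e 6) else if m = 6 then P u (e 1) (e 2) (e 5) else 
     P u (e 1) (e 2) (e 4))"

text \<open>The 35 components are linked by instances of \<open>P_cr\<close>. The seven belonging to
  the monomials of \<phi> vanish; the other 28 form seven groups of four that agree up to
  sign.\<close>

lemma P_frame:
  "P u (e 1) (e 2) (e 3) = 0"
  "P u (e 1) (e 2) (e 4) = T u 7"
  "P u (e 1) (e 2) (e 5) = T u 6"
  "P u (e 1) (e 2) (e 6) = - T u 5"
  "P u (e 1) (e 2) (e 7) = - T u 4"
  "P u (e 1) (e 3) (e 4) = T u 6"
  "P u (e 1) (e 3) (e 5) = - T u 7"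
  "P u (e 1) (e 3) (e 6) = - T u 4"
  "P u (e 1) (e 3) (e 7) = T u 5"
  "P u (e 1) (e 4) (e 5) = 0"
  "P u (e 1) (e 4) (e 6) = T u 3"
  "P u (e 1) (e 4) (e 7) = T u 2"
  "P u (e 1) (e 5) (e 6) = T u 2"
  "P u (e 1) (e 5) (e 7) = - T u 3"
  "P u (e 1) (e 6) (e 7) = 0"
  "P u (e 2) (e 3) (e 4) = - T u 5"
  "P u (e 2) (e 3) (e 5) = T u 4"
  "P u (e 2) (e 3) (e 6) = - T u 7"
  "P u (e 2) (e 3) (e 7) = T u 6"
  "P u (e 2) (e 4) (e 5) = - T u 3"
  "P u (e 2) (e 4) (e 6) = 0"
  "P u (e 2) (e 4) (e 7) = - T u 1"
  "P u (e 2) (e 5) (e 6) = - T u 1"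
  "P u (e 2) (e 5) (e 7) = 0"
  "P u (e 2) (e 6) (e 7) = - T u 3"
  "P u (e 3) (e 4) (e 5) = T u 2"
  "P u (e 3) (e 4) (e 6) = - T u 1"
  "P u (e 3) (e 4) (e 7) = 0"
  "P u (e 3) (e 5) (e 6) = 0"
  "P u (e 3) (e 5) (e 7) = T u 1"
  "P u (e 3) (e 6) (e 7) = T u 2"
  "P u (e 4) (e 5) (e 6) = - T u 7"
  "P u (e 4) (e 5) (e 7) = T u 6"
  "P u (e 4) (e 6) (e 7) = - T u 5"
  "P u (e 5) (e 6) (e 7) = T u 4"
proof -
  \<comment> \<open>Here and for the other vanishing components, \<open>P_cr\<close> with equal
    \<open>b\<close> and \<open>c\<close> says that the component is its own negative.\<close>
  show "P u (e 1) (e 2) (e 3) = 0"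
    using P_cr[of u "e 1" "e 2" "e 2"] by (simp add: cr_frame P_sort P_linear)
  show "P u (e 1) (e 2) (e 4) = T u 7"
    by (simp add: T_def)
  show "P u (e 1) (e 2) (e 5) = T u 6"
    by (simp add: T_def)
  show "P u (e 1) (e 2) (e 6) = - T u 5"
    by (simp add: T_def)
  show "P u (e 1) (e 2) (e 7) = - T u 4"
    by (simp add: T_def)
  show "P u (e 1) (e 3) (e 4) = T u 6"
    using P_cr[of u "e 1" "e 2" "e 4"] by (simp add: T_def cr_frame P_sort P_linear)
  show "P u (e 1) (e 3) (e 5) = - T u 7"
    using P_cr[of u "e 1" "e 2" "e 5"] by (simp add: T_def cr_frame P_sort P_linear)
  show "P u (e 1) (e 3) (e 6) = - T u 4"
    using P_cr[of u "e 1" "e 2" "e 6"] by (simp add: T_def cr_frame P_sort P_linear)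
  show "P u (e 1) (e 3) (e 7) = T u 5"
    using P_cr[of u "e 1" "e 2" "e 7"] by (simp add: T_def cr_frame P_sort P_linear)
  show "P u (e 1) (e 4) (e 5) = 0"
    using P_cr[of u "e 1" "e 4" "e 4"] by (simp add: cr_frame P_sort P_linear)
  show "P u (e 1) (e 4) (e 6) = T u 3"
    by (simp add: T_def)
  show "P u (e 1) (e 4) (e 7) = T u 2"
    by (simp add: T_def)
  show "P u (e 1) (e 5) (e 6) = T u 2"
    using P_cr[of u "e 1" "e 4" "e 6"] by (simp add: T_def cr_frame P_sort P_linear)
  show "P u (e 1) (e 5) (e 7) = - T u 3"
    using P_cr[of u "e 1" "e 4" "e 7"] by (simp add: T_def cr_frame P_sort P_linear)
  show "P u (e 1) (e 6) (e 7) = 0"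
    using P_cr[of u "e 1" "e 6" "e 6"] by (simp add: cr_frame P_sort P_linear)
  show "P u (e 2) (e 3) (e 4) = - T u 5"
    using P_cr[of u "e 2" "e 1" "e 4"] by (simp add: T_def cr_frame P_sort P_linear)
  show "P u (e 2) (e 3) (e 5) = T u 4"
    using P_cr[of u "e 2" "e 1" "e 5"] by (simp add: T_def cr_frame P_sort P_linear)
  show "P u (e 2) (e 3) (e 6) = - T u 7"
    using P_cr[of u "e 2" "e 1" "e 6"] by (simp add: T_def cr_frame P_sort P_linear)
  show "P u (e 2) (e 3) (e 7) = T u 6"
    using P_cr[of u "e 2" "e 1" "e 7"] by (simp add: T_def cr_frame P_sort P_linear)
  show "P u (e 2) (e 4) (e 5) = - T u 3"
    using P_cr[of u "e 4" "e 1" "e 2"] by (simp add: T_def cr_frame P_sort P_linear)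
  show "P u (e 2) (e 4) (e 6) = 0"
    using P_cr[of u "e 2" "e 4" "e 4"] by (simp add: cr_frame P_sort P_linear)
  show "P u (e 2) (e 4) (e 7) = - T u 1"
    by (simp add: T_def)
  show "P u (e 2) (e 5) (e 6) = - T u 1"
    using P_cr[of u "e 2" "e 4" "e 5"] by (simp add: T_def cr_frame P_sort P_linear)
  show "P u (e 2) (e 5) (e 7) = 0"
    using P_cr[of u "e 2" "e 5" "e 5"] by (simp add: cr_frame P_sort P_linear)
  show "P u (e 2) (e 6) (e 7) = - T u 3"
    using P_cr[of u "e 6" "e 1" "e 2"] by (simp add: T_def cr_frame P_sort P_linear)
  show "P u (e 3) (e 4) (e 5) = T u 2"
    using P_cr[of u "e 4" "e 1" "e 3"] by (simp add: T_def cr_frame P_sort P_linear)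
  show "P u (e 3) (e 4) (e 6) = - T u 1"
    using P_cr[of u "e 4" "e 2" "e 3"] by (simp add: T_def cr_frame P_sort P_linear)
  show "P u (e 3) (e 4) (e 7) = 0"
    using P_cr[of u "e 3" "e 4" "e 4"] by (simp add: cr_frame P_sort P_linear)
  show "P u (e 3) (e 5) (e 6) = 0"
    using P_cr[of u "e 3" "e 5" "e 5"] by (simp add: cr_frame P_sort P_linear)
  show "P u (e 3) (e 5) (e 7) = T u 1"
    using P_cr[of u "e 7" "e 2" "e 3"] by (simp add: T_def cr_frame P_sort P_linear)
  show "P u (e 3) (e 6) (e 7) = T u 2"
    using P_cr[of u "e 7" "e 1" "e 3"] by (simp add: T_def cr_frame P_sort P_linear)
  show "P u (e 4) (e 5) (e 6) = - T u 7"
    using P_cr[of u "e 4" "e 1" "e 6"] by (simp add: T_def cr_frame P_sort P_linear)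
  show "P u (e 4) (e 5) (e 7) = T u 6"
    using P_cr[of u "e 5" "e 1" "e 7"] by (simp add: T_def cr_frame P_sort P_linear)
  show "P u (e 4) (e 6) (e 7) = - T u 5"
    using P_cr[of u "e 6" "e 1" "e 4"] by (simp add: T_def cr_frame P_sort P_linear)
  show "P u (e 5) (e 6) (e 7) = T u 4"
    using P_cr[of u "e 7" "e 1" "e 5"] by (simp add: T_def cr_frame P_sort P_linear)
qed

lemma x_Q: "x k (Q u a b) = P u a b (e k)"
  by (simp add: P_def sym[of _ "e k"] g_frame)

lemma Q_frame:
  "Q u (e 1) (e 2) = T u 7 *\<^sub>R e 4 + T u 6 *\<^sub>R e 5 - T u 5 *\<^sub>R e 6 - T u 4 *\<^sub>R e 7"
  "Q u (e 1) (e 3) = T u 6 *\<^sub>R e 4 - T u 7 *\<^sub>R e 5 - T u 4 *\<^sub>R e 6 + T u 5 *\<^sub>R e 7"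
  "Q u (e 1) (e 4) = - (T u 7 *\<^sub>R e 2) - T u 6 *\<^sub>R e 3 + T u 3 *\<^sub>R e 6 + T u 2 *\<^sub>R e 7"
  "Q u (e 1) (e 5) = - (T u 6 *\<^sub>R e 2) + T u 7 *\<^sub>R e 3 + T u 2 *\<^sub>R e 6 - T u 3 *\<^sub>R e 7"
  "Q u (e 1) (e 6) = T u 5 *\<^sub>R e 2 + T u 4 *\<^sub>R e 3 - T u 3 *\<^sub>R e 4 - T u 2 *\<^sub>R e 5"
  "Q u (e 1) (e 7) = T u 4 *\<^sub>R e 2 - T u 5 *\<^sub>R e 3 - T u 2 *\<^sub>R e 4 + T u 3 *\<^sub>R e 5"
  "Q u (e 2) (e 3) = - (T u 5 *\<^sub>R e 4) + T u 4 *\<^sub>R e 5 - T u 7 *\<^sub>R e 6 + T u 6 *\<^sub>R e 7"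
  "Q u (e 2) (e 4) = T u 7 *\<^sub>R e 1 + T u 5 *\<^sub>R e 3 - T u 3 *\<^sub>R e 5 - T u 1 *\<^sub>R e 7"
  "Q u (e 2) (e 5) = T u 6 *\<^sub>R e 1 - T u 4 *\<^sub>R e 3 + T u 3 *\<^sub>R e 4 - T u 1 *\<^sub>R e 6"
  "Q u (e 2) (e 6) = - (T u 5 *\<^sub>R e 1) + T u 7 *\<^sub>R e 3 + T u 1 *\<^sub>R e 5 - T u 3 *\<^sub>R e 7"
  "Q u (e 2) (e 7) = - (T u 4 *\<^sub>R e 1) - T u 6 *\<^sub>R e 3 + T u 1 *\<^sub>R e 4 + T u 3 *\<^sub>R e 6"
  "Q u (e 3) (e 4) = T u 6 *\<^sub>R e 1 - T u 5 *\<^sub>R e 2 + T u 2 *\<^sub>R e 5 - T u 1 *\<^sub>R e 6"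
  "Q u (e 3) (e 5) = - (T u 7 *\<^sub>R e 1) + T u 4 *\<^sub>R e 2 - T u 2 *\<^sub>R e 4 + T u 1 *\<^sub>R e 7"
  "Q u (e 3) (e 6) = - (T u 4 *\<^sub>R e 1) - T u 7 *\<^sub>R e 2 + T u 1 *\<^sub>R e 4 + T u 2 *\<^sub>R e 7"
  "Q u (e 3) (e 7) = T u 5 *\<^sub>R e 1 + T u 6 *\<^sub>R e 2 - T u 1 *\<^sub>R e 5 - T u 2 *\<^sub>R e 6"
  "Q u (e 4) (e 5) = - (T u 3 *\<^sub>R e 2) + T u 2 *\<^sub>R e 3 - T u 7 *\<^sub>R e 6 + T u 6 *\<^sub>R e 7"
  "Q u (e 4) (e 6) = T u 3 *\<^sub>R e 1 - T u 1 *\<^sub>R e 3 + T u 7 *\<^sub>R e 5 - T u 5 *\<^sub>R e 7"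
  "Q u (e 4) (e 7) = T u 2 *\<^sub>R e 1 - T u 1 *\<^sub>R e 2 - T u 6 *\<^sub>R e 5 + T u 5 *\<^sub>R e 6"
  "Q u (e 5) (e 6) = T u 2 *\<^sub>R e 1 - T u 1 *\<^sub>R e 2 - T u 7 *\<^sub>R e 4 + T u 4 *\<^sub>R e 7"
  "Q u (e 5) (e 7) = - (T u 3 *\<^sub>R e 1) + T u 1 *\<^sub>R e 3 + T u 6 *\<^sub>R e 4 - T u 4 *\<^sub>R e 6"
  "Q u (e 6) (e 7) = - (T u 3 *\<^sub>R e 2) + T u 2 *\<^sub>R e 3 - T u 5 *\<^sub>R e 4 + T u 4 *\<^sub>R e 5"
  by (rule x_eq7I; simp add: x_Q x_linear x_frame P_frame P_sort alt3_same[OF alt3_P])+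

lemma Q_sort:
  "Q u (e 2) (e 1) = - Q u (e 1) (e 2)"
  "Q u (e 3) (e 1) = - Q u (e 1) (e 3)"
  "Q u (e 4) (e 1) = - Q u (e 1) (e 4)"
  "Q u (e 5) (e 1) = - Q u (e 1) (e 5)"
  "Q u (e 6) (e 1) = - Q u (e 1) (e 6)"
  "Q u (e 7) (e 1) = - Q u (e 1) (e 7)"
  "Q u (e 3) (e 2) = - Q u (e 2) (e 3)"
  "Q u (e 4) (e 2) = - Q u (e 2) (e 4)"
  "Q u (e 5) (e 2) = - Q u (e 2) (e 5)"
  "Q u (e 6) (e 2) = - Q u (e 2) (e 6)"
  "Q u (e 7) (e 2) = - Q u (e 2) (e 7)"
  "Q u (e 4) (e 3) = - Q u (e 3) (e 4)"
  "Q u (e 5) (e 3) = - Q u (e 3) (e 5)"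
  "Q u (e 6) (e 3) = - Q u (e 3) (e 6)"
  "Q u (e 7) (e 3) = - Q u (e 3) (e 7)"
  "Q u (e 5) (e 4) = - Q u (e 4) (e 5)"
  "Q u (e 6) (e 4) = - Q u (e 4) (e 6)"
  "Q u (e 7) (e 4) = - Q u (e 4) (e 7)"
  "Q u (e 6) (e 5) = - Q u (e 5) (e 6)"
  "Q u (e 7) (e 5) = - Q u (e 5) (e 7)"
  "Q u (e 7) (e 6) = - Q u (e 6) (e 7)"
  by (rule alt2_swap[OF alt2_Q])+

text \<open>In invariant terms, \<open>g (R u a b c) d\<close> is minus the value on
  \<open>a, b, c, d\<close> of the wedge product of the covector dual to \<open>T(u)\<close> with
  \<phi>.\<close>

lemma R_frame:
  "R u (e 1) (e 2) (e 3) = T u 4 *\<^sub>R e 4 + T u 5 *\<^sub>R e 5 + T u 6 *\<^sub>R e 6 + T u 7 *\<^sub>R e 7"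
  "R u (e 1) (e 2) (e 4) = - (T u 4 *\<^sub>R e 3) + T u 2 *\<^sub>R e 5 - T u 1 *\<^sub>R e 6"
  "R u (e 1) (e 2) (e 5) = - (T u 5 *\<^sub>R e 3) - T u 2 *\<^sub>R e 4 + T u 1 *\<^sub>R e 7"
  "R u (e 1) (e 2) (e 6) = - (T u 6 *\<^sub>R e 3) + T u 1 *\<^sub>R e 4 + T u 2 *\<^sub>R e 7"
  "R u (e 1) (e 2) (e 7) = - (T u 7 *\<^sub>R e 3) - T u 1 *\<^sub>R e 5 - T u 2 *\<^sub>R e 6"
  "R u (e 1) (e 3) (e 4) = T u 4 *\<^sub>R e 2 + T u 3 *\<^sub>R e 5 + T u 1 *\<^sub>R e 7"
  "R u (e 1) (e 3) (e 5) = T u 5 *\<^sub>R e 2 - T u 3 *\<^sub>R e 4 + T u 1 *\<^sub>R e 6"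
  "R u (e 1) (e 3) (e 6) = T u 6 *\<^sub>R e 2 - T u 1 *\<^sub>R e 5 + T u 3 *\<^sub>R e 7"
  "R u (e 1) (e 3) (e 7) = T u 7 *\<^sub>R e 2 - T u 1 *\<^sub>R e 4 - T u 3 *\<^sub>R e 6"
  "R u (e 1) (e 4) (e 5) = T u 2 *\<^sub>R e 2 + T u 3 *\<^sub>R e 3 + T u 6 *\<^sub>R e 6 + T u 7 *\<^sub>R e 7"
  "R u (e 1) (e 4) (e 6) = - (T u 1 *\<^sub>R e 2) - T u 6 *\<^sub>R e 5 + T u 4 *\<^sub>R e 7"
  "R u (e 1) (e 4) (e 7) = T u 1 *\<^sub>R e 3 - T u 7 *\<^sub>R e 5 - T u 4 *\<^sub>R e 6"
  "R u (e 1) (e 5) (e 6) = T u 1 *\<^sub>R e 3 + T u 6 *\<^sub>R e 4 + T u 5 *\<^sub>R e 7"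
  "R u (e 1) (e 5) (e 7) = T u 1 *\<^sub>R e 2 + T u 7 *\<^sub>R e 4 - T u 5 *\<^sub>R e 6"
  "R u (e 1) (e 6) (e 7) = T u 2 *\<^sub>R e 2 + T u 3 *\<^sub>R e 3 + T u 4 *\<^sub>R e 4 + T u 5 *\<^sub>R e 5"
  "R u (e 2) (e 3) (e 4) = - (T u 4 *\<^sub>R e 1) + T u 3 *\<^sub>R e 6 + T u 2 *\<^sub>R e 7"
  "R u (e 2) (e 3) (e 5) = - (T u 5 *\<^sub>R e 1) + T u 2 *\<^sub>R e 6 - T u 3 *\<^sub>R e 7"
  "R u (e 2) (e 3) (e 6) = - (T u 6 *\<^sub>R e 1) - T u 3 *\<^sub>R e 4 - T u 2 *\<^sub>R e 5"
  "R u (e 2) (e 3) (e 7) = - (T u 7 *\<^sub>R e 1) - T u 2 *\<^sub>R e 4 + T u 3 *\<^sub>R e 5"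
  "R u (e 2) (e 4) (e 5) = - (T u 2 *\<^sub>R e 1) - T u 5 *\<^sub>R e 6 - T u 4 *\<^sub>R e 7"
  "R u (e 2) (e 4) (e 6) = T u 1 *\<^sub>R e 1 + T u 3 *\<^sub>R e 3 + T u 5 *\<^sub>R e 5 + T u 7 *\<^sub>R e 7"
  "R u (e 2) (e 4) (e 7) = T u 2 *\<^sub>R e 3 + T u 4 *\<^sub>R e 5 - T u 7 *\<^sub>R e 6"
  "R u (e 2) (e 5) (e 6) = T u 2 *\<^sub>R e 3 - T u 5 *\<^sub>R e 4 + T u 6 *\<^sub>R e 7"
  "R u (e 2) (e 5) (e 7) = - (T u 1 *\<^sub>R e 1) - T u 3 *\<^sub>R e 3 - T u 4 *\<^sub>R e 4 - T u 6 *\<^sub>R e 6"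
  "R u (e 2) (e 6) (e 7) = - (T u 2 *\<^sub>R e 1) + T u 7 *\<^sub>R e 4 + T u 6 *\<^sub>R e 5"
  "R u (e 3) (e 4) (e 5) = - (T u 3 *\<^sub>R e 1) - T u 4 *\<^sub>R e 6 + T u 5 *\<^sub>R e 7"
  "R u (e 3) (e 4) (e 6) = - (T u 3 *\<^sub>R e 2) + T u 4 *\<^sub>R e 5 + T u 6 *\<^sub>R e 7"
  "R u (e 3) (e 4) (e 7) = - (T u 1 *\<^sub>R e 1) - T u 2 *\<^sub>R e 2 - T u 5 *\<^sub>R e 5 - T u 6 *\<^sub>R e 6"
  "R u (e 3) (e 5) (e 6) = - (T u 1 *\<^sub>R e 1) - T u 2 *\<^sub>R e 2 - T u 4 *\<^sub>R e 4 - T u 7 *\<^sub>R e 7"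
  "R u (e 3) (e 5) (e 7) = T u 3 *\<^sub>R e 2 + T u 5 *\<^sub>R e 4 + T u 7 *\<^sub>R e 6"
  "R u (e 3) (e 6) (e 7) = - (T u 3 *\<^sub>R e 1) + T u 6 *\<^sub>R e 4 - T u 7 *\<^sub>R e 5"
  "R u (e 4) (e 5) (e 6) = - (T u 6 *\<^sub>R e 1) + T u 5 *\<^sub>R e 2 + T u 4 *\<^sub>R e 3"
  "R u (e 4) (e 5) (e 7) = - (T u 7 *\<^sub>R e 1) + T u 4 *\<^sub>R e 2 - T u 5 *\<^sub>R e 3"
  "R u (e 4) (e 6) (e 7) = - (T u 4 *\<^sub>R e 1) - T u 7 *\<^sub>R e 2 - T u 6 *\<^sub>R e 3"
  "R u (e 5) (e 6) (e 7) = - (T u 5 *\<^sub>R e 1) - T u 6 *\<^sub>R e 2 + T u 7 *\<^sub>R e 3"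
  by (simp_all add: R_def cr_frame cr_linear Q_sort Q_linear alt2_same[OF alt2_Q] Q_frame)

lemma R_linear: "R (- u) a b c = - R u a b c" "R 0 a b c = 0"
  by (simp_all add: R_def Q_linear cr_linear)

lemma linear_T: "linear (\<lambda>u. T u m)"
  by (auto simp: linear_iff T_def P_def Q_linear g_linear)

lemmas T_linear = linear_T[THEN linear_neg] linear_T[THEN linear_0]

lemma frame_coeffs:
  assumes "c1 *\<^sub>R e 1 + c2 *\<^sub>R e 2 + c3 *\<^sub>R e 3 + c4 *\<^sub>R e 4 + c5 *\<^sub>R e 5
    + c6 *\<^sub>R e 6 + c7 *\<^sub>R e 7 = 0" (is "?v = 0")
  shows "c1 = 0" "c2 = 0" "c3 = 0" "c4 = 0" "c5 = 0" "c6 = 0" "c7 = 0"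
proof -
  have "x i ?v = 0" for i
    unfolding assms by (rule linear_0[OF linear_x])
  from this[of 1] this[of 2] this[of 3] this[of 4] this[of 5] this[of 6] this[of 7]
  show "c1 = 0" "c2 = 0" "c3 = 0" "c4 = 0" "c5 = 0" "c6 = 0" "c7 = 0"
    by (simp_all add: x_linear x_frame)
qed

lemma Q_eq_0:
  assumes "\<And>i m. T (e i) m = 0"
  shows "Q u a b = 0"
proof -
  have T: "T u m = 0" for m
  proof -
    have "T u m = T (\<Sum>j\<in>UNIV. x j u *\<^sub>R e j) m"
      using frame_expansion[of u] by simp
    then show ?thesis
      by (simp add: linear_sum[OF linear_T] linear_cmul[OF linear_T] assms)
  qed
  have "\<forall>i j. Q u (e i) (e j) = 0"
    unfolding forall_7 by (simp add: Q_sort Q_frame T alt2_same[OF alt2_Q])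
  then have "Q u (e i) (\<Sum>j\<in>UNIV. x j b *\<^sub>R e j) = 0" for i
    unfolding linear_sum[OF alt2_linear(2)[OF alt2_Q]] by (simp add: Q_linear)
  then have "Q u (e i) b = 0" for i
    using frame_expansion[of b] by simp
  then have "Q u (\<Sum>j\<in>UNIV. x j a *\<^sub>R e j) b = 0"
    unfolding linear_sum[OF alt2_linear(1)[OF alt2_Q]] by (simp add: Q_linear)
  then show ?thesis
    using frame_expansion[of a] by simp
qed

text \<open>These rules evaluate a bracket on an increasing list of frame vectors down to a
  combination of frame vectors whose coefficients are built from the
  \<open>T (e i) m\<close>.\<close>

lemmas bracket_simps = T_linear scaleR_minus_left scaleR_zero_left cr_frame cr_linear Q_frame
    Q_linear ch_frame ch_linear R_frame R_linear skew3_def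
  skew4_def minus_minus minus_zero diff_zero diff_0 diff_minus_eq_add add_0_left add_0_right
  minus_diff_eq minus_add_distrib scaleR_minus_right scaleR_zero_right

end

section \<open>Evaluation of the brackets on a frame\<close>

context g2_torsion
begin

text \<open>Twelve of the \<open>21\<close> sets of five frame vectors already determine \<open>T\<close>.\<close>

lemma fn23_12345:
  "fn23 cr Q ch R (e 1) (e 2) (e 3) (e 4) (e 5) =
      (- 4 * T (e 1) 1 - 4 * T (e 2) 2 - 4 * T (e 3) 3 - 4 * T (e 4) 4 - 4 * T (e 5) 5
          + 2 * T (e 6) 6 + 2 * T (e 7) 7) *\<^sub>R e 1
      + (4 * T (e 1) 2 - 4 * T (e 2) 1 - 4 * T (e 4) 7 - 4 * T (e 5) 6 - 2 * T (e 6) 5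
          - 2 * T (e 7) 4) *\<^sub>R e 2
      + (4 * T (e 1) 3 - 4 * T (e 3) 1 - 4 * T (e 4) 6 + 4 * T (e 5) 7 - 2 * T (e 6) 4
          + 2 * T (e 7) 5) *\<^sub>R e 3
      + (4 * T (e 1) 4 + 4 * T (e 2) 7 + 4 * T (e 3) 6 - 4 * T (e 4) 1 + 2 * T (e 6) 3
          + 2 * T (e 7) 2) *\<^sub>R e 4
      + (4 * T (e 1) 5 + 4 * T (e 2) 6 - 4 * T (e 3) 7 - 4 * T (e 5) 1 + 2 * T (e 6) 2
          - 2 * T (e 7) 3) *\<^sub>R e 5
      + (- 2 * T (e 1) 6 + 2 * T (e 2) 5 + 2 * T (e 3) 4 - 2 * T (e 4) 3 - 2 * T (e 5) 2
          - 4 * T (e 6) 1) *\<^sub>R e 6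
      + (- 2 * T (e 1) 7 + 2 * T (e 2) 4 - 2 * T (e 3) 5 - 2 * T (e 4) 2 + 2 * T (e 5) 3
          - 4 * T (e 7) 1) *\<^sub>R e 7"
  unfolding fn23_def by (simp only: bracket_simps) (rule x_eq7I; simp only: x_linear x_frame; simp)

lemma fn23_12346:
  "fn23 cr Q ch R (e 1) (e 2) (e 3) (e 4) (e 6) =
      (- 4 * T (e 1) 2 + 4 * T (e 2) 1 + 4 * T (e 4) 7 - 2 * T (e 5) 6 - 4 * T (e 6) 5
          + 2 * T (e 7) 4) *\<^sub>R e 1
      + (- 4 * T (e 1) 1 - 4 * T (e 2) 2 - 4 * T (e 3) 3 - 4 * T (e 4) 4 + 2 * T (e 5) 5
          - 4 * T (e 6) 6 + 2 * T (e 7) 7) *\<^sub>R e 2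
      + (4 * T (e 2) 3 - 4 * T (e 3) 2 + 4 * T (e 4) 5 + 2 * T (e 5) 4 + 4 * T (e 6) 7
          + 2 * T (e 7) 6) *\<^sub>R e 3
      + (- 4 * T (e 1) 7 + 4 * T (e 2) 4 - 4 * T (e 3) 5 - 4 * T (e 4) 2 - 2 * T (e 5) 3
          - 2 * T (e 7) 1) *\<^sub>R e 4
      + (2 * T (e 1) 6 - 2 * T (e 2) 5 - 2 * T (e 3) 4 + 2 * T (e 4) 3 - 4 * T (e 5) 2
          - 2 * T (e 6) 1) *\<^sub>R e 5
      + (4 * T (e 1) 5 + 4 * T (e 2) 6 - 4 * T (e 3) 7 + 2 * T (e 5) 1 - 4 * T (e 6) 2
          - 2 * T (e 7) 3) *\<^sub>R e 6
      + (- 2 * T (e 1) 4 - 2 * T (e 2) 7 - 2 * T (e 3) 6 + 2 * T (e 4) 1 + 2 * T (e 6) 3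
          - 4 * T (e 7) 2) *\<^sub>R e 7"
  unfolding fn23_def by (simp only: bracket_simps) (rule x_eq7I; simp only: x_linear x_frame; simp)

lemma fn23_12347:
  "fn23 cr Q ch R (e 1) (e 2) (e 3) (e 4) (e 7) =
      (4 * T (e 1) 3 - 4 * T (e 3) 1 - 4 * T (e 4) 6 - 2 * T (e 5) 7 - 2 * T (e 6) 4
          - 4 * T (e 7) 5) *\<^sub>R e 1
      + (4 * T (e 2) 3 - 4 * T (e 3) 2 + 4 * T (e 4) 5 + 2 * T (e 5) 4 - 2 * T (e 6) 7
          - 4 * T (e 7) 6) *\<^sub>R e 2
      + (4 * T (e 1) 1 + 4 * T (e 2) 2 + 4 * T (e 3) 3 + 4 * T (e 4) 4 - 2 * T (e 5) 5
          - 2 * T (e 6) 6 + 4 * T (e 7) 7) *\<^sub>R e 3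
      + (4 * T (e 1) 6 - 4 * T (e 2) 5 - 4 * T (e 3) 4 + 4 * T (e 4) 3 - 2 * T (e 5) 2
          + 2 * T (e 6) 1) *\<^sub>R e 4
      + (2 * T (e 1) 7 - 2 * T (e 2) 4 + 2 * T (e 3) 5 + 2 * T (e 4) 2 + 4 * T (e 5) 3
          - 2 * T (e 7) 1) *\<^sub>R e 5
      + (2 * T (e 1) 4 + 2 * T (e 2) 7 + 2 * T (e 3) 6 - 2 * T (e 4) 1 + 4 * T (e 6) 3
          - 2 * T (e 7) 2) *\<^sub>R e 6
      + (4 * T (e 1) 5 + 4 * T (e 2) 6 - 4 * T (e 3) 7 + 2 * T (e 5) 1 + 2 * T (e 6) 2
          + 4 * T (e 7) 3) *\<^sub>R e 7"
  unfolding fn23_def by (simp only: bracket_simps) (rule x_eq7I; simp only: x_linear x_frame; simp)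

lemma fn23_12356:
  "fn23 cr Q ch R (e 1) (e 2) (e 3) (e 5) (e 6) =
      (4 * T (e 1) 3 - 4 * T (e 3) 1 + 2 * T (e 4) 6 + 4 * T (e 5) 7 + 4 * T (e 6) 4
          + 2 * T (e 7) 5) *\<^sub>R e 1
      + (4 * T (e 2) 3 - 4 * T (e 3) 2 - 2 * T (e 4) 5 - 4 * T (e 5) 4 + 4 * T (e 6) 7
          + 2 * T (e 7) 6) *\<^sub>R e 2
      + (4 * T (e 1) 1 + 4 * T (e 2) 2 + 4 * T (e 3) 3 - 2 * T (e 4) 4 + 4 * T (e 5) 5
          + 4 * T (e 6) 6 - 2 * T (e 7) 7) *\<^sub>R e 3
      + (- 2 * T (e 1) 6 + 2 * T (e 2) 5 + 2 * T (e 3) 4 + 4 * T (e 4) 3 - 2 * T (e 5) 2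
          + 2 * T (e 6) 1) *\<^sub>R e 4
      + (- 4 * T (e 1) 7 + 4 * T (e 2) 4 - 4 * T (e 3) 5 + 2 * T (e 4) 2 + 4 * T (e 5) 3
          - 2 * T (e 7) 1) *\<^sub>R e 5
      + (- 4 * T (e 1) 4 - 4 * T (e 2) 7 - 4 * T (e 3) 6 - 2 * T (e 4) 1 + 4 * T (e 6) 3
          - 2 * T (e 7) 2) *\<^sub>R e 6
      + (- 2 * T (e 1) 5 - 2 * T (e 2) 6 + 2 * T (e 3) 7 + 2 * T (e 5) 1 + 2 * T (e 6) 2
          + 4 * T (e 7) 3) *\<^sub>R e 7"
  unfolding fn23_def by (simp only: bracket_simps) (rule x_eq7I; simp only: x_linear x_frame; simp)

lemma fn23_12357:
  "fn23 cr Q ch R (e 1) (e 2) (e 3) (e 5) (e 7) =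
      (4 * T (e 1) 2 - 4 * T (e 2) 1 + 2 * T (e 4) 7 - 4 * T (e 5) 6 - 2 * T (e 6) 5
          + 4 * T (e 7) 4) *\<^sub>R e 1
      + (4 * T (e 1) 1 + 4 * T (e 2) 2 + 4 * T (e 3) 3 - 2 * T (e 4) 4 + 4 * T (e 5) 5
          - 2 * T (e 6) 6 + 4 * T (e 7) 7) *\<^sub>R e 2
      + (- 4 * T (e 2) 3 + 4 * T (e 3) 2 + 2 * T (e 4) 5 + 4 * T (e 5) 4 + 2 * T (e 6) 7
          + 4 * T (e 7) 6) *\<^sub>R e 3
      + (- 2 * T (e 1) 7 + 2 * T (e 2) 4 - 2 * T (e 3) 5 + 4 * T (e 4) 2 + 2 * T (e 5) 3
          + 2 * T (e 7) 1) *\<^sub>R e 4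
      + (4 * T (e 1) 6 - 4 * T (e 2) 5 - 4 * T (e 3) 4 - 2 * T (e 4) 3 + 4 * T (e 5) 2
          + 2 * T (e 6) 1) *\<^sub>R e 5
      + (2 * T (e 1) 5 + 2 * T (e 2) 6 - 2 * T (e 3) 7 - 2 * T (e 5) 1 + 4 * T (e 6) 2
          + 2 * T (e 7) 3) *\<^sub>R e 6
      + (- 4 * T (e 1) 4 - 4 * T (e 2) 7 - 4 * T (e 3) 6 - 2 * T (e 4) 1 - 2 * T (e 6) 3
          + 4 * T (e 7) 2) *\<^sub>R e 7"
  unfolding fn23_def by (simp only: bracket_simps) (rule x_eq7I; simp only: x_linear x_frame; simp)

lemma fn23_12456:
  "fn23 cr Q ch R (e 1) (e 2) (e 4) (e 5) (e 6) =
      (4 * T (e 1) 4 + 4 * T (e 2) 7 - 2 * T (e 3) 6 - 4 * T (e 4) 1 - 4 * T (e 6) 3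
          + 2 * T (e 7) 2) *\<^sub>R e 1
      + (- 4 * T (e 1) 7 + 4 * T (e 2) 4 + 2 * T (e 3) 5 - 4 * T (e 4) 2 + 4 * T (e 5) 3
          - 2 * T (e 7) 1) *\<^sub>R e 2
      + (2 * T (e 1) 6 - 2 * T (e 2) 5 + 4 * T (e 3) 4 + 2 * T (e 4) 3 + 2 * T (e 5) 2
          - 2 * T (e 6) 1) *\<^sub>R e 3
      + (4 * T (e 1) 1 + 4 * T (e 2) 2 - 2 * T (e 3) 3 + 4 * T (e 4) 4 + 4 * T (e 5) 5
          + 4 * T (e 6) 6 - 2 * T (e 7) 7) *\<^sub>R e 4
      + (- 4 * T (e 2) 3 - 2 * T (e 3) 2 - 4 * T (e 4) 5 + 4 * T (e 5) 4 - 4 * T (e 6) 7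
          - 2 * T (e 7) 6) *\<^sub>R e 5
      + (4 * T (e 1) 3 + 2 * T (e 3) 1 - 4 * T (e 4) 6 + 4 * T (e 5) 7 + 4 * T (e 6) 4
          + 2 * T (e 7) 5) *\<^sub>R e 6
      + (- 2 * T (e 1) 2 + 2 * T (e 2) 1 + 2 * T (e 4) 7 + 2 * T (e 5) 6 - 2 * T (e 6) 5
          + 4 * T (e 7) 4) *\<^sub>R e 7"
  unfolding fn23_def by (simp only: bracket_simps) (rule x_eq7I; simp only: x_linear x_frame; simp)

lemma fn23_12457:
  "fn23 cr Q ch R (e 1) (e 2) (e 4) (e 5) (e 7) =
      (- 4 * T (e 1) 5 - 4 * T (e 2) 6 - 2 * T (e 3) 7 + 4 * T (e 5) 1 - 2 * T (e 6) 2
          - 4 * T (e 7) 3) *\<^sub>R e 1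
      + (4 * T (e 1) 6 - 4 * T (e 2) 5 + 2 * T (e 3) 4 + 4 * T (e 4) 3 + 4 * T (e 5) 2
          + 2 * T (e 6) 1) *\<^sub>R e 2
      + (2 * T (e 1) 7 - 2 * T (e 2) 4 - 4 * T (e 3) 5 + 2 * T (e 4) 2 - 2 * T (e 5) 3
          - 2 * T (e 7) 1) *\<^sub>R e 3
      + (- 4 * T (e 2) 3 - 2 * T (e 3) 2 - 4 * T (e 4) 5 + 4 * T (e 5) 4 + 2 * T (e 6) 7
          + 4 * T (e 7) 6) *\<^sub>R e 4
      + (- 4 * T (e 1) 1 - 4 * T (e 2) 2 + 2 * T (e 3) 3 - 4 * T (e 4) 4 - 4 * T (e 5) 5
          + 2 * T (e 6) 6 - 4 * T (e 7) 7) *\<^sub>R e 5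
      + (2 * T (e 1) 2 - 2 * T (e 2) 1 - 2 * T (e 4) 7 - 2 * T (e 5) 6 - 4 * T (e 6) 5
          + 2 * T (e 7) 4) *\<^sub>R e 6
      + (4 * T (e 1) 3 + 2 * T (e 3) 1 - 4 * T (e 4) 6 + 4 * T (e 5) 7 - 2 * T (e 6) 4
          - 4 * T (e 7) 5) *\<^sub>R e 7"
  unfolding fn23_def by (simp only: bracket_simps) (rule x_eq7I; simp only: x_linear x_frame; simp)

lemma fn23_12467:
  "fn23 cr Q ch R (e 1) (e 2) (e 4) (e 6) (e 7) =
      (- 4 * T (e 1) 6 + 4 * T (e 2) 5 - 2 * T (e 3) 4 - 4 * T (e 4) 3 + 2 * T (e 5) 2
          + 4 * T (e 6) 1) *\<^sub>R e 1
      + (- 4 * T (e 1) 5 - 4 * T (e 2) 6 - 2 * T (e 3) 7 - 2 * T (e 5) 1 + 4 * T (e 6) 2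
          - 4 * T (e 7) 3) *\<^sub>R e 2
      + (2 * T (e 1) 4 + 2 * T (e 2) 7 - 4 * T (e 3) 6 - 2 * T (e 4) 1 - 2 * T (e 6) 3
          - 2 * T (e 7) 2) *\<^sub>R e 3
      + (4 * T (e 1) 3 + 2 * T (e 3) 1 - 4 * T (e 4) 6 - 2 * T (e 5) 7 + 4 * T (e 6) 4
          - 4 * T (e 7) 5) *\<^sub>R e 4
      + (- 2 * T (e 1) 2 + 2 * T (e 2) 1 + 2 * T (e 4) 7 - 4 * T (e 5) 6 - 2 * T (e 6) 5
          - 2 * T (e 7) 4) *\<^sub>R e 5
      + (- 4 * T (e 1) 1 - 4 * T (e 2) 2 + 2 * T (e 3) 3 - 4 * T (e 4) 4 + 2 * T (e 5) 5
          - 4 * T (e 6) 6 - 4 * T (e 7) 7) *\<^sub>R e 6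
      + (4 * T (e 2) 3 + 2 * T (e 3) 2 + 4 * T (e 4) 5 + 2 * T (e 5) 4 + 4 * T (e 6) 7
          - 4 * T (e 7) 6) *\<^sub>R e 7"
  unfolding fn23_def by (simp only: bracket_simps) (rule x_eq7I; simp only: x_linear x_frame; simp)

lemma fn23_13456:
  "fn23 cr Q ch R (e 1) (e 3) (e 4) (e 5) (e 6) =
      (- 4 * T (e 1) 5 + 2 * T (e 2) 6 + 4 * T (e 3) 7 + 4 * T (e 5) 1 + 4 * T (e 6) 2
          + 2 * T (e 7) 3) *\<^sub>R e 1
      + (- 2 * T (e 1) 6 - 4 * T (e 2) 5 + 2 * T (e 3) 4 - 2 * T (e 4) 3 - 2 * T (e 5) 2
          + 2 * T (e 6) 1) *\<^sub>R e 2
      + (- 4 * T (e 1) 7 - 2 * T (e 2) 4 - 4 * T (e 3) 5 - 4 * T (e 4) 2 + 4 * T (e 5) 3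
          - 2 * T (e 7) 1) *\<^sub>R e 3
      + (2 * T (e 2) 3 + 4 * T (e 3) 2 - 4 * T (e 4) 5 + 4 * T (e 5) 4 - 4 * T (e 6) 7
          - 2 * T (e 7) 6) *\<^sub>R e 4
      + (- 4 * T (e 1) 1 + 2 * T (e 2) 2 - 4 * T (e 3) 3 - 4 * T (e 4) 4 - 4 * T (e 5) 5
          - 4 * T (e 6) 6 + 2 * T (e 7) 7) *\<^sub>R e 5
      + (- 4 * T (e 1) 2 - 2 * T (e 2) 1 + 4 * T (e 4) 7 + 4 * T (e 5) 6 - 4 * T (e 6) 5
          + 2 * T (e 7) 4) *\<^sub>R e 6
      + (- 2 * T (e 1) 3 + 2 * T (e 3) 1 + 2 * T (e 4) 6 - 2 * T (e 5) 7 - 2 * T (e 6) 4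
          - 4 * T (e 7) 5) *\<^sub>R e 7"
  unfolding fn23_def by (simp only: bracket_simps) (rule x_eq7I; simp only: x_linear x_frame; simp)

lemma fn23_13457:
  "fn23 cr Q ch R (e 1) (e 3) (e 4) (e 5) (e 7) =
      (- 4 * T (e 1) 4 + 2 * T (e 2) 7 - 4 * T (e 3) 6 + 4 * T (e 4) 1 - 2 * T (e 6) 3
          + 4 * T (e 7) 2) *\<^sub>R e 1
      + (- 2 * T (e 1) 7 - 4 * T (e 2) 4 - 2 * T (e 3) 5 - 2 * T (e 4) 2 + 2 * T (e 5) 3
          + 2 * T (e 7) 1) *\<^sub>R e 2
      + (4 * T (e 1) 6 + 2 * T (e 2) 5 - 4 * T (e 3) 4 + 4 * T (e 4) 3 + 4 * T (e 5) 2
          + 2 * T (e 6) 1) *\<^sub>R e 3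
      + (- 4 * T (e 1) 1 + 2 * T (e 2) 2 - 4 * T (e 3) 3 - 4 * T (e 4) 4 - 4 * T (e 5) 5
          + 2 * T (e 6) 6 - 4 * T (e 7) 7) *\<^sub>R e 4
      + (- 2 * T (e 2) 3 - 4 * T (e 3) 2 + 4 * T (e 4) 5 - 4 * T (e 5) 4 - 2 * T (e 6) 7
          - 4 * T (e 7) 6) *\<^sub>R e 5
      + (2 * T (e 1) 3 - 2 * T (e 3) 1 - 2 * T (e 4) 6 + 2 * T (e 5) 7 - 4 * T (e 6) 4
          - 2 * T (e 7) 5) *\<^sub>R e 6
      + (- 4 * T (e 1) 2 - 2 * T (e 2) 1 + 4 * T (e 4) 7 + 4 * T (e 5) 6 + 2 * T (e 6) 5
          - 4 * T (e 7) 4) *\<^sub>R e 7"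
  unfolding fn23_def by (simp only: bracket_simps) (rule x_eq7I; simp only: x_linear x_frame; simp)

lemma fn23_23456:
  "fn23 cr Q ch R (e 2) (e 3) (e 4) (e 5) (e 6) =
      (- 4 * T (e 1) 6 - 2 * T (e 2) 5 - 2 * T (e 3) 4 + 2 * T (e 4) 3 + 2 * T (e 5) 2
          - 2 * T (e 6) 1) *\<^sub>R e 1
      + (2 * T (e 1) 5 - 4 * T (e 2) 6 + 4 * T (e 3) 7 + 4 * T (e 5) 1 + 4 * T (e 6) 2
          + 2 * T (e 7) 3) *\<^sub>R e 2
      + (2 * T (e 1) 4 - 4 * T (e 2) 7 - 4 * T (e 3) 6 + 4 * T (e 4) 1 + 4 * T (e 6) 3
          - 2 * T (e 7) 2) *\<^sub>R e 3
      + (- 2 * T (e 1) 3 - 4 * T (e 3) 1 - 4 * T (e 4) 6 + 4 * T (e 5) 7 + 4 * T (e 6) 4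
          + 2 * T (e 7) 5) *\<^sub>R e 4
      + (- 2 * T (e 1) 2 - 4 * T (e 2) 1 - 4 * T (e 4) 7 - 4 * T (e 5) 6 + 4 * T (e 6) 5
          - 2 * T (e 7) 4) *\<^sub>R e 5
      + (2 * T (e 1) 1 - 4 * T (e 2) 2 - 4 * T (e 3) 3 - 4 * T (e 4) 4 - 4 * T (e 5) 5
          - 4 * T (e 6) 6 + 2 * T (e 7) 7) *\<^sub>R e 6
      + (- 2 * T (e 2) 3 + 2 * T (e 3) 2 - 2 * T (e 4) 5 + 2 * T (e 5) 4 - 2 * T (e 6) 7
          - 4 * T (e 7) 6) *\<^sub>R e 7"
  unfolding fn23_def by (simp only: bracket_simps) (rule x_eq7I; simp only: x_linear x_frame; simp)

lemma fn23_23457: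
  "fn23 cr Q ch R (e 2) (e 3) (e 4) (e 5) (e 7) =
      (- 4 * T (e 1) 7 - 2 * T (e 2) 4 + 2 * T (e 3) 5 + 2 * T (e 4) 2 - 2 * T (e 5) 3
          - 2 * T (e 7) 1) *\<^sub>R e 1
      + (2 * T (e 1) 4 - 4 * T (e 2) 7 - 4 * T (e 3) 6 + 4 * T (e 4) 1 - 2 * T (e 6) 3
          + 4 * T (e 7) 2) *\<^sub>R e 2
      + (- 2 * T (e 1) 5 + 4 * T (e 2) 6 - 4 * T (e 3) 7 - 4 * T (e 5) 1 + 2 * T (e 6) 2
          + 4 * T (e 7) 3) *\<^sub>R e 3
      + (- 2 * T (e 1) 2 - 4 * T (e 2) 1 - 4 * T (e 4) 7 - 4 * T (e 5) 6 - 2 * T (e 6) 5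
          + 4 * T (e 7) 4) *\<^sub>R e 4
      + (2 * T (e 1) 3 + 4 * T (e 3) 1 + 4 * T (e 4) 6 - 4 * T (e 5) 7 + 2 * T (e 6) 4
          + 4 * T (e 7) 5) *\<^sub>R e 5
      + (2 * T (e 2) 3 - 2 * T (e 3) 2 + 2 * T (e 4) 5 - 2 * T (e 5) 4 - 4 * T (e 6) 7
          - 2 * T (e 7) 6) *\<^sub>R e 6
      + (2 * T (e 1) 1 - 4 * T (e 2) 2 - 4 * T (e 3) 3 - 4 * T (e 4) 4 - 4 * T (e 5) 5
          + 2 * T (e 6) 6 - 4 * T (e 7) 7) *\<^sub>R e 7"
  unfolding fn23_def by (simp only: bracket_simps) (rule x_eq7I; simp only: x_linear x_frame; simp)

text \<open>The equations decouple into one system for the seven diagonal unknowns and seven systems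
  of six unknowns each. For every system as many coefficients are picked from the tables as there
  are unknowns, in such a way that the system is regular.\<close>

lemma fn23_imp_T_eq_0:
  assumes "\<And>a b c d e. fn23 cr Q ch R a b c d e = 0"
  shows "T (e i) m = 0"
proof -
  note c12345 = frame_coeffs[OF trans[OF fn23_12345[symmetric] assms]]
  note c12346 = frame_coeffs[OF trans[OF fn23_12346[symmetric] assms]]
  note c12347 = frame_coeffs[OF trans[OF fn23_12347[symmetric] assms]]
  note c12356 = frame_coeffs[OF trans[OF fn23_12356[symmetric] assms]]
  note c12357 = frame_coeffs[OF trans[OF fn23_12357[symmetric] assms]]
  note c12456 = frame_coeffs[OF trans[OF fn23_12456[symmetric] assms]]
  note c12457 = frame_coeffs[OF trans[OF fn23_12457[symmetric] assms]]
  note c12467 = frame_coeffs[OF trans[OF fn23_12467[symmetric] assms]]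
  note c13456 = frame_coeffs[OF trans[OF fn23_13456[symmetric] assms]]
  note c13457 = frame_coeffs[OF trans[OF fn23_13457[symmetric] assms]]
  note c23456 = frame_coeffs[OF trans[OF fn23_23456[symmetric] assms]]
  note c23457 = frame_coeffs[OF trans[OF fn23_23457[symmetric] assms]]
  have "T (e 1) 1 = 0" "T (e 2) 2 = 0" "T (e 3) 3 = 0" "T (e 4) 4 = 0"
    "T (e 5) 5 = 0" "T (e 6) 6 = 0" "T (e 7) 7 = 0"
    using c12345(1) c12346(2) c12347(3) c12356(3) c12456(4) c13456(5) c23456(6) by linarith+
  note z0 = this
  \<comment> \<open>These are the \<open>T (e i) m\<close> with \<open>e i \<times> e m\<close>
    equal to \<open>e 1\<close> up to sign. The blocks of \<open>e 2\<close> to \<open>e 7\<close>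
    follow in this order.\<close>
  have "T (e 2) 3 = 0" "T (e 3) 2 = 0" "T (e 4) 5 = 0" "T (e 5) 4 = 0"
    "T (e 6) 7 = 0" "T (e 7) 6 = 0"
    using c12346(3) c12347(2) c12356(2) c12456(5) c12467(7) c13456(4) by linarith+
  note z1 = this
  have "T (e 1) 3 = 0" "T (e 3) 1 = 0" "T (e 4) 6 = 0" "T (e 5) 7 = 0"
    "T (e 6) 4 = 0" "T (e 7) 5 = 0"
    using c12345(3) c12347(1) c12356(1) c12456(6) c12457(7) c23456(4) by linarith+
  note z2 = this
  have "T (e 1) 2 = 0" "T (e 2) 1 = 0" "T (e 4) 7 = 0" "T (e 5) 6 = 0"
    "T (e 6) 5 = 0" "T (e 7) 4 = 0"
    using c12345(2) c12346(1) c12357(1) c12456(7) c13456(6) c23456(5) by linarith+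
  note z3 = this
  have "T (e 1) 5 = 0" "T (e 2) 6 = 0" "T (e 3) 7 = 0" "T (e 5) 1 = 0"
    "T (e 6) 2 = 0" "T (e 7) 3 = 0"
    using c12345(5) c12346(6) c12347(7) c12457(1) c13456(1) c23456(2) by linarith+
  note z4 = this
  have "T (e 1) 4 = 0" "T (e 2) 7 = 0" "T (e 3) 6 = 0" "T (e 4) 1 = 0"
    "T (e 6) 3 = 0" "T (e 7) 2 = 0"
    using c12345(4) c12346(7) c12356(6) c12456(1) c13457(1) c23456(3) by linarith+
  note z5 = this
  have "T (e 1) 7 = 0" "T (e 2) 4 = 0" "T (e 3) 5 = 0" "T (e 4) 2 = 0"
    "T (e 5) 3 = 0" "T (e 7) 1 = 0"
    using c12345(7) c12346(4) c12356(5) c12456(2) c13456(3) c23457(1) by linarith+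
  note z6 = this
  have "T (e 1) 6 = 0" "T (e 2) 5 = 0" "T (e 3) 4 = 0" "T (e 4) 3 = 0"
    "T (e 5) 2 = 0" "T (e 6) 1 = 0"
    using c12345(6) c12346(5) c12356(4) c12456(3) c13456(2) c23456(1) by linarith+
  note z7 = this
  have "\<forall>i m. T (e i) m = 0"
    unfolding forall_7 using z0 z1 z2 z3 z4 z5 z6 z7 by blast
  then show ?thesis by blast
qed

section \<open>The bracket of \<chi> with itself on frame vectors\<close>

lemma fn33_234567:
  "fn33 ch R (e 2) (e 3) (e 4) (e 5) (e 6) (e 7) =
      (- 4 * T (e 1) 1) *\<^sub>R e 1
      + (- 2 * T (e 1) 2 - 2 * T (e 2) 1 - 3 * T (e 4) 7 - 3 * T (e 5) 6 + 3 * T (e 6) 5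
          + 3 * T (e 7) 4) *\<^sub>R e 2
      + (- 2 * T (e 1) 3 - 2 * T (e 3) 1 - 3 * T (e 4) 6 + 3 * T (e 5) 7 + 3 * T (e 6) 4
          - 3 * T (e 7) 5) *\<^sub>R e 3
      + (- 2 * T (e 1) 4 + 3 * T (e 2) 7 + 3 * T (e 3) 6 - 2 * T (e 4) 1 - 3 * T (e 6) 3
          - 3 * T (e 7) 2) *\<^sub>R e 4
      + (- 2 * T (e 1) 5 + 3 * T (e 2) 6 - 3 * T (e 3) 7 - 2 * T (e 5) 1 - 3 * T (e 6) 2
          + 3 * T (e 7) 3) *\<^sub>R e 5
      + (- 2 * T (e 1) 6 - 3 * T (e 2) 5 - 3 * T (e 3) 4 + 3 * T (e 4) 3 + 3 * T (e 5) 2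
          - 2 * T (e 6) 1) *\<^sub>R e 6
      + (- 2 * T (e 1) 7 - 3 * T (e 2) 4 + 3 * T (e 3) 5 + 3 * T (e 4) 2 - 3 * T (e 5) 3
          - 2 * T (e 7) 1) *\<^sub>R e 7"
  unfolding fn33_def by (simp only: bracket_simps) (rule x_eq7I; simp only: x_linear x_frame; simp)

lemma fn33_134567:
  "fn33 ch R (e 1) (e 3) (e 4) (e 5) (e 6) (e 7) =
      (2 * T (e 1) 2 + 2 * T (e 2) 1 - 3 * T (e 4) 7 - 3 * T (e 5) 6 + 3 * T (e 6) 5
          + 3 * T (e 7) 4) *\<^sub>R e 1
      + (4 * T (e 2) 2) *\<^sub>R e 2
      + (2 * T (e 2) 3 + 2 * T (e 3) 2 - 3 * T (e 4) 5 + 3 * T (e 5) 4 - 3 * T (e 6) 7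
          + 3 * T (e 7) 6) *\<^sub>R e 3
      + (3 * T (e 1) 7 + 2 * T (e 2) 4 + 3 * T (e 3) 5 + 2 * T (e 4) 2 - 3 * T (e 5) 3
          - 3 * T (e 7) 1) *\<^sub>R e 4
      + (3 * T (e 1) 6 + 2 * T (e 2) 5 - 3 * T (e 3) 4 + 3 * T (e 4) 3 + 2 * T (e 5) 2
          - 3 * T (e 6) 1) *\<^sub>R e 5
      + (- 3 * T (e 1) 5 + 2 * T (e 2) 6 + 3 * T (e 3) 7 + 3 * T (e 5) 1 + 2 * T (e 6) 2
          - 3 * T (e 7) 3) *\<^sub>R e 6
      + (- 3 * T (e 1) 4 + 2 * T (e 2) 7 - 3 * T (e 3) 6 + 3 * T (e 4) 1 + 3 * T (e 6) 3
          + 2 * T (e 7) 2) *\<^sub>R e 7"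
  unfolding fn33_def by (simp only: bracket_simps) (rule x_eq7I; simp only: x_linear x_frame; simp)

lemma fn33_124567:
  "fn33 ch R (e 1) (e 2) (e 4) (e 5) (e 6) (e 7) =
      (- 2 * T (e 1) 3 - 2 * T (e 3) 1 + 3 * T (e 4) 6 - 3 * T (e 5) 7 - 3 * T (e 6) 4
          + 3 * T (e 7) 5) *\<^sub>R e 1
      + (- 2 * T (e 2) 3 - 2 * T (e 3) 2 - 3 * T (e 4) 5 + 3 * T (e 5) 4 - 3 * T (e 6) 7
          + 3 * T (e 7) 6) *\<^sub>R e 2
      + (- 4 * T (e 3) 3) *\<^sub>R e 3
      + (- 3 * T (e 1) 6 + 3 * T (e 2) 5 - 2 * T (e 3) 4 - 2 * T (e 4) 3 - 3 * T (e 5) 2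
          + 3 * T (e 6) 1) *\<^sub>R e 4
      + (3 * T (e 1) 7 - 3 * T (e 2) 4 - 2 * T (e 3) 5 + 3 * T (e 4) 2 - 2 * T (e 5) 3
          - 3 * T (e 7) 1) *\<^sub>R e 5
      + (3 * T (e 1) 4 + 3 * T (e 2) 7 - 2 * T (e 3) 6 - 3 * T (e 4) 1 - 2 * T (e 6) 3
          - 3 * T (e 7) 2) *\<^sub>R e 6
      + (- 3 * T (e 1) 5 - 3 * T (e 2) 6 - 2 * T (e 3) 7 + 3 * T (e 5) 1 + 3 * T (e 6) 2
          - 2 * T (e 7) 3) *\<^sub>R e 7"
  unfolding fn33_def by (simp only: bracket_simps) (rule x_eq7I; simp only: x_linear x_frame; simp)

lemma fn33_123567:
  "fn33 ch R (e 1) (e 2) (e 3) (e 5) (e 6) (e 7) =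
      (2 * T (e 1) 4 + 3 * T (e 2) 7 + 3 * T (e 3) 6 + 2 * T (e 4) 1 - 3 * T (e 6) 3
          - 3 * T (e 7) 2) *\<^sub>R e 1
      + (- 3 * T (e 1) 7 + 2 * T (e 2) 4 - 3 * T (e 3) 5 + 2 * T (e 4) 2 + 3 * T (e 5) 3
          + 3 * T (e 7) 1) *\<^sub>R e 2
      + (- 3 * T (e 1) 6 + 3 * T (e 2) 5 + 2 * T (e 3) 4 + 2 * T (e 4) 3 - 3 * T (e 5) 2
          + 3 * T (e 6) 1) *\<^sub>R e 3
      + (4 * T (e 4) 4) *\<^sub>R e 4
      + (- 3 * T (e 2) 3 + 3 * T (e 3) 2 + 2 * T (e 4) 5 + 2 * T (e 5) 4 - 3 * T (e 6) 7
          + 3 * T (e 7) 6) *\<^sub>R e 5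
      + (3 * T (e 1) 3 - 3 * T (e 3) 1 + 2 * T (e 4) 6 + 3 * T (e 5) 7 + 2 * T (e 6) 4
          - 3 * T (e 7) 5) *\<^sub>R e 6
      + (3 * T (e 1) 2 - 3 * T (e 2) 1 + 2 * T (e 4) 7 - 3 * T (e 5) 6 + 3 * T (e 6) 5
          + 2 * T (e 7) 4) *\<^sub>R e 7"
  unfolding fn33_def by (simp only: bracket_simps) (rule x_eq7I; simp only: x_linear x_frame; simp)

lemma fn33_123467:
  "fn33 ch R (e 1) (e 2) (e 3) (e 4) (e 6) (e 7) =
      (- 2 * T (e 1) 5 - 3 * T (e 2) 6 + 3 * T (e 3) 7 - 2 * T (e 5) 1 + 3 * T (e 6) 2
          - 3 * T (e 7) 3) *\<^sub>R e 1
      + (3 * T (e 1) 6 - 2 * T (e 2) 5 - 3 * T (e 3) 4 + 3 * T (e 4) 3 - 2 * T (e 5) 2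
          - 3 * T (e 6) 1) *\<^sub>R e 2
      + (- 3 * T (e 1) 7 + 3 * T (e 2) 4 - 2 * T (e 3) 5 - 3 * T (e 4) 2 - 2 * T (e 5) 3
          + 3 * T (e 7) 1) *\<^sub>R e 3
      + (- 3 * T (e 2) 3 + 3 * T (e 3) 2 - 2 * T (e 4) 5 - 2 * T (e 5) 4 - 3 * T (e 6) 7
          + 3 * T (e 7) 6) *\<^sub>R e 4
      + (- 4 * T (e 5) 5) *\<^sub>R e 5
      + (- 3 * T (e 1) 2 + 3 * T (e 2) 1 + 3 * T (e 4) 7 - 2 * T (e 5) 6 - 2 * T (e 6) 5
          - 3 * T (e 7) 4) *\<^sub>R e 6
      + (3 * T (e 1) 3 - 3 * T (e 3) 1 - 3 * T (e 4) 6 - 2 * T (e 5) 7 + 3 * T (e 6) 4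
          - 2 * T (e 7) 5) *\<^sub>R e 7"
  unfolding fn33_def by (simp only: bracket_simps) (rule x_eq7I; simp only: x_linear x_frame; simp)

lemma fn33_123457:
  "fn33 ch R (e 1) (e 2) (e 3) (e 4) (e 5) (e 7) =
      (2 * T (e 1) 6 - 3 * T (e 2) 5 - 3 * T (e 3) 4 + 3 * T (e 4) 3 + 3 * T (e 5) 2
          + 2 * T (e 6) 1) *\<^sub>R e 1
      + (3 * T (e 1) 5 + 2 * T (e 2) 6 - 3 * T (e 3) 7 - 3 * T (e 5) 1 + 2 * T (e 6) 2
          + 3 * T (e 7) 3) *\<^sub>R e 2
      + (3 * T (e 1) 4 + 3 * T (e 2) 7 + 2 * T (e 3) 6 - 3 * T (e 4) 1 + 2 * T (e 6) 3
          - 3 * T (e 7) 2) *\<^sub>R e 3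
      + (- 3 * T (e 1) 3 + 3 * T (e 3) 1 + 2 * T (e 4) 6 - 3 * T (e 5) 7 + 2 * T (e 6) 4
          + 3 * T (e 7) 5) *\<^sub>R e 4
      + (- 3 * T (e 1) 2 + 3 * T (e 2) 1 + 3 * T (e 4) 7 + 2 * T (e 5) 6 + 2 * T (e 6) 5
          - 3 * T (e 7) 4) *\<^sub>R e 5
      + (4 * T (e 6) 6) *\<^sub>R e 6
      + (- 3 * T (e 2) 3 + 3 * T (e 3) 2 - 3 * T (e 4) 5 + 3 * T (e 5) 4 + 2 * T (e 6) 7
          + 2 * T (e 7) 6) *\<^sub>R e 7"
  unfolding fn33_def by (simp only: bracket_simps) (rule x_eq7I; simp only: x_linear x_frame; simp)

lemma fn33_123456:
  "fn33 ch R (e 1) (e 2) (e 3) (e 4) (e 5) (e 6) =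
      (- 2 * T (e 1) 7 + 3 * T (e 2) 4 - 3 * T (e 3) 5 - 3 * T (e 4) 2 + 3 * T (e 5) 3
          - 2 * T (e 7) 1) *\<^sub>R e 1
      + (- 3 * T (e 1) 4 - 2 * T (e 2) 7 - 3 * T (e 3) 6 + 3 * T (e 4) 1 + 3 * T (e 6) 3
          - 2 * T (e 7) 2) *\<^sub>R e 2
      + (3 * T (e 1) 5 + 3 * T (e 2) 6 - 2 * T (e 3) 7 - 3 * T (e 5) 1 - 3 * T (e 6) 2
          - 2 * T (e 7) 3) *\<^sub>R e 3
      + (3 * T (e 1) 2 - 3 * T (e 2) 1 - 2 * T (e 4) 7 - 3 * T (e 5) 6 + 3 * T (e 6) 5
          - 2 * T (e 7) 4) *\<^sub>R e 4
      + (- 3 * T (e 1) 3 + 3 * T (e 3) 1 + 3 * T (e 4) 6 - 2 * T (e 5) 7 - 3 * T (e 6) 4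
          - 2 * T (e 7) 5) *\<^sub>R e 5
      + (- 3 * T (e 2) 3 + 3 * T (e 3) 2 - 3 * T (e 4) 5 + 3 * T (e 5) 4 - 2 * T (e 6) 7
          - 2 * T (e 7) 6) *\<^sub>R e 6
      + (- 4 * T (e 7) 7) *\<^sub>R e 7"
  unfolding fn33_def by (simp only: bracket_simps) (rule x_eq7I; simp only: x_linear x_frame; simp)

text \<open>Omitting each of the seven frame vectors in turn gives exactly 49 equations for the 49
  unknowns. The diagonal unknowns stand alone: if \<open>e i\<close> is omitted, the coefficient of
  \<open>e i\<close> is \<open>4 * T (e i) i\<close> up to sign. Every other block has six
  equations.\<close>

lemma fn33_imp_T_eq_0:
  assumes "\<And>a b c d e f. fn33 ch R a b c d e f = 0"
  shows "T (e i) m = 0"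
proof -
  note c234567 = frame_coeffs[OF trans[OF fn33_234567[symmetric] assms]]
  note c134567 = frame_coeffs[OF trans[OF fn33_134567[symmetric] assms]]
  note c124567 = frame_coeffs[OF trans[OF fn33_124567[symmetric] assms]]
  note c123567 = frame_coeffs[OF trans[OF fn33_123567[symmetric] assms]]
  note c123467 = frame_coeffs[OF trans[OF fn33_123467[symmetric] assms]]
  note c123457 = frame_coeffs[OF trans[OF fn33_123457[symmetric] assms]]
  note c123456 = frame_coeffs[OF trans[OF fn33_123456[symmetric] assms]]
  have "T (e 1) 1 = 0" "T (e 2) 2 = 0" "T (e 3) 3 = 0" "T (e 4) 4 = 0"
    "T (e 5) 5 = 0" "T (e 6) 6 = 0" "T (e 7) 7 = 0"
    using c234567(1) c134567(2) c124567(3) c123567(4) c123467(5) c123457(6) c123456(7) by linarith+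
  note z0 = this
  have "T (e 2) 3 = 0" "T (e 3) 2 = 0" "T (e 4) 5 = 0" "T (e 5) 4 = 0"
    "T (e 6) 7 = 0" "T (e 7) 6 = 0"
    using c134567(3) c124567(2) c123567(5) c123467(4) c123457(7) c123456(6) by linarith+
  note z1 = this
  have "T (e 1) 3 = 0" "T (e 3) 1 = 0" "T (e 4) 6 = 0" "T (e 5) 7 = 0"
    "T (e 6) 4 = 0" "T (e 7) 5 = 0"
    using c234567(3) c124567(1) c123567(6) c123467(7) c123457(4) c123456(5) by linarith+
  note z2 = this
  have "T (e 1) 2 = 0" "T (e 2) 1 = 0" "T (e 4) 7 = 0" "T (e 5) 6 = 0"
    "T (e 6) 5 = 0" "T (e 7) 4 = 0"
    using c234567(2) c134567(1) c123567(7) c123467(6) c123457(5) c123456(4) by linarith+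
  note z3 = this
  have "T (e 1) 5 = 0" "T (e 2) 6 = 0" "T (e 3) 7 = 0" "T (e 5) 1 = 0"
    "T (e 6) 2 = 0" "T (e 7) 3 = 0"
    using c234567(5) c134567(6) c124567(7) c123467(1) c123457(2) c123456(3) by linarith+
  note z4 = this
  have "T (e 1) 4 = 0" "T (e 2) 7 = 0" "T (e 3) 6 = 0" "T (e 4) 1 = 0"
    "T (e 6) 3 = 0" "T (e 7) 2 = 0"
    using c234567(4) c134567(7) c124567(6) c123567(1) c123457(3) c123456(2) by linarith+
  note z5 = this
  have "T (e 1) 7 = 0" "T (e 2) 4 = 0" "T (e 3) 5 = 0" "T (e 4) 2 = 0"
    "T (e 5) 3 = 0" "T (e 7) 1 = 0"
    using c234567(7) c134567(4) c124567(5) c123567(2) c123467(3) c123456(1) by linarith+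
  note z6 = this
  have "T (e 1) 6 = 0" "T (e 2) 5 = 0" "T (e 3) 4 = 0" "T (e 4) 3 = 0"
    "T (e 5) 2 = 0" "T (e 6) 1 = 0"
    using c234567(6) c134567(5) c124567(4) c123567(3) c123467(2) c123457(1) by linarith+
  note z7 = this
  have "\<forall>i m. T (e i) m = 0"
    unfolding forall_7 using z0 z1 z2 z3 z4 z5 z6 z7 by blast
  then show ?thesis by blast
qed

end

section \<open>Covariant derivatives of the cross products\<close>

lemma differentiable_prod:
  fixes F :: "'i \<Rightarrow> 'a::real_normed_vector \<Rightarrow> real"
  assumes "\<And>i. i \<in> I \<Longrightarrow> F i differentiable (at x)"
  shows "(\<lambda>y. \<Prod>i\<in>I. F i y) differentiable (at x)"
  using has_derivative_prod[of I F "\<lambda>i. frechet_derivative (F i) (at x)" x UNIV] assms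
  by (auto simp: frechet_derivative_works[of "F _"] intro: differentiableI)

lemma differentiable_det:
  fixes A :: "'a::real_normed_vector \<Rightarrow> real^'n^'n"
  assumes "\<And>i j. (\<lambda>y. A y $ i $ j) differentiable (at x)"
  shows "(\<lambda>y. det (A y)) differentiable (at x)"
  unfolding det_def
  by (intro differentiable_sum ballI differentiable_mult differentiable_const differentiable_prod
      assms)
    (simp add: finite_permutations)

text \<open>By Cramer's rule the inverse of the Gram matrix acts through quotients of determinants,
  that is, of polynomials in differentiable entries.\<close>

lemma differentiable_sharp:
  fixes h :: "'b::real_normed_vector \<Rightarrow> real^'n::finite \<Rightarrow> real^'n \<Rightarrow> real"
  assumes S: "open S" "x \<in> S" and inv: "\<And>y. y \<in> S \<Longrightarrow> invertible (gram (h y))"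
    and diff: "\<And>u v. (\<lambda>y. h y u v) differentiable (at x)"
  shows "(\<lambda>y. sharp (h y) \<beta>) differentiable (at x)"
proof -
  let ?b = "\<chi> i. \<beta> (axis i 1)"
  let ?N = "\<lambda>y k. (\<chi> i j. if j = k then ?b $ i else gram (h y) $ i $ j)"
  have gram: "(\<lambda>y. gram (h y) $ i $ j) differentiable (at x)" for i j
    using diff by (simp add: gram_def)
  have "(\<lambda>y. ?N y k $ i $ j) differentiable (at x)" for i j k
    using gram[of i j] by (cases "j = k") simp_all
  then have num: "(\<lambda>y. det (?N y k)) differentiable (at x)" for k
    by (rule differentiable_det)
  have den: "(\<lambda>y. det (gram (h y))) differentiable (at x)"
    by (rule differentiable_det[OF gram])
  have "(\<lambda>y. \<Sum>k\<in>UNIV. (det (?N y k) / det (gram (h y))) *\<^sub>R (axis k 1 :: real^'n)) differentiable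
      (at x)"
    using inv[OF S(2)]
    by (intro differentiable_sum ballI differentiable_scaleR differentiable_divide num den
        differentiable_const)
      (auto simp: invertible_det_nz)
  then obtain D where D: "((\<lambda>y. \<Sum>k\<in>UNIV. (det (?N y k) / det (gram (h y))) *\<^sub>R (axis k 1 ::
      real^'n))
      has_derivative D) (at x)"
    unfolding differentiable_def by blast
  have "(\<Sum>k\<in>UNIV. (det (?N y k) / det (gram (h y))) *\<^sub>R (axis k 1 :: real^'n)) = sharp (h y) \<beta>"
    if "y \<in> S" for y
  proof -
    have d: "det (gram (h y)) \<noteq> 0" using inv[OF that] by (simp add: invertible_det_nz)
    have "gram (h y) *v sharp (h y) \<beta> = ?b"
      by (simp add: sharp_def matrix_vector_mul_assoc matrix_inv(1)[OF inv[OF that]])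
    then have "sharp (h y) \<beta> = (\<chi> k. det (?N y k) / det (gram (h y)))"
      unfolding cramer[OF d] .
    moreover have "v = (\<Sum>k\<in>UNIV. (v $ k) *\<^sub>R axis k 1)" for v :: "real^'n"
      using basis_expansion[of v] by (simp add: scalar_mult_eq_scaleR)
    ultimately show ?thesis
      by (metis (mono_tags, lifting) sum.cong vec_lambda_beta)
  qed
  from has_derivative_transform_within_open[OF D S this] show ?thesis
    unfolding differentiable_def by blast
qed

text \<open>This passes algebraic identities that hold at every point of an open set on to the
  derivatives.\<close>

lemma has_derivative_eq_0:
  assumes "open S" "x \<in> S" "\<And>y. y \<in> S \<Longrightarrow> F y = 0" "(F has_derivative F') (at x)"
  shows "F' u = 0"
proof -
  have "((\<lambda>_. 0) has_derivative F') (at x)"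
    by (rule has_derivative_transform_within_open[OF assms(4,1,2)]) (simp add: assms(3))
  then have "F' = (\<lambda>_. 0)" by (rule has_derivative_unique) (rule has_derivative_const)
  then show ?thesis by simp
qed

lemma has_derivative_linear_family:
  assumes S: "open S" "x \<in> S" and lin: "\<And>y. y \<in> S \<Longrightarrow> linear (B y)"
    and B: "\<And>z. ((\<lambda>y. B y z) has_derivative (\<lambda>u. B' u z)) (at x)"
  shows "linear (B' u)"
proof (rule linearI)
  show "B' u (z + z') = B' u z + B' u z'" for z z'
    using has_derivative_eq_0[OF S _ has_derivative_diff[OF has_derivative_diff[OF B[of "z
        + z'"] B[of z]] B[of z']]]
    by (simp add: linear_add[OF lin] diff_eq_eq add.commute)
  show "B' u (r *\<^sub>R z) = r *\<^sub>R B' u z" for r z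
    using has_derivative_eq_0[OF S _ has_derivative_diff[OF B[of "r *\<^sub>R z"]
        has_derivative_scaleR_right[OF B[of z]]]]
    by (simp add: linear_cmul[OF lin])
qed

text \<open>A Leibniz rule for a family known to be differentiable only at each fixed argument.
  Expanding \<open>w y\<close> in coordinates leaves finitely many fixed arguments, namely the
  coordinate vectors.\<close>

lemma has_derivative_linear_apply:
  fixes B :: "'a::real_normed_vector \<Rightarrow> real^'n \<Rightarrow> 'b::real_normed_vector"
  assumes S: "open S" "x \<in> S" and lin: "\<And>y. y \<in> S \<Longrightarrow> linear (B y)"
    and B: "\<And>z. ((\<lambda>y. B y z) has_derivative (\<lambda>u. B' u z)) (at x)"
    and w: "(w has_derivative w') (at x)"
  shows "((\<lambda>y. B y (w y)) has_derivative (\<lambda>u. B' u (w x) + B x (w' u))) (at x)"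
proof -
  have exp: "v = (\<Sum>k\<in>UNIV. (v $ k) *\<^sub>R axis k 1)" for v :: "real^'n"
    using basis_expansion[of v] by (simp add: scalar_mult_eq_scaleR)
  have app: "L v = (\<Sum>k\<in>UNIV. (v $ k) *\<^sub>R L (axis k 1))" if "linear L" for v and L :: "real^'n \<Rightarrow> 'b"
    by (subst exp[of v]) (simp add: linear_sum[OF that] linear_cmul[OF that])
  have linB': "linear (B' u)" for u
    by (rule has_derivative_linear_family[OF S lin B])
  have "((\<lambda>y. \<Sum>k\<in>UNIV. (w y $ k) *\<^sub>R B y (axis k 1)) has_derivative
      (\<lambda>u. \<Sum>k\<in>UNIV. (w x $ k) *\<^sub>R B' u (axis k 1) + (w' u $ k) *\<^sub>R B x (axis k 1))) (at x)"
    by (intro has_derivative_sum has_derivative_scaleR has_derivative_vec_nth w B)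
  then have "((\<lambda>y. \<Sum>k\<in>UNIV. (w y $ k) *\<^sub>R B y (axis k 1)) has_derivative
      (\<lambda>u. B' u (w x) + B x (w' u))) (at x)"
    unfolding sum.distrib app[OF linB', symmetric] app[OF lin[OF S(2)], symmetric] .
  then show ?thesis
    by (rule has_derivative_transform_within_open[OF _ S]) (simp add: app[OF lin, symmetric])
qed

lemma alt2_has_derivative:
  assumes S: "open S" "x \<in> S" and K: "\<And>y. y \<in> S \<Longrightarrow> alt2 (K y)"
    and D: "\<And>a b. ((\<lambda>y. K y a b) has_derivative (\<lambda>u. D u a b)) (at x)"
  shows "alt2 (D u)"
  unfolding alt2_def
proof (intro conjI allI)
  show "linear (\<lambda>a. D u a b)" for b
    by (rule has_derivative_linear_family[OF S, where B
        = "\<lambda>y a. K y a b"]) (rule alt2_linear[OF K] D, assumption?)+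
  show "linear (D u a)" for a
    by (rule has_derivative_linear_family[OF S, where B = "\<lambda>y. K y a" and B'
        = "\<lambda>u. D u a"]) (rule alt2_linear[OF K] D, assumption?)+
  show "D u a a = 0" for a
    by (rule has_derivative_eq_0[OF S alt2_same[OF K] D])
qed

lemma alt3_has_derivative:
  assumes S: "open S" "x \<in> S" and K: "\<And>y. y \<in> S \<Longrightarrow> alt3 (K y)"
    and D: "\<And>a b c. ((\<lambda>y. K y a b c) has_derivative (\<lambda>u. D u a b c)) (at x)"
  shows "alt3 (D u)"
  unfolding alt3_def
proof (intro conjI allI)
  show "alt2 (\<lambda>a b. D u a b c)" for c
    by (rule alt2_has_derivative[OF S, where K = "\<lambda>y a b. K y a b c" and D = "\<lambda>u a b. D u a b c"])
      (use K D in \<open>auto simp: alt3_def\<close>)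
  show "alt2 (D u a)" for a
    by (rule alt2_has_derivative[OF S, where K = "\<lambda>y. K y a" and D = "\<lambda>u. D u a"])
      (use K D in \<open>auto simp: alt3_def\<close>)
qed

lemma smooth_on_differentiable: "smooth_on f S \<Longrightarrow> x \<in> S \<Longrightarrow> f differentiable (at x)"
  unfolding smooth_on_def by (metis Ck_on.simps(2))

lemma smooth_on_const: "smooth_on (\<lambda>_. c) S"
proof -
  have "Ck_on k (\<lambda>_. c) S" for k and c :: 'b
    by (induction k arbitrary: c) (simp_all add: deriv_at_const)
  then show ?thesis by (simp add: smooth_on_def)
qed

section \<open>The structure in one chart: cross products and their covariant derivatives\<close>

locale g2_chart =
  fixes S :: "(real^7) set" and f :: "real^7 \<Rightarrow> (7, real) mform"
    and h :: "real^7 \<Rightarrow> real^7 \<Rightarrow> real^7 \<Rightarrow> real" and G :: "real^7 \<Rightarrow> real^7 \<Rightarrow> real^7 \<Rightarrow> real^7"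
  assumes open_S: "open S"
    and point: "y \<in> S \<Longrightarrow> \<exists>e. g2_point (f y) (h y) e"
    and f_diff: "y \<in> S \<Longrightarrow> (\<lambda>z. f z p) differentiable (at y)"
    and h_diff: "y \<in> S \<Longrightarrow> (\<lambda>z. h z u v) differentiable (at y)"
    and G_bil: "y \<in> S \<Longrightarrow> bilinear (G y)"
    and G_sym: "y \<in> S \<Longrightarrow> G y u v = G y v u"
    and metric: "y \<in> S \<Longrightarrow> deriv_at (\<lambda>z. h z v w) y u = h y (G y u v) w + h y v (G y u w)"
begin

text \<open>\<open>g2_point.cr\<close> depends on the form and the metric but not on the frame, so
  this is one function on the whole chart although frames are available only point by point.\<close>

definition cross2 where "cross2 y = g2_point.cr (f y) (h y)"

definition cross3 where "cross3 y = g2_point.ch (f y) (h y)"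

lemma cross_facts:
  assumes "y \<in> S"
  shows cross2_eq_delta_form: "delta_form (h y) (f y) w = cross2 y (w 0) (w 1)"
    and h_cross2: "h y (cross2 y a b) c = f y (case_nat c (case_nat a (\<lambda>_. b)))"
    and alt2_cross2: "alt2 (cross2 y)" and alt3_cross3: "alt3 (cross3 y)"
    and cross3_eq: "cross3 y a b c = h y a c *\<^sub>R b - h y a b *\<^sub>R c - cross2 y a (cross2 y b c)"
    and cross3_eq_delta_form: "- delta_form (h y) (hodge (h y) 3 (f y)) w
        = cross3 y (w 0) (w 1) (w 2)"
    and h_linear: "linear (h y a)" "linear (\<lambda>a. h y a b)"
    and alt3_h_cross2: "alt3 (\<lambda>a b c. h y (cross2 y a b) c)"
    and alternating_f: "alternating 3 (f y)"
    and invertible_gram: "invertible (gram (h y))"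
    and h_nondegenerate: "(\<And>b. h y a b = 0) \<Longrightarrow> a = 0"
proof -
  obtain e where "g2_point (f y) (h y) e" using point[OF assms] by blast
  then interpret g2_point "f y" "h y" e .
  show "delta_form (h y) (f y) w = cross2 y (w 0) (w 1)" "h y (cross2 y a b) c
      = f y (case_nat c (case_nat a (\<lambda>_. b)))"
    "alt2 (cross2 y)" "alt3 (\<lambda>a b c. h y (cross2 y a b) c)"
    unfolding cross2_def by (rule delta_form_eq_cr g_cr alt2_cr g_cr_alt3)+
  show "alt3 (cross3 y)" "cross3 y a b c = h y a c *\<^sub>R b - h y a b *\<^sub>R c
      - cross2 y a (cross2 y b c)"
    "- delta_form (h y) (hodge (h y) 3 (f y)) w = cross3 y (w 0) (w 1) (w 2)"
    unfolding cross3_def cross2_def by (rule alt3_ch ch_def three_fold_cross_eq[folded ch_def])+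
  show "linear (h y a)" "linear (\<lambda>a. h y a b)" "alternating 3 (f y)" "invertible (gram (h y))"
    by (rule linear_g alternating invertible_gram)+
  show "a = 0" if "\<And>b. h y a b = 0"
  proof (rule x_eqI)
    show "x i a = x i 0" for i
      using that[of "e i"] g_frame[of i a] sym[of a "e i"] by (simp add: linear_0[OF linear_x])
  qed
qed

text \<open>Differentiability is read off from the coordinate expression of
  \<open>delta_form\<close>, as the frames at different points need not fit together.\<close>

lemma cross2_differentiable:
  assumes y: "y \<in> S"
  shows "(\<lambda>z. cross2 z a b) differentiable (at y)"
proof -
  let ?w = "case_nat a (\<lambda>_. b)"
  have "(\<lambda>z. delta_form (h z) (f z) ?w) differentiable (at y)"
    unfolding delta_form_def
    by (intro differentiable_sum ballI differentiable_scaleR f_diff y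
        differentiable_sharp[OF open_S y] cross_facts h_diff) simp_all
  then obtain D where "((\<lambda>z. delta_form (h z) (f z) ?w) has_derivative D) (at y)"
    unfolding differentiable_def by blast
  then have "((\<lambda>z. cross2 z a b) has_derivative D) (at y)"
    by (rule has_derivative_transform_within_open[OF _ open_S y]) (simp add: cross2_eq_delta_form)
  then show ?thesis unfolding differentiable_def by blast
qed

definition dcross2 where "dcross2 y u a b = deriv_at (\<lambda>z. cross2 z a b) y u"

text \<open>The partial derivative of the formula \<open>cross3_eq\<close>, with the derivatives of
  the metric expressed through \<open>G\<close> by metric compatibility.\<close>

definition dcross3 where "dcross3 y u a b c =
   (h y (G y u a) c + h y a (G y u c)) *\<^sub>R b - (h y (G y u a) b + h y a (G y u b)) *\<^sub>R c
   - (dcross2 y u a (cross2 y b c) + cross2 y a (dcross2 y u b c))"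

definition nabla2 where "nabla2 y u a b = dcross2 y u a b + G y u (cross2 y a b)
    - cross2 y (G y u a) b - cross2 y a (G y u b)"

text \<open>The shape of \<open>R\<close>, with \<open>nabla2\<close> in place of \<open>Q\<close>.
  That this is the covariant derivative of the three-fold cross product is the content of
  \<open>dcross3_eq\<close>.\<close>

definition nabla3 where "nabla3 y u a b c = - nabla2 y u a (cross2 y b c)
    - cross2 y a (nabla2 y u b c)"

context
  fixes y assumes y: "y \<in> S"
begin

lemmas cross_facts_y = cross_facts[OF y]

lemma cross2_has_derivative: "((\<lambda>z. cross2 z a b) has_derivative (\<lambda>u. dcross2 y u a b)) (at y)"
  using cross2_differentiable[OF y, of a b] unfolding dcross2_def frechet_derivative_works .

lemma h_has_derivative: "((\<lambda>z. h z v w) has_derivative (\<lambda>u. h y (G y u v) w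
    + h y v (G y u w))) (at y)"
  using h_diff[OF y, of v w] unfolding frechet_derivative_works metric[OF y, symmetric] .

lemma alt2_dcross2: "alt2 (dcross2 y u)"
  by (rule alt2_has_derivative[OF open_S y alt2_cross2 cross2_has_derivative])

lemma linear_dcross2: "linear (\<lambda>u. dcross2 y u a b)"
  by (rule has_derivative_linear[OF cross2_has_derivative])

lemma cross3_has_derivative: "((\<lambda>z. cross3 z a b c) has_derivative (\<lambda>u. dcross3 y u a b c)) (at y)"
proof -
  have "((\<lambda>z. cross2 z a (cross2 z b c)) has_derivative (\<lambda>u. dcross2 y u a (cross2 y b c)
      + cross2 y a (dcross2 y u b c))) (at y)"
    by (rule has_derivative_linear_apply[OF open_S y, where B = "\<lambda>z. cross2 z a" and B'
        = "\<lambda>u. dcross2 y u a"])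
      (use alt2_linear(2)[OF alt2_cross2] cross2_has_derivative in auto)
  then have "((\<lambda>z. h z a c *\<^sub>R b - h z a b *\<^sub>R c
      - cross2 z a (cross2 z b c)) has_derivative (\<lambda>u. dcross3 y u a b c)) (at y)"
    unfolding dcross3_def
    by (intro has_derivative_diff has_derivative_scaleR_left h_has_derivative)
  then show ?thesis
    by (rule has_derivative_transform_within_open[OF _ open_S y]) (simp add: cross3_eq)
qed

lemma alt3_dcross3: "alt3 (dcross3 y u)"
  by (rule alt3_has_derivative[OF open_S y alt3_cross3 cross3_has_derivative])

lemma G_linear: "linear (G y u)" "linear (\<lambda>u. G y u v)"
  using G_bil[OF y] by (simp_all add: bilinear_def)

lemmas lin_add = alt2_linear[OF cross_facts_y(3), THEN linear_add] G_linear[THEN linear_add]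
  alt2_linear[OF alt2_dcross2, THEN linear_add] linear_dcross2[THEN linear_add]
      cross_facts_y(7,8)[THEN linear_add]

lemmas lin_cmul = alt2_linear[OF cross_facts_y(3), THEN linear_cmul] G_linear[THEN linear_cmul]
  alt2_linear[OF alt2_dcross2, THEN linear_cmul] linear_dcross2[THEN linear_cmul]
      cross_facts_y(7,8)[THEN linear_cmul]

lemmas lin_diff = alt2_linear[OF cross_facts_y(3), THEN linear_diff] G_linear[THEN linear_diff]
  alt2_linear[OF alt2_dcross2, THEN linear_diff] linear_dcross2[THEN linear_diff]
      cross_facts_y(7,8)[THEN linear_diff]

lemma alt2_nabla2: "alt2 (nabla2 y u)"
proof -
  have "cross2 y a (G y u a) = - cross2 y (G y u a) a" for a by (rule alt2_swap[OF
      cross_facts_y(3)])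
  then show ?thesis
    by (simp add: alt2_def linear_iff nabla2_def lin_add lin_cmul algebra_simps alt2_same[OF
        cross_facts_y(3)]
        alt2_same[OF alt2_dcross2] linear_0[OF G_linear(1)])
qed

lemma linear_nabla2: "linear (\<lambda>u. nabla2 y u a b)"
  by (simp add: linear_iff nabla2_def lin_add lin_cmul algebra_simps)

lemma dcross2_eq: "dcross2 y u a b = nabla2 y u a b - G y u (cross2 y a b) + cross2 y (G y u a) b
    + cross2 y a (G y u b)"
  by (simp add: nabla2_def)

lemma dcross3_eq: "dcross3 y u a b c =
    nabla3 y u a b c - G y u (cross3 y a b c) + cross3 y (G y u a) b c + cross3 y a (G y u b) c
        + cross3 y a b (G y u c)"
  unfolding dcross3_def nabla3_def cross3_eq[OF y] dcross2_eq
  by (simp add: lin_add lin_diff lin_cmul scaleR_add_left)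

lemma nabla2_cross2: "nabla2 y u a (cross2 y a b) = - cross2 y a (nabla2 y u a b)"
proof -
  \<comment> \<open>For equal first arguments the two connection terms with \<open>G\<close> in one
    of them cancel, and the other terms of \<open>dcross3_eq\<close> apart from
    \<open>nabla3\<close> vanish by alternation.\<close>
  have "cross3 y a (G y u a) b = - cross3 y (G y u a) a b" by (rule alt3_swap(1)[OF
      cross_facts_y(4)])
  then have "nabla3 y u a a b = 0"
    using dcross3_eq[of u a a b]
    by (simp add: alt3_same[OF cross_facts_y(4)] alt3_same[OF alt3_dcross3] linear_0[OF
        G_linear(1)])
  then have "- nabla2 y u a (cross2 y a b) = cross2 y a (nabla2 y u a b)"
    by (simp only: nabla3_def right_minus_eq)
  then show ?thesis by (metis minus_minus)
qed

lemma f_eq: "z \<in> S \<Longrightarrow> f z w = h z (cross2 z (w 1) (w 2)) (w 0)"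
  by (subst h_cross2, assumption, rule alternating_cong[OF alternating_f], assumption)
    (auto simp: nat_less_3_iff numeral_2_eq_2)

text \<open>Differentiate \<phi> as the metric applied to the cross product; since the metric is
  parallel, only the covariant derivative of the cross product remains. Cyclic symmetry of \<phi>
  puts the argument \<open>w 0\<close> into the slot of the metric.\<close>

lemma cov_deriv_eq:
  "deriv_at (\<lambda>z. f z w) y u - (\<Sum>i<3. f y (w(i := G y u (w i))))
      = h y (nabla2 y u (w 1) (w 2)) (w 0)"
proof -
  have "((\<lambda>z. h z (cross2 z (w 1) (w 2)) (w 0)) has_derivative
      (\<lambda>u. (h y (G y u (cross2 y (w 1) (w 2))) (w 0) + h y (cross2 y (w 1) (w 2)) (G y u (w 0)))
        + h y (dcross2 y u (w 1) (w 2)) (w 0))) (at y)"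
    by (rule has_derivative_linear_apply[OF open_S y, where B = "\<lambda>z v. h z v (w 0)"
          and B' = "\<lambda>u v. h y (G y u v) (w 0) + h y v (G y u (w 0))"])
      (use h_linear h_has_derivative cross2_has_derivative in auto)
  then have "((\<lambda>z. f z w) has_derivative
      (\<lambda>u. (h y (G y u (cross2 y (w 1) (w 2))) (w 0) + h y (cross2 y (w 1) (w 2)) (G y u (w 0)))
        + h y (dcross2 y u (w 1) (w 2)) (w 0))) (at y)"
    by (rule has_derivative_transform_within_open[OF _ open_S y]) (simp add: f_eq)
  then have "deriv_at (\<lambda>z. f z w) y u =
      (h y (G y u (cross2 y (w 1) (w 2))) (w 0) + h y (cross2 y (w 1) (w 2)) (G y u (w 0)))
        + h y (dcross2 y u (w 1) (w 2)) (w 0)"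
    by (simp only: frechet_derivative_at[symmetric])
  then show ?thesis
    by (simp add: numeral_3_eq_3 f_eq[OF y] nabla2_def lin_add lin_diff numeral_2_eq_2)
qed

text \<open>Near \<open>y\<close> the form is identically zero on \<open>b, a, b\<close>, so its
  derivative vanishes. The connection terms in the two outer slots cancel, and the one in the middle
  slot is zero.\<close>

lemma h_nabla2: "h y (nabla2 y u a b) b = 0"
proof -
  let ?w = "case_nat b (case_nat a (\<lambda>_. b)) :: nat \<Rightarrow> real^7"
  have w: "?w 0 = b" "?w 1 = a" "?w 2 = b" by (simp_all add: numeral_2_eq_2)
  obtain D where D: "((\<lambda>z. f z ?w) has_derivative D) (at y)"
    using f_diff[OF y, of ?w] unfolding differentiable_def by blast
  have "D u = 0"
    by (rule has_derivative_eq_0[OF open_S y _ D])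
      (rule alternating_eq_0[OF alternating_f, of _ 0 2], simp_all add: numeral_2_eq_2)
  then have d: "deriv_at (\<lambda>z. f z ?w) y u = 0"
    using frechet_derivative_at[OF D] by simp
  have s: "h y (cross2 y a (G y u b)) b = - h y (cross2 y a b) (G y u b)"
    by (rule alt3_swap(2)[OF cross_facts_y(9)])
  have "(\<Sum>i<3. f y (?w(i := G y u (?w i)))) = 0"
    unfolding f_eq[OF y] using s alt3_same(2)[OF cross_facts_y(9), of "G y u a" b]
    by (simp add: numeral_3_eq_3 numeral_2_eq_2)
  then show ?thesis using cov_deriv_eq[of ?w u] d by (simp add: w)
qed

lemma g2_torsion_nabla2:
  assumes "g2_point (f y) (h y) e"
  shows "g2_torsion (f y) (h y) e (nabla2 y)"
proof -
  interpret g2_point "f y" "h y" e by (rule assms)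
  show ?thesis
    by (intro g2_torsion.intro assms g2_torsion_axioms.intro linear_nabla2 alt2_nabla2 h_nabla2
        nabla2_cross2[unfolded cross2_def])
qed

lemma R_eq:
  assumes "g2_point (f y) (h y) e"
  shows "g2_torsion.R (f y) (h y) (nabla2 y) = nabla3 y"
proof -
  interpret g2_torsion "f y" "h y" e "nabla2 y" by (rule g2_torsion_nabla2[OF assms])
  show ?thesis by (intro ext) (simp add: R_def nabla3_def cross2_def)
qed

end

end

section \<open>The equivalence\<close>

context g2_chart
begin

text \<open>\<open>K\<close> and \<open>L\<close> are prescribed on \<open>S\<close> only, since the
  representative of a field is arbitrary outside the chart image; the openness of \<open>S\<close>
  makes this enough for their derivatives at \<open>y\<close>.\<close>

lemma fn_brackets_eq:
  assumes y: "y \<in> S"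
    and K: "\<And>z w. z \<in> S \<Longrightarrow> K z w = cross2 z (w 0) (w 1)"
    and L: "\<And>z w. z \<in> S \<Longrightarrow> L z w = cross3 z (w 0) (w 1) (w 2)"
  shows "fn_local 2 K 3 L y v = fn23 (cross2 y) (nabla2 y) (cross3 y) (nabla3 y) (v 0) (v 1) (v 2)
      (v 3) (v 4)"
    and "fn_local 3 L 3 L y v = 2 *\<^sub>R fn33 (cross3 y) (nabla3 y) (v 0) (v 1) (v 2) (v 3) (v 4) (v
        5)"
proof -
  have K': "K y = (\<lambda>w. cross2 y (w 0) (w 1))" "((\<lambda>z. K z w) has_derivative (\<lambda>u. dcross2 y u (w 0) (w
      1))) (at y)" for w
    using K[OF y] has_derivative_transform_within_open[OF cross2_has_derivative[OF y] open_S y, of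
        "w 0" "w 1" "\<lambda>z. K z w"] K
    by auto
  have L': "L y = (\<lambda>w. cross3 y (w 0) (w 1) (w 2))"
    "((\<lambda>z. L z w) has_derivative (\<lambda>u. dcross3 y u (w 0) (w 1) (w 2))) (at y)" for w
    using L[OF y] has_derivative_transform_within_open[OF cross3_has_derivative[OF y] open_S y, of
        "w 0" "w 1" "w 2" "\<lambda>z. L z w"] L
    by auto
  show "fn_local 2 K 3 L y v = fn23 (cross2 y) (nabla2 y) (cross3 y) (nabla3 y) (v 0) (v 1) (v 2) (v
      3) (v 4)"
    unfolding fn_local_2_3[OF K' L' alt2_cross2[OF y] alt2_dcross2[OF y] alt3_cross3[OF y]
        alt3_dcross3[OF y]]
    by (rule fn23_flat[where G = "G y", OF alt2_cross2[OF y] alt3_cross3[OF y] G_sym[OF y]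
        dcross2_eq[OF y] dcross3_eq[OF y]])
  show "fn_local 3 L 3 L y v = 2 *\<^sub>R fn33 (cross3 y) (nabla3 y) (v 0) (v 1) (v 2) (v 3) (v 4) (v 5)"
    unfolding fn_local_3_3[OF L' alt3_cross3[OF y] alt3_dcross3[OF y]]
    by (subst fn33_flat[where G = "G y", OF alt3_cross3[OF y] G_sym[OF y] dcross3_eq[OF y]]) (rule
        refl)
qed

lemma torsion_free_iff:
  assumes y: "y \<in> S"
    and K: "\<And>z w. z \<in> S \<Longrightarrow> K z w = cross2 z (w 0) (w 1)"
    and L: "\<And>z w. z \<in> S \<Longrightarrow> L z w = cross3 z (w 0) (w 1) (w 2)"
  shows "(\<forall>v :: nat \<Rightarrow> real^7. h y (nabla2 y (v 0) (v 2) (v 3)) (v 1)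
      = 0) \<longleftrightarrow> (\<forall>v. fn_local 2 K 3 L y v = 0)"
    and "(\<forall>v :: nat \<Rightarrow> real^7. h y (nabla2 y (v 0) (v 2) (v 3)) (v 1)
        = 0) \<longleftrightarrow> (\<forall>v. fn_local 3 L 3 L y v = 0)"
proof -
  obtain e where e: "g2_point (f y) (h y) e" using point[OF y] by blast
  interpret T: g2_torsion "f y" "h y" e "nabla2 y" by (rule g2_torsion_nabla2[OF y e])
  have eqs: "T.cr = cross2 y" "T.ch = cross3 y" "T.R = nabla3 y"
    using R_eq[OF y e] by (simp_all add: cross2_def cross3_def)
  have Q0: "(\<forall>v :: nat \<Rightarrow> real^7. h y (nabla2 y (v 0) (v 2) (v 3)) (v 1)
      = 0) \<longleftrightarrow> (\<forall>u a b. nabla2 y u a b = 0)" (is "?l \<longleftrightarrow> ?r")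
  proof
    assume l: ?l
    \<comment> \<open>The order of arguments is that of \<open>cov_deriv\<close>: the direction,
      then the slot paired by the metric, then the two slots of the cross product.\<close>
    have "h y (nabla2 y u a b) c = 0" for u a b c
      using l[rule_format, of "case_nat u (case_nat c (case_nat a (\<lambda>_. b)))"]
      by (simp add: numeral_2_eq_2 numeral_3_eq_3)
    then show ?r using h_nondegenerate[OF y] by blast
  qed (simp add: T.g_linear)
  have nabla3: "\<forall>u a b. nabla2 y u a b = 0 \<Longrightarrow> nabla3 y u a b c = 0" for u a b c
    by (simp add: nabla3_def linear_0[OF alt2_linear(2)[OF alt2_cross2[OF y]]])
  have z: "cross2 y 0 a = 0" "cross3 y 0 a b = 0" for a b
    using linear_0[OF alt2_linear(1)[OF alt2_cross2[OF y]]] linear_0[OF alt3_linear(1)[OF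
        alt3_cross3[OF y]]] by auto
  have "fn23 (cross2 y) (nabla2 y) (cross3 y) (nabla3 y) a b c d e'
      = 0" "fn33 (cross3 y) (nabla3 y) a b c d e' f' = 0"
    if "\<forall>u a b. nabla2 y u a b = 0" for a b c d e' f'
    using that nabla3[OF that] by (simp_all add: fn23_def fn33_def skew3_def skew4_def z)
  then have "fn_local 2 K 3 L y v = 0" "fn_local 3 L 3 L y v = 0"
    if "\<forall>u a b. nabla2 y u a b = 0" for v
    using that by (simp_all add: fn_brackets_eq[OF y K L])
  moreover have "nabla2 y u a b = 0" if "\<forall>v. fn_local 2 K 3 L y v = 0" for u a b
  proof -
    \<comment> \<open>Any five vectors begin some sequence, here one read off from a list;
      \<open>fn_brackets_eq\<close> looks at the first five entries only.\<close>
    have "fn23 T.cr (nabla2 y) T.ch T.R a b c d e' = 0" for a b c d e'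
      using that[rule_format, of "\<lambda>n. [a, b, c, d, e'] ! n"]
      by (simp add: fn_brackets_eq[OF y K L] eqs)
    then show ?thesis by (intro T.Q_eq_0 T.fn23_imp_T_eq_0)
  qed
  moreover have "nabla2 y u a b = 0" if "\<forall>v. fn_local 3 L 3 L y v = 0" for u a b
  proof -
    have "fn33 T.ch T.R a b c d e' f' = 0" for a b c d e' f'
      using that[rule_format, of "\<lambda>n. [a, b, c, d, e', f'] ! n"]
      by (simp add: fn_brackets_eq[OF y K L] eqs)
    then show ?thesis by (intro T.Q_eq_0 T.fn33_imp_T_eq_0)
  qed
  ultimately show "(\<forall>v :: nat \<Rightarrow> real^7. h y (nabla2 y (v 0) (v 2) (v 3)) (v 1)
      = 0) \<longleftrightarrow> (\<forall>v. fn_local 2 K 3 L y v = 0)"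
    and "(\<forall>v :: nat \<Rightarrow> real^7. h y (nabla2 y (v 0) (v 2) (v 3)) (v 1)
        = 0) \<longleftrightarrow> (\<forall>v. fn_local 3 L 3 L y v = 0)"
    unfolding Q0 by blast+
qed

end

text \<open>The conditions on the Levi-Civita connection are evaluated on constant vector fields.
  Their Lie brackets and derivatives vanish, so torsion-freeness becomes the symmetry of
  \<open>\<Gamma> c y\<close>, and metric compatibility becomes the formula for the derivative of
  the metric coefficients.\<close>

lemma g2_chart_of_structure:
  assumes M: "oriented_manifold X A" and \<phi>: "g2_structure A \<phi>" and g: "g2_metric A \<phi> g"
    and \<Gamma>: "levi_civita A g \<Gamma>" and c: "c \<in> A"
  shows "g2_chart (chart_image c) (\<phi> c) (g c) (\<Gamma> c)"
proof
  let ?S = "chart_image c"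
  show "open ?S"
    using M c by (auto simp: oriented_manifold_def chart_on_def)
  fix y assume y: "y \<in> ?S"
  have alt: "alternating 3 (\<phi> c y)" and sm: "smooth_on (\<lambda>x. \<phi> c x w) ?S" for w
    using \<phi> c y by (auto simp: g2_structure_def diff_form_def)
  have metric: "bilinear (g c y)" "g c y u v = g c y v u" "smooth_on (\<lambda>x. g c x u v) ?S" for u v
    using g c y by (auto simp: g2_metric_def riemannian_metric_def)
  obtain e where e: "g2_frame (\<phi> c y) e"
    using \<phi> c y by (auto simp: g2_structure_def)
  have "g c y (e i) (e j) = (if i = j then 1 else 0)" for i j
    using g c y e by (auto simp: g2_metric_def)
  then have "g2_point (\<phi> c y) (g c y) e"
    using alt e metric by unfold_locales auto
  then show "\<exists>e. g2_point (\<phi> c y) (g c y) e" by blast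
  show "(\<lambda>z. \<phi> c z p) differentiable (at y)" for p
    by (rule smooth_on_differentiable[OF sm y])
  show "(\<lambda>z. g c z u v) differentiable (at y)" for u v
    by (rule smooth_on_differentiable[OF metric(3) y])
  show bil: "bilinear (\<Gamma> c y)"
    using \<Gamma> c y by (auto simp: levi_civita_def affine_connection_def)
  have torsion: "cov_deriv_vec (\<Gamma> c) (\<lambda>_. u) (\<lambda>_. v) y - cov_deriv_vec (\<Gamma> c) (\<lambda>_. v) (\<lambda>_. u) y
      = lie_bracket (\<lambda>_. u) (\<lambda>_. v) y" for u v
    using \<Gamma> c y smooth_on_const[of u ?S] smooth_on_const[of v ?S] unfolding levi_civita_def by blast
  then show "\<Gamma> c y u v = \<Gamma> c y v u" for u v
    by (simp add: cov_deriv_vec_def lie_bracket_def deriv_at_const)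
  have "deriv_at (\<lambda>y. g c y v w) y u =
      g c y (cov_deriv_vec (\<Gamma> c) (\<lambda>_. u) (\<lambda>_. v) y) w
          + g c y v (cov_deriv_vec (\<Gamma> c) (\<lambda>_. u) (\<lambda>_. w) y)"
    for u v w
    using \<Gamma> c y smooth_on_const[of u ?S] smooth_on_const[of v ?S] smooth_on_const[of w ?S]
    unfolding levi_civita_def by blast
  then show "deriv_at (\<lambda>z. g c z v w) y u = g c y (\<Gamma> c y u v) w + g c y v (\<Gamma> c y u w)" for u v w
    by (simp add: cov_deriv_vec_def deriv_at_const)
qed

theorem theorem1p1:
  fixes X :: "'a topology"
    and A :: "('a, 7) chart set"
    and \<phi> :: "('a, 7, (7, real) mform) field"
    and g :: "('a, 7, real^7 \<Rightarrow> real^7 \<Rightarrow> real) field"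
    and \<Gamma> :: "('a, 7, real^7 \<Rightarrow> real^7 \<Rightarrow> real^7) field"
    and p :: 'a
  assumes "oriented_manifold X A"
    and "g2_structure A \<phi>"
    and "g2_metric A \<phi> g"
    and "levi_civita A g \<Gamma>"
    and "p \<in> topspace X"
  shows "(vanishes_at A p (cov_deriv \<Gamma> 3 \<phi>) \<longleftrightarrow>
            vanishes_at A p (fn_bracket 2 (two_fold_cross g \<phi>) 3 (three_fold_cross g \<phi>))) \<and>
         (vanishes_at A p (cov_deriv \<Gamma> 3 \<phi>) \<longleftrightarrow>
            vanishes_at A p (fn_bracket 3 (three_fold_cross g \<phi>) 3 (three_fold_cross g \<phi>)))"
proof -
  \<comment> \<open>The equivalences hold in each chart around \<open>p\<close> separately, and
    \<open>vanishes_at\<close> asks for all of these charts.\<close>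
  have "((\<forall>v. cov_deriv \<Gamma> 3 \<phi> c (snd c p) v = 0) \<longleftrightarrow>
      (\<forall>v. fn_bracket 2 (two_fold_cross g \<phi>) 3 (three_fold_cross g \<phi>) c (snd c p) v = 0)) \<and>
    ((\<forall>v. cov_deriv \<Gamma> 3 \<phi> c (snd c p) v = 0) \<longleftrightarrow>
      (\<forall>v. fn_bracket 3 (three_fold_cross g \<phi>) 3 (three_fold_cross g \<phi>) c (snd c p) v = 0))"
    if c: "c \<in> A" and p: "p \<in> fst c" for c
  proof -
    interpret g2_chart "chart_image c" "\<phi> c" "g c" "\<Gamma> c"
      by (rule g2_chart_of_structure[OF assms(1-4) c])
    have y: "snd c p \<in> chart_image c" using p by (simp add: chart_image_def)
    \<comment> \<open>\<open>cov_deriv\<close> takes the direction as argument 0, so the arguments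
      of \<phi> are shifted by one.\<close>
    have cov: "cov_deriv \<Gamma> 3 \<phi> c (snd c p) v = g c (snd c p) (nabla2 (snd c p) (v 0) (v 2) (v 3)) (v 1)" for v
      using cov_deriv_eq[OF y, of "\<lambda>n. v (Suc n)" "v 0"]
      by (simp add: cov_deriv_def numeral_2_eq_2 numeral_3_eq_3)
    have K: "two_fold_cross g \<phi> c z w = cross2 z (w 0) (w 1)" if "z \<in> chart_image c" for z w
      by (simp add: two_fold_cross_def cross2_eq_delta_form[OF that])
    have L: "three_fold_cross g \<phi> c z w = cross3 z (w 0) (w 1) (w 2)" if "z \<in> chart_image c" for z w
      by (simp add: three_fold_cross_def cross3_eq_delta_form[OF that])
    show ?thesis
      unfolding cov fn_bracket_def
      by (intro conjI torsion_free_iff[OF y K L])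
  qed
  then show ?thesis
    unfolding vanishes_at_def by blast
qed

end
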